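(* Let $(R,\mathfrak{m},k)$ be a local ring with $\mathfrak{m}^3=0$ and $2\cdot\mu(\mathfrak{m})\neq\lambda(R)$. Set $E:=E_R(k)$. Let $M$ be a nonzero homomorphic image of a finite direct sum of syzygy modules $\Omega_n^R(k)$ ($n\ge 0$) of $k$. If $\operatorname{Ext}_R^i(E,M)=0$ for three consecutive values of $i\ge 3$, then $R$ is Gorenstein.
   Context: All rings are commutative Noetherian local rings and all modules are finitely generated. $R$ has maximal ideal $\mathfrak{m}$ and residue field $k=R/\mathfrak{m}$. $E_R(k)$ is the injective hull of $k$ over $R$, $\mu(-)$ is the minimal number of generators and $\lambda(-)$ is length. For $n\ge 0$, $\Omega_n^R(k)$ is the $n$th syzygy module in a minimal free resolution of $k$, so $\Omega_0^R(k)=k$ and $\Omega_1^R(k)=\mathfrak{m}$. The direct sum may involve different values of $n$. "Three consecutive values of $i\ge 3$" means $i=j,j+1,j+2$ for some integer $j\ge 3$. *)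

theory Defs
  imports "HOL-Algebra.Algebra" "HOL-Library.Extended_Nat"
begin

section \<open>Modules\<close>

text \<open>
  The record type for modules extends the one for rings; its fields \<open>mult\<close> and \<open>one\<close> are not
  constrained by \<open>module\<close> and carry no meaning below.
\<close>

definition self_module :: "('a, 'r) ring_scheme \<Rightarrow> ('a, 'a) module" where
  "self_module R =
     \<lparr>carrier = carrier R, monoid.mult = monoid.mult R, one = one R, ring.zero = \<zero>\<^bsub>R\<^esub>, add = add R,
      smult = monoid.mult R\<rparr>"

definition rmod_hom ::
  "('a, 'r) ring_scheme \<Rightarrow> ('a, 'b) module \<Rightarrow> ('a, 'c) module \<Rightarrow> ('b \<Rightarrow> 'c) set" where
  "rmod_hom R A B =
     {f. f \<in> carrier A \<rightarrow> carrier B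
       \<and> (\<forall>x\<in>carrier A. \<forall>y\<in>carrier A. f (x \<oplus>\<^bsub>A\<^esub> y) = f x \<oplus>\<^bsub>B\<^esub> f y)
       \<and> (\<forall>r\<in>carrier R. \<forall>x\<in>carrier A. f (r \<odot>\<^bsub>A\<^esub> x) = r \<odot>\<^bsub>B\<^esub> f x)}"

definition rmod_kernel ::
  "('a, 'b) module \<Rightarrow> ('a, 'c) module \<Rightarrow> ('b \<Rightarrow> 'c) \<Rightarrow> 'b set" where
  "rmod_kernel A B f = {x \<in> carrier A. f x = \<zero>\<^bsub>B\<^esub>}"

definition rmod_isomorphic ::
  "('a, 'r) ring_scheme \<Rightarrow> ('a, 'b) module \<Rightarrow> ('a, 'c) module \<Rightarrow> bool" where
  "rmod_isomorphic R A B \<longleftrightarrow> (\<exists>f\<in>rmod_hom R A B. bij_betw f (carrier A) (carrier B))"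

definition quotient_module :: "('a, 'b) module \<Rightarrow> 'b set \<Rightarrow> ('a, 'b set) module" where
  "quotient_module M N =
     \<lparr>carrier = a_rcosets\<^bsub>M\<^esub> N, monoid.mult = undefined, one = undefined, ring.zero = N,
      add = set_add M, smult = (\<lambda>r Y. (\<Union>x\<in>Y. N +>\<^bsub>M\<^esub> r \<odot>\<^bsub>M\<^esub> x))\<rparr>"

text \<open>
  For a finite index set this is the direct sum. Elements are extensional functions (\<open>undefined\<close>
  off the index set), so that equality in the carrier is equality of components.
\<close>

definition finite_direct_sum :: "'i set \<Rightarrow> ('i \<Rightarrow> ('a, 'b) module) \<Rightarrow> ('a, 'i \<Rightarrow> 'b) module" where
  "finite_direct_sum I Y =
     \<lparr>carrier = (\<Pi>\<^sub>E i\<in>I. carrier (Y i)), monoid.mult = undefined, one = undefined,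
      ring.zero = (\<lambda>i\<in>I. \<zero>\<^bsub>Y i\<^esub>), add = (\<lambda>x y. \<lambda>i\<in>I. x i \<oplus>\<^bsub>Y i\<^esub> y i),
      smult = (\<lambda>r x. \<lambda>i\<in>I. r \<odot>\<^bsub>Y i\<^esub> x i)\<rparr>"

definition free_module :: "('a, 'r) ring_scheme \<Rightarrow> nat \<Rightarrow> ('a, nat \<Rightarrow> 'a) module" where
  "free_module R n = finite_direct_sum {..<n} (\<lambda>_. self_module R)"

definition hom_module ::
  "('a, 'r) ring_scheme \<Rightarrow> ('a, 'b) module \<Rightarrow> ('a, 'c) module \<Rightarrow> ('a, 'b \<Rightarrow> 'c) module" where
  "hom_module R A B =
     \<lparr>carrier = rmod_hom R A B \<inter> extensional (carrier A), monoid.mult = undefined, one = undefined,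
      ring.zero = (\<lambda>x\<in>carrier A. \<zero>\<^bsub>B\<^esub>), add = (\<lambda>f g. \<lambda>x\<in>carrier A. f x \<oplus>\<^bsub>B\<^esub> g x),
      smult = (\<lambda>r f. \<lambda>x\<in>carrier A. r \<odot>\<^bsub>B\<^esub> f x)\<rparr>"

definition generated_submodule ::
  "('a, 'r) ring_scheme \<Rightarrow> ('a, 'b) module \<Rightarrow> 'b set \<Rightarrow> 'b set" where
  "generated_submodule R M S = \<Inter>{N. submodule N R M \<and> S \<subseteq> N}"

text \<open>The value is meaningful for finitely generated modules only.\<close>

definition min_num_generators :: "('a, 'r) ring_scheme \<Rightarrow> ('a, 'b) module \<Rightarrow> nat" where
  "min_num_generators R M =
     (LEAST n. \<exists>S\<subseteq>carrier M. finite S \<and> card S = n \<and> generated_submodule R M S = carrier M)"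

text \<open>The length is the supremum of the lengths \<open>n\<close> of strict chains of submodules
  \<open>C 0 \<subset> \<dots> \<subset> C n\<close>.\<close>

definition module_length :: "('a, 'r) ring_scheme \<Rightarrow> ('a, 'b) module \<Rightarrow> enat" where
  "module_length R M =
     Sup {enat n | n. \<exists>C. (\<forall>i\<le>n. submodule (C i) R M) \<and> (\<forall>i<n. C i \<subset> C (Suc i))}"


section \<open>Local rings\<close>

definition noetherian_local_ring :: "('a, 'r) ring_scheme \<Rightarrow> 'a set \<Rightarrow> bool" where
  "noetherian_local_ring R m \<longleftrightarrow>
     cring R \<and> noetherian_ring R \<and> maximalideal m R \<and> (\<forall>J. maximalideal J R \<longrightarrow> J = m)"

definition residue_field_module :: "('a, 'r) ring_scheme \<Rightarrow> 'a set \<Rightarrow> ('a, 'a set) module" where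
  "residue_field_module R m = quotient_module (self_module R) m"

definition ideal_module :: "('a, 'r) ring_scheme \<Rightarrow> 'a set \<Rightarrow> ('a, 'a) module" where
  "ideal_module R I = (self_module R)\<lparr>carrier := I\<rparr>"


section \<open>Injective modules, injective hulls and Gorenstein rings\<close>

text \<open>
  A definition in HOL cannot quantify over types, so the extension property is required for all
  modules carried by subsets of the type below. For \<open>R \<noteq> 0\<close> these are, up to isomorphism, all
  \<open>R\<close>-modules of cardinality at most that of this type; they include the quotients of
  the modules \<open>R\<^sup>n\<close>, i.e. all finitely generated modules. The lemma
  \<open>injective_module_extend\<close> shows that the extension property then holds for modules carried by
  arbitrary types.
\<close>

type_synonym 'a module_universe = "(nat \<Rightarrow> 'a) set"

definition injective_module :: "('a, 'r) ring_scheme \<Rightarrow> ('a, 'e) module \<Rightarrow> bool" where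
  "injective_module R E \<longleftrightarrow> module R E \<and>
     (\<forall>(A :: ('a, 'a module_universe) module) (B :: ('a, 'a module_universe) module) f g.
        module R A \<and> module R B \<and> f \<in> rmod_hom R A B \<and> inj_on f (carrier A) \<and> g \<in> rmod_hom R A E
        \<longrightarrow> (\<exists>h\<in>rmod_hom R B E. \<forall>x\<in>carrier A. h (f x) = g x))"

lemma self_module_simps [simp]:
  "carrier (self_module R) = carrier R" "\<zero>\<^bsub>self_module R\<^esub> = \<zero>\<^bsub>R\<^esub>"
  "x \<oplus>\<^bsub>self_module R\<^esub> y = x \<oplus>\<^bsub>R\<^esub> y" "r \<odot>\<^bsub>self_module R\<^esub> x = r \<otimes>\<^bsub>R\<^esub> x"
  by (simp_all add: self_module_def)

lemma module_self_module:
  assumes "cring R" shows "module R (self_module R)"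
proof -
  interpret cring R by fact
  have "abelian_group (self_module R)"
  proof (rule abelian_groupI)
    fix x assume "x \<in> carrier (self_module R)"
    then show "\<exists>y\<in>carrier (self_module R). y \<oplus>\<^bsub>self_module R\<^esub> x = \<zero>\<^bsub>self_module R\<^esub>"
      by (intro bexI[of _ "\<ominus>\<^bsub>R\<^esub> x"]) (simp_all add: l_neg)
  qed (simp_all add: a_ac)
  then show ?thesis
    by (intro moduleI assms) (simp_all add: m_assoc l_distr r_distr)
qed

text \<open>Transport of structure along an injection into another type.\<close>

lemma module_transport:
  fixes A :: "('a, 'b) module" and h :: "'b \<Rightarrow> 'u"
  assumes A: "module R A" and inj: "inj_on h (carrier A)"
  obtains A' :: "('a, 'u) module" where "module R A'" "h \<in> rmod_hom R A A'"
    "the_inv_into (carrier A) h \<in> rmod_hom R A' A" "carrier A' = h ` carrier A"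
proof -
  interpret module R A by fact
  define k where "k = the_inv_into (carrier A) h"
  have k: "k (h x) = x" if "x \<in> carrier A" for x
    unfolding k_def using inj that by (rule the_inv_into_f_f)
  define A' :: "('a, 'u) module" where "A' =
    \<lparr>carrier = h ` carrier A, monoid.mult = undefined, one = undefined, ring.zero = h \<zero>\<^bsub>A\<^esub>,
     add = (\<lambda>x y. h (k x \<oplus>\<^bsub>A\<^esub> k y)), smult = (\<lambda>r x. h (r \<odot>\<^bsub>A\<^esub> k x))\<rparr>"
  have sel: "carrier A' = h ` carrier A" "\<zero>\<^bsub>A'\<^esub> = h \<zero>\<^bsub>A\<^esub>"
    "x \<oplus>\<^bsub>A'\<^esub> y = h (k x \<oplus>\<^bsub>A\<^esub> k y)" "r \<odot>\<^bsub>A'\<^esub> x = h (r \<odot>\<^bsub>A\<^esub> k x)" for x y r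
    by (simp_all add: A'_def)
  have "abelian_group A'"
  proof (rule abelian_groupI)
    fix x assume "x \<in> carrier A'"
    then obtain a where "a \<in> carrier A" "x = h a" by (auto simp: sel)
    then show "\<exists>y\<in>carrier A'. y \<oplus>\<^bsub>A'\<^esub> x = \<zero>\<^bsub>A'\<^esub>"
      by (intro bexI[of _ "h (\<ominus>\<^bsub>A\<^esub> a)"]) (simp_all add: sel k M.l_neg)
  next
    fix x y assume "x \<in> carrier A'" "y \<in> carrier A'"
    then obtain a c where "a \<in> carrier A" "c \<in> carrier A" "x = h a" "y = h c"
      by (auto simp: sel)
    then show "x \<oplus>\<^bsub>A'\<^esub> y = y \<oplus>\<^bsub>A'\<^esub> x" by (simp add: sel k M.a_comm)
  qed (auto simp: sel k M.a_assoc)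
  then have "module R A'"
    by (intro moduleI R.is_cring)
      (auto simp: sel k smult_l_distr smult_r_distr smult_assoc1)
  moreover have "h \<in> rmod_hom R A A'" "k \<in> rmod_hom R A' A"
    by (auto simp: rmod_hom_def sel k)
  ultimately show ?thesis using that sel(1) unfolding k_def by blast
qed

lemma rmod_hom_comp:
  "f \<in> rmod_hom R A B \<Longrightarrow> g \<in> rmod_hom R B C \<Longrightarrow> (\<lambda>x. g (f x)) \<in> rmod_hom R A C"
  by (auto simp: rmod_hom_def Pi_iff)

lemma injective_module_extend_small:
  fixes A :: "('a, 'b) module" and B :: "('a, 'c) module" and E :: "('a, 'e) module"
    and u :: "'b \<Rightarrow> 'a module_universe" and v :: "'c \<Rightarrow> 'a module_universe"
  assumes E: "injective_module R E" and A: "module R A" and B: "module R B"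
    and u: "inj_on u (carrier A)" and v: "inj_on v (carrier B)"
    and f: "f \<in> rmod_hom R A B" "inj_on f (carrier A)" and g: "g \<in> rmod_hom R A E"
  obtains h where "h \<in> rmod_hom R B E" "\<And>x. x \<in> carrier A \<Longrightarrow> h (f x) = g x"
proof -
  obtain A' :: "('a, 'a module_universe) module" where A': "module R A'" "u \<in> rmod_hom R A A'"
    "the_inv_into (carrier A) u \<in> rmod_hom R A' A" "carrier A' = u ` carrier A"
    using module_transport[OF A u] .
  obtain B' :: "('a, 'a module_universe) module" where B': "module R B'" "v \<in> rmod_hom R B B'"
    "the_inv_into (carrier B) v \<in> rmod_hom R B' B" "carrier B' = v ` carrier B"
    using module_transport[OF B v] .
  let ?k = "the_inv_into (carrier A) u"
  let ?f = "\<lambda>x. v (f (?k x))"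
  have k: "?k (u x) = x" if "x \<in> carrier A" for x
    using u that by (rule the_inv_into_f_f)
  have fc: "f x \<in> carrier B" if "x \<in> carrier A" for x
    using f(1) that by (auto simp: rmod_hom_def)
  have "?f \<in> rmod_hom R A' B'"
    by (rule rmod_hom_comp[OF A'(3) rmod_hom_comp[OF f(1) B'(2)]])
  moreover have "inj_on ?f (carrier A')"
  proof (rule inj_onI)
    fix x y assume "x \<in> carrier A'" "y \<in> carrier A'" and eq: "?f x = ?f y"
    then obtain a c where *: "a \<in> carrier A" "c \<in> carrier A" "x = u a" "y = u c"
      by (auto simp: A'(4))
    then have "v (f a) = v (f c)" using eq by (simp add: k)
    then have "f a = f c" using inj_onD[OF v] fc[OF *(1)] fc[OF *(2)] by blast
    then show "x = y" using inj_onD[OF f(2) _ *(1,2)] *(3,4) by simp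
  qed
  moreover have "(\<lambda>x. g (?k x)) \<in> rmod_hom R A' E"
    by (rule rmod_hom_comp[OF A'(3) g])
  ultimately obtain h where h: "h \<in> rmod_hom R B' E" "\<forall>x\<in>carrier A'. h (?f x) = g (?k x)"
    using E A'(1) B'(1) unfolding injective_module_def by blast
  show ?thesis
  proof (rule that)
    show "(\<lambda>y. h (v y)) \<in> rmod_hom R B E"
      by (rule rmod_hom_comp[OF B'(2) h(1)])
    fix x assume "x \<in> carrier A"
    then show "h (v (f x)) = g x" using h(2) by (auto simp: A'(4) k)
  qed
qed

theorem injective_module_extend:
  fixes A :: "('a, 'b) module" and B :: "('a, 'c) module" and E :: "('a, 'e) module"
  assumes inj: "injective_module R E" and A: "module R A" and B: "module R B"
    and f: "f \<in> rmod_hom R A B" "inj_on f (carrier A)" and g: "g \<in> rmod_hom R A E"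
  shows "\<exists>h\<in>rmod_hom R B E. \<forall>x\<in>carrier A. h (f x) = g x"
proof -
  have E: "module R E" using inj by (simp add: injective_module_def)
  interpret A: module R A by fact
  interpret B: module R B by fact
  interpret E: module R E by fact
  interpret self: module R "self_module R" by (rule module_self_module) (rule A.R.is_cring)
  note fD = f(1)[unfolded rmod_hom_def, simplified]
  note gD = g[unfolded rmod_hom_def, simplified]
  have fc [simp]: "f x \<in> carrier B" if "x \<in> carrier A" for x using fD that by auto
  have gc [simp]: "g x \<in> carrier E" if "x \<in> carrier A" for x using gD that by auto
  define ok where "ok G \<longleftrightarrow> G \<subseteq> carrier B \<times> carrier E \<and> (\<forall>x\<in>carrier A. (f x, g x) \<in> G)
      \<and> (\<forall>v. (\<zero>\<^bsub>B\<^esub>, v) \<in> G \<longrightarrow> v = \<zero>\<^bsub>E\<^esub>)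
      \<and> (\<forall>x u y v. (x, u) \<in> G \<longrightarrow> (y, v) \<in> G \<longrightarrow> (x \<oplus>\<^bsub>B\<^esub> y, u \<oplus>\<^bsub>E\<^esub> v) \<in> G)
      \<and> (\<forall>r x u. r \<in> carrier R \<longrightarrow> (x, u) \<in> G \<longrightarrow> (r \<odot>\<^bsub>B\<^esub> x, r \<odot>\<^bsub>E\<^esub> u) \<in> G)" for G
  have f0: "f \<zero>\<^bsub>A\<^esub> = \<zero>\<^bsub>B\<^esub>"
    using fD A.M.zero_closed A.R.zero_closed A.smult_l_null[of "\<zero>\<^bsub>A\<^esub>"]
      B.smult_l_null[of "f \<zero>\<^bsub>A\<^esub>"] by (metis fc)
  have "\<exists>G\<in>Collect ok. \<forall>G'\<in>Collect ok. G \<subseteq> G' \<longrightarrow> G' = G"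
  proof (rule subset_Zorn_nonempty)
    have "ok ((\<lambda>x. (f x, g x)) ` carrier A)"
      unfolding ok_def
    proof (intro conjI allI impI)
      fix v assume "(\<zero>\<^bsub>B\<^esub>, v) \<in> (\<lambda>x. (f x, g x)) ` carrier A"
      then obtain x where x: "x \<in> carrier A" "f x = \<zero>\<^bsub>B\<^esub>" "v = g x" by auto
      with f(2) f0 have "x = \<zero>\<^bsub>A\<^esub>" by (metis A.M.zero_closed inj_onD)
      then show "v = \<zero>\<^bsub>E\<^esub>"
        using x gD A.M.zero_closed A.R.zero_closed A.smult_l_null[of x] E.smult_l_null[of v]
        by (metis gc)
    next
      fix x u y v
      assume "(x, u) \<in> (\<lambda>x. (f x, g x)) ` carrier A" "(y, v) \<in> (\<lambda>x. (f x, g x)) ` carrier A"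
      then obtain a b where "a \<in> carrier A" "b \<in> carrier A" "x = f a" "u = g a" "y = f b" "v = g b"
        by auto
      then show "(x \<oplus>\<^bsub>B\<^esub> y, u \<oplus>\<^bsub>E\<^esub> v) \<in> (\<lambda>x. (f x, g x)) ` carrier A"
        using fD gD by (intro image_eqI[of _ _ "a \<oplus>\<^bsub>A\<^esub> b"]) auto
    next
      fix r x u assume "r \<in> carrier R" "(x, u) \<in> (\<lambda>x. (f x, g x)) ` carrier A"
      then obtain a where "a \<in> carrier A" "x = f a" "u = g a" "r \<in> carrier R"
        by auto
      then show "(r \<odot>\<^bsub>B\<^esub> x, r \<odot>\<^bsub>E\<^esub> u) \<in> (\<lambda>x. (f x, g x)) ` carrier A"
        using fD gD by (intro image_eqI[of _ _ "r \<odot>\<^bsub>A\<^esub> a"]) auto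
    qed auto
    then show "Collect ok \<noteq> {}" by blast
  next
    fix \<C> assume C: "\<C> \<noteq> {}" "subset.chain (Collect ok) \<C>"
    have okC: "ok G" if "G \<in> \<C>" for G using C(2) that by (auto simp: subset.chain_def)
    have "ok (\<Union>\<C>)"
      unfolding ok_def
    proof (intro conjI allI impI ballI)
      show "\<Union>\<C> \<subseteq> carrier B \<times> carrier E" using okC unfolding ok_def by blast
    next
      fix x assume "x \<in> carrier A"
      then show "(f x, g x) \<in> \<Union>\<C>" using okC C(1) unfolding ok_def by blast
    next
      fix v assume "(\<zero>\<^bsub>B\<^esub>, v) \<in> \<Union>\<C>"
      then show "v = \<zero>\<^bsub>E\<^esub>" using okC unfolding ok_def by blast
    next
      fix x u y v assume "(x, u) \<in> \<Union>\<C>" "(y, v) \<in> \<Union>\<C>"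
      then obtain G where "G \<in> \<C>" "(x, u) \<in> G" "(y, v) \<in> G"
        using subset.chain_total[OF C(2)] by blast
      then show "(x \<oplus>\<^bsub>B\<^esub> y, u \<oplus>\<^bsub>E\<^esub> v) \<in> \<Union>\<C>" using okC[of G] unfolding ok_def by blast
    next
      fix r x u assume "r \<in> carrier R" "(x, u) \<in> \<Union>\<C>"
      then show "(r \<odot>\<^bsub>B\<^esub> x, r \<odot>\<^bsub>E\<^esub> u) \<in> \<Union>\<C>" using okC unfolding ok_def by blast
    qed
    then show "\<Union>\<C> \<in> Collect ok" by simp
  qed
  then obtain G where G: "ok G" and Gmax: "\<And>G'. ok G' \<Longrightarrow> G \<subseteq> G' \<Longrightarrow> G' = G" by auto
  have GB: "x \<in> carrier B" and GE: "u \<in> carrier E" if "(x, u) \<in> G" for x u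
    using G that unfolding ok_def by auto
  have Gfg: "(f x, g x) \<in> G" if "x \<in> carrier A" for x using G that unfolding ok_def by auto
  have G0: "v = \<zero>\<^bsub>E\<^esub>" if "(\<zero>\<^bsub>B\<^esub>, v) \<in> G" for v using G that unfolding ok_def by auto
  have Gadd: "(x \<oplus>\<^bsub>B\<^esub> y, u \<oplus>\<^bsub>E\<^esub> v) \<in> G" if "(x, u) \<in> G" "(y, v) \<in> G" for x u y v
    using G that unfolding ok_def by blast
  have Gsm: "(r \<odot>\<^bsub>B\<^esub> x, r \<odot>\<^bsub>E\<^esub> u) \<in> G" if "r \<in> carrier R" "(x, u) \<in> G" for r x u
    using G that unfolding ok_def by blast
  have Gneg: "(\<ominus>\<^bsub>B\<^esub> x, \<ominus>\<^bsub>E\<^esub> u) \<in> G" if "(x, u) \<in> G" for x u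
    using Gsm[OF _ that, of "\<ominus>\<^bsub>R\<^esub> \<one>\<^bsub>R\<^esub>"] GB[OF that] GE[OF that]
    by (simp add: B.smult_l_minus E.smult_l_minus)
  have Guniq: "u = v" if "(x, u) \<in> G" "(x, v) \<in> G" for x u v
  proof -
    have "u \<oplus>\<^bsub>E\<^esub> \<ominus>\<^bsub>E\<^esub> v = \<zero>\<^bsub>E\<^esub>"
      using Gadd[OF that(1) Gneg[OF that(2)]] GB[OF that(1)] by (intro G0) (simp add: B.M.r_neg)
    then show ?thesis using GE[OF that(1)] GE[OF that(2)] 
      by (metis E.M.a_inv_closed E.M.minus_equality E.M.minus_minus)
  qed
  have Gzero: "(\<zero>\<^bsub>B\<^esub>, \<zero>\<^bsub>E\<^esub>) \<in> G"
    using Gsm[OF A.R.zero_closed Gfg[OF A.M.zero_closed]] by simp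
  have dom: "b \<in> Domain G" if b: "b \<in> carrier B" for b
  proof -
    define I where "I = {r \<in> carrier R. r \<odot>\<^bsub>B\<^esub> b \<in> Domain G}"
    define \<phi> where "\<phi> r = (THE v. (r \<odot>\<^bsub>B\<^esub> b, v) \<in> G)" for r
    have \<phi>: "\<phi> r = v" if "(r \<odot>\<^bsub>B\<^esub> b, v) \<in> G" for r v
      unfolding \<phi>_def using that Guniq by blast
    let ?I = "(self_module R)\<lparr>carrier := I\<rparr>"
    have "submodule I R (self_module R)"
    proof (rule self.submoduleI)
      fix a assume a: "a \<in> I"
      then obtain u where "a \<in> carrier R" "(a \<odot>\<^bsub>B\<^esub> b, u) \<in> G" by (auto simp: I_def)
      moreover have "\<ominus>\<^bsub>self_module R\<^esub> a = \<ominus>\<^bsub>R\<^esub> a"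
        using \<open>a \<in> carrier R\<close> self.M.minus_equality[of "\<ominus>\<^bsub>R\<^esub> a" a] by (simp add: A.R.l_neg)
      ultimately show "\<ominus>\<^bsub>self_module R\<^esub> a \<in> I"
        using Gneg[of "a \<odot>\<^bsub>B\<^esub> b" u] b by (auto simp: I_def B.smult_l_minus)
    next
      fix a c assume "a \<in> I" "c \<in> I"
      then obtain u v where "a \<in> carrier R" "(a \<odot>\<^bsub>B\<^esub> b, u) \<in> G"
        "c \<in> carrier R" "(c \<odot>\<^bsub>B\<^esub> b, v) \<in> G" by (auto simp: I_def)
      then show "a \<oplus>\<^bsub>self_module R\<^esub> c \<in> I"
        using Gadd[of "a \<odot>\<^bsub>B\<^esub> b" u "c \<odot>\<^bsub>B\<^esub> b" v] b by (auto simp: I_def B.smult_l_distr)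
    next
      fix r a assume "r \<in> carrier R" "a \<in> I"
      then obtain u where "r \<in> carrier R" "a \<in> carrier R" "(a \<odot>\<^bsub>B\<^esub> b, u) \<in> G"
        by (auto simp: I_def)
      then show "r \<odot>\<^bsub>self_module R\<^esub> a \<in> I"
        using Gsm[of r "a \<odot>\<^bsub>B\<^esub> b" u] b by (auto simp: I_def B.smult_assoc1)
    qed (use Gzero b in \<open>auto simp: I_def\<close>)
    then have modI: "module R ?I"
      using self.module_axioms by (rule submodule.submodule_is_module)
    have incl: "(\<lambda>r. r) \<in> rmod_hom R ?I (self_module R)"
      by (auto simp: rmod_hom_def I_def)
    have "\<phi> \<in> rmod_hom R ?I E"
      unfolding rmod_hom_def
    proof (intro CollectI conjI ballI Pi_I)
      fix a assume "a \<in> carrier ?I"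
      then obtain u where "(a \<odot>\<^bsub>B\<^esub> b, u) \<in> G" by (auto simp: I_def)
      then show "\<phi> a \<in> carrier E" using \<phi> GE by blast
    next
      fix a c assume "a \<in> carrier ?I" "c \<in> carrier ?I"
      then obtain u v where *: "a \<in> carrier R" "(a \<odot>\<^bsub>B\<^esub> b, u) \<in> G"
        "c \<in> carrier R" "(c \<odot>\<^bsub>B\<^esub> b, v) \<in> G" by (auto simp: I_def)
      then have "((a \<oplus>\<^bsub>R\<^esub> c) \<odot>\<^bsub>B\<^esub> b, u \<oplus>\<^bsub>E\<^esub> v) \<in> G"
        using Gadd[of "a \<odot>\<^bsub>B\<^esub> b" u "c \<odot>\<^bsub>B\<^esub> b" v] b by (auto simp: B.smult_l_distr)
      then show "\<phi> (a \<oplus>\<^bsub>?I\<^esub> c) = \<phi> a \<oplus>\<^bsub>E\<^esub> \<phi> c"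
        using \<phi>[OF *(2)] \<phi>[OF *(4)] \<phi>[of "a \<oplus>\<^bsub>R\<^esub> c"] by simp
    next
      fix r a assume "r \<in> carrier R" "a \<in> carrier ?I"
      then obtain u where *: "r \<in> carrier R" "a \<in> carrier R" "(a \<odot>\<^bsub>B\<^esub> b, u) \<in> G"
        by (auto simp: I_def)
      then have "((r \<otimes>\<^bsub>R\<^esub> a) \<odot>\<^bsub>B\<^esub> b, r \<odot>\<^bsub>E\<^esub> u) \<in> G"
        using Gsm[of r "a \<odot>\<^bsub>B\<^esub> b" u] b by (auto simp: B.smult_assoc1)
      then show "\<phi> (r \<odot>\<^bsub>?I\<^esub> a) = r \<odot>\<^bsub>E\<^esub> \<phi> a"
        using \<phi>[OF *(3)] \<phi>[of "r \<otimes>\<^bsub>R\<^esub> a"] by simp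
    qed
    then obtain \<psi> where \<psi>: "\<psi> \<in> rmod_hom R (self_module R) E" "\<And>r. r \<in> I \<Longrightarrow> \<psi> r = \<phi> r"
      using injective_module_extend_small[OF inj modI self.module_axioms, of
          "\<lambda>r. {\<lambda>_. r}" "\<lambda>r. {\<lambda>_. r}" "\<lambda>r. r" \<phi>] incl
      by (auto simp: inj_on_def fun_eq_iff)
    define e where "e = \<psi> \<one>\<^bsub>R\<^esub>"
    have e: "e \<in> carrier E" using \<psi>(1) by (auto simp: e_def rmod_hom_def)
    have \<psi>e: "\<psi> r = r \<odot>\<^bsub>E\<^esub> e" if "r \<in> carrier R" for r
    proof -
      have "\<forall>r\<in>carrier R. \<forall>x\<in>carrier R. \<psi> (r \<otimes>\<^bsub>R\<^esub> x) = r \<odot>\<^bsub>E\<^esub> \<psi> x"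
        using \<psi>(1) unfolding rmod_hom_def by simp
      from bspec[OF bspec[OF this that] A.R.one_closed]
      have "\<psi> (r \<otimes>\<^bsub>R\<^esub> \<one>\<^bsub>R\<^esub>) = r \<odot>\<^bsub>E\<^esub> \<psi> \<one>\<^bsub>R\<^esub>" .
      then show ?thesis using that by (simp add: e_def)
    qed
    define G' where "G' = {(x \<oplus>\<^bsub>B\<^esub> r \<odot>\<^bsub>B\<^esub> b, u \<oplus>\<^bsub>E\<^esub> r \<odot>\<^bsub>E\<^esub> e) | x u r. (x, u) \<in> G \<and> r \<in> carrier R}"
    have sub: "G \<subseteq> G'"
    proof
      fix z assume "z \<in> G"
      then show "z \<in> G'" unfolding G'_def using b e GB GE
        by (cases z) (auto intro!: exI[of _ "fst z"] exI[of _ "snd z"] exI[of _ "\<zero>\<^bsub>R\<^esub>"])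
    qed
    have "ok G'"
      unfolding ok_def
    proof (intro conjI allI impI ballI)
      show "G' \<subseteq> carrier B \<times> carrier E" using b e GB GE by (auto simp: G'_def)
    next
      fix x assume "x \<in> carrier A"
      then show "(f x, g x) \<in> G'" using Gfg sub by blast
    next
      fix v assume "(\<zero>\<^bsub>B\<^esub>, v) \<in> G'"
      then obtain x u r where *: "(x, u) \<in> G" "r \<in> carrier R" "\<zero>\<^bsub>B\<^esub> = x \<oplus>\<^bsub>B\<^esub> r \<odot>\<^bsub>B\<^esub> b"
        "v = u \<oplus>\<^bsub>E\<^esub> r \<odot>\<^bsub>E\<^esub> e" by (auto simp: G'_def)
      have x: "x \<in> carrier B" and u: "u \<in> carrier E" using GB GE *(1) by auto
      have "r \<odot>\<^bsub>B\<^esub> b = \<ominus>\<^bsub>B\<^esub> x"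
        using *(2,3) b x by (metis B.M.a_comm B.M.minus_equality B.smult_closed)
      then have neg: "(r \<odot>\<^bsub>B\<^esub> b, \<ominus>\<^bsub>E\<^esub> u) \<in> G" using Gneg[OF *(1)] by simp
      then have "r \<in> I" using *(2) by (auto simp: I_def)
      then have "r \<odot>\<^bsub>E\<^esub> e = \<ominus>\<^bsub>E\<^esub> u" using \<phi>[OF neg] \<psi>(2) \<psi>e[OF *(2)] by simp
      then show "v = \<zero>\<^bsub>E\<^esub>" using *(4) u by (simp add: E.M.r_neg)
    next
      fix x u y v assume "(x, u) \<in> G'" "(y, v) \<in> G'"
      then obtain x1 u1 r y1 v1 t where *: "(x1, u1) \<in> G" "r \<in> carrier R"
        "x = x1 \<oplus>\<^bsub>B\<^esub> r \<odot>\<^bsub>B\<^esub> b" "u = u1 \<oplus>\<^bsub>E\<^esub> r \<odot>\<^bsub>E\<^esub> e" "(y1, v1) \<in> G" "t \<in> carrier R"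
        "y = y1 \<oplus>\<^bsub>B\<^esub> t \<odot>\<^bsub>B\<^esub> b" "v = v1 \<oplus>\<^bsub>E\<^esub> t \<odot>\<^bsub>E\<^esub> e" by (auto simp: G'_def)
      have "x \<oplus>\<^bsub>B\<^esub> y = (x1 \<oplus>\<^bsub>B\<^esub> y1) \<oplus>\<^bsub>B\<^esub> (r \<oplus>\<^bsub>R\<^esub> t) \<odot>\<^bsub>B\<^esub> b"
        using * GB[OF *(1)] GB[OF *(5)] b by (simp add: B.smult_l_distr B.M.a_ac)
      moreover have "u \<oplus>\<^bsub>E\<^esub> v = (u1 \<oplus>\<^bsub>E\<^esub> v1) \<oplus>\<^bsub>E\<^esub> (r \<oplus>\<^bsub>R\<^esub> t) \<odot>\<^bsub>E\<^esub> e"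
        using * GE[OF *(1)] GE[OF *(5)] e by (simp add: E.smult_l_distr E.M.a_ac)
      ultimately show "(x \<oplus>\<^bsub>B\<^esub> y, u \<oplus>\<^bsub>E\<^esub> v) \<in> G'"
        using Gadd[OF *(1,5)] *(2,6) unfolding G'_def by blast
    next
      fix c x u assume c: "c \<in> carrier R" and "(x, u) \<in> G'"
      then obtain x1 u1 r where *: "(x1, u1) \<in> G" "r \<in> carrier R"
        "x = x1 \<oplus>\<^bsub>B\<^esub> r \<odot>\<^bsub>B\<^esub> b" "u = u1 \<oplus>\<^bsub>E\<^esub> r \<odot>\<^bsub>E\<^esub> e" by (auto simp: G'_def)
      have "c \<odot>\<^bsub>B\<^esub> x = c \<odot>\<^bsub>B\<^esub> x1 \<oplus>\<^bsub>B\<^esub> (c \<otimes>\<^bsub>R\<^esub> r) \<odot>\<^bsub>B\<^esub> b"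
        using * GB[OF *(1)] b c by (simp add: B.smult_r_distr B.smult_assoc1)
      moreover have "c \<odot>\<^bsub>E\<^esub> u = c \<odot>\<^bsub>E\<^esub> u1 \<oplus>\<^bsub>E\<^esub> (c \<otimes>\<^bsub>R\<^esub> r) \<odot>\<^bsub>E\<^esub> e"
        using * GE[OF *(1)] e c by (simp add: E.smult_r_distr E.smult_assoc1)
      moreover have "c \<otimes>\<^bsub>R\<^esub> r \<in> carrier R" using c *(2) by simp
      ultimately show "(c \<odot>\<^bsub>B\<^esub> x, c \<odot>\<^bsub>E\<^esub> u) \<in> G'"
        using Gsm[OF c *(1)] unfolding G'_def by blast
    qed
    then have "G' = G" using sub by (rule Gmax)
    moreover have "(\<zero>\<^bsub>B\<^esub> \<oplus>\<^bsub>B\<^esub> \<one>\<^bsub>R\<^esub> \<odot>\<^bsub>B\<^esub> b, \<zero>\<^bsub>E\<^esub> \<oplus>\<^bsub>E\<^esub> \<one>\<^bsub>R\<^esub> \<odot>\<^bsub>E\<^esub> e) \<in> G'"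
      unfolding G'_def using Gzero by blast
    ultimately show ?thesis using b by (auto simp: Domain_iff)
  qed
  define h where "h x = (THE v. (x, v) \<in> G)" for x
  have h: "h x = v" if "(x, v) \<in> G" for x v
    unfolding h_def using that Guniq by blast
  have hG: "(x, h x) \<in> G" if "x \<in> carrier B" for x
    using dom[OF that] h by blast
  have "h \<in> rmod_hom R B E"
    unfolding rmod_hom_def
  proof (intro CollectI conjI ballI Pi_I)
    fix x assume "x \<in> carrier B"
    then show "h x \<in> carrier E" by (rule GE[OF hG])
  next
    fix x y assume "x \<in> carrier B" "y \<in> carrier B"
    then show "h (x \<oplus>\<^bsub>B\<^esub> y) = h x \<oplus>\<^bsub>E\<^esub> h y" by (intro h Gadd hG)
  next
    fix r x assume "r \<in> carrier R" "x \<in> carrier B"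
    then show "h (r \<odot>\<^bsub>B\<^esub> x) = r \<odot>\<^bsub>E\<^esub> h x" by (intro h Gsm hG)
  qed
  then show ?thesis using h Gfg by blast
qed


definition injective_hull ::
  "('a, 'r) ring_scheme \<Rightarrow> ('a, 'b) module \<Rightarrow> ('a, 'e) module \<Rightarrow> bool" where
  "injective_hull R N E \<longleftrightarrow> injective_module R E \<and>
     (\<exists>\<iota>\<in>rmod_hom R N E. inj_on \<iota> (carrier N) \<and>
        (\<forall>L. submodule L R E \<and> L \<noteq> {\<zero>\<^bsub>E\<^esub>} \<longrightarrow> L \<inter> \<iota> ` carrier N \<noteq> {\<zero>\<^bsub>E\<^esub>}))"

definition injective_resolution ::
  "('a, 'r) ring_scheme \<Rightarrow> ('a, 'b) module \<Rightarrow> (nat \<Rightarrow> ('a, 'c) module) \<Rightarrow> ('b \<Rightarrow> 'c)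
    \<Rightarrow> (nat \<Rightarrow> 'c \<Rightarrow> 'c) \<Rightarrow> bool" where
  "injective_resolution R N I \<eta> d \<longleftrightarrow>
     (\<forall>i. injective_module R (I i))
     \<and> \<eta> \<in> rmod_hom R N (I 0) \<and> inj_on \<eta> (carrier N)
     \<and> (\<forall>i. d i \<in> rmod_hom R (I i) (I (Suc i)))
     \<and> \<eta> ` carrier N = rmod_kernel (I 0) (I 1) (d 0)
     \<and> (\<forall>i. d i ` carrier (I i) = rmod_kernel (I (Suc i)) (I (Suc (Suc i))) (d (Suc i)))"

text \<open>
  Again the terms of the resolution are taken in \<^typ>\<open>'a module_universe\<close>. This suffices for a
  finitely generated module over a Noetherian ring: the terms of its minimal injective
  resolution are direct sums of injective hulls of modules \<open>R/P\<close> with finite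
  multiplicities, and hence of cardinality at most \<open>max |R| \<aleph>\<^sub>0\<close>.
\<close>

definition finite_injective_dimension ::
  "('a, 'r) ring_scheme \<Rightarrow> ('a, 'b) module \<Rightarrow> bool" where
  "finite_injective_dimension R N \<longleftrightarrow>
     (\<exists>(I :: nat \<Rightarrow> ('a, 'a module_universe) module) \<eta> d n.
        injective_resolution R N I \<eta> d \<and> (\<forall>i>n. carrier (I i) = {\<zero>\<^bsub>I i\<^esub>}))"

definition gorenstein_local_ring :: "('a, 'r) ring_scheme \<Rightarrow> 'a set \<Rightarrow> bool" where
  "gorenstein_local_ring R m \<longleftrightarrow>
     noetherian_local_ring R m \<and> finite_injective_dimension R (self_module R)"


section \<open>Free resolutions, syzygies and Ext\<close>

text \<open>
  Resolutions by finitely generated free modules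
  \<open>\<dots> \<rightarrow> R\<^bsup>b 2\<^esup> \<rightarrow> R\<^bsup>b 1\<^esup> \<rightarrow> R\<^bsup>b 0\<^esup> \<rightarrow> N \<rightarrow> 0\<close>, where \<open>d i\<close> maps \<open>R\<^bsup>b (i+1)\<^esup>\<close> to \<open>R\<^bsup>b i\<^esup>\<close>.
\<close>

definition free_resolution ::
  "('a, 'r) ring_scheme \<Rightarrow> ('a, 'b) module \<Rightarrow> (nat \<Rightarrow> nat) \<Rightarrow> ((nat \<Rightarrow> 'a) \<Rightarrow> 'b)
    \<Rightarrow> (nat \<Rightarrow> (nat \<Rightarrow> 'a) \<Rightarrow> (nat \<Rightarrow> 'a)) \<Rightarrow> bool" where
  "free_resolution R N b \<epsilon> d \<longleftrightarrow>
     \<epsilon> \<in> rmod_hom R (free_module R (b 0)) N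
     \<and> \<epsilon> ` carrier (free_module R (b 0)) = carrier N
     \<and> (\<forall>i. d i \<in> rmod_hom R (free_module R (b (Suc i))) (free_module R (b i)))
     \<and> d 0 ` carrier (free_module R (b 1)) = rmod_kernel (free_module R (b 0)) N \<epsilon>
     \<and> (\<forall>i. d (Suc i) ` carrier (free_module R (b (Suc (Suc i)))) =
             rmod_kernel (free_module R (b (Suc i))) (free_module R (b i)) (d i))"

text \<open>Minimality over a local ring: the image of \<open>d i\<close> lies in \<open>\<mm>R\<^bsup>b i\<^esup>\<close>, the set of tuples
  with all entries in \<open>\<mm>\<close>.\<close>

definition minimal_free_resolution ::
  "('a, 'r) ring_scheme \<Rightarrow> 'a set \<Rightarrow> ('a, 'b) module \<Rightarrow> (nat \<Rightarrow> nat) \<Rightarrow> ((nat \<Rightarrow> 'a) \<Rightarrow> 'b)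
    \<Rightarrow> (nat \<Rightarrow> (nat \<Rightarrow> 'a) \<Rightarrow> (nat \<Rightarrow> 'a)) \<Rightarrow> bool" where
  "minimal_free_resolution R m N b \<epsilon> d \<longleftrightarrow>
     free_resolution R N b \<epsilon> d
     \<and> (\<forall>i. d i ` carrier (free_module R (b (Suc i))) \<subseteq> {..<b i} \<rightarrow>\<^sub>E m)"

text \<open>
  Syzygies are defined up to isomorphism. The zeroth syzygy of \<open>N\<close> is \<open>N\<close>, the \<open>(i+1)\<close>st one is
  the image of \<open>d i\<close>, i.e. for \<open>i = 0\<close> the kernel of \<open>\<epsilon>\<close> and otherwise the kernel of \<open>d (i-1)\<close>.
\<close>

definition is_syzygy ::
  "('a, 'r) ring_scheme \<Rightarrow> 'a set \<Rightarrow> ('a, 'b) module \<Rightarrow> nat \<Rightarrow> ('a, 'c) module \<Rightarrow> bool" where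
  "is_syzygy R m N n Y \<longleftrightarrow> module R Y \<and>
     (case n of
        0 \<Rightarrow> rmod_isomorphic R Y N
      | Suc i \<Rightarrow> \<exists>b \<epsilon> d. minimal_free_resolution R m N b \<epsilon> d \<and>
          rmod_isomorphic R Y
            ((free_module R (b i))\<lparr>carrier := d i ` carrier (free_module R (b (Suc i)))\<rparr>))"

text \<open>
  The cochain complex \<open>Hom\<^sub>R(R\<^bsup>b 0\<^esup>, M) \<rightarrow> Hom\<^sub>R(R\<^bsup>b 1\<^esup>, M) \<rightarrow> \<dots>\<close> with \<open>f \<mapsto> f \<circ> d i\<close>
  in degree \<open>i\<close>.
\<close>

definition hom_coboundary ::
  "('a, 'r) ring_scheme \<Rightarrow> (nat \<Rightarrow> nat) \<Rightarrow> (nat \<Rightarrow> (nat \<Rightarrow> 'a) \<Rightarrow> (nat \<Rightarrow> 'a))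
    \<Rightarrow> nat \<Rightarrow> ((nat \<Rightarrow> 'a) \<Rightarrow> 'c) \<Rightarrow> ((nat \<Rightarrow> 'a) \<Rightarrow> 'c)" where
  "hom_coboundary R b d i f = (\<lambda>x\<in>carrier (free_module R (b (Suc i))). f (d i x))"

definition hom_cocycles ::
  "('a, 'r) ring_scheme \<Rightarrow> (nat \<Rightarrow> nat) \<Rightarrow> (nat \<Rightarrow> (nat \<Rightarrow> 'a) \<Rightarrow> (nat \<Rightarrow> 'a))
    \<Rightarrow> ('a, 'c) module \<Rightarrow> nat \<Rightarrow> ((nat \<Rightarrow> 'a) \<Rightarrow> 'c) set" where
  "hom_cocycles R b d M i =
     rmod_kernel (hom_module R (free_module R (b i)) M)
       (hom_module R (free_module R (b (Suc i))) M) (hom_coboundary R b d i)"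

definition hom_coboundaries ::
  "('a, 'r) ring_scheme \<Rightarrow> (nat \<Rightarrow> nat) \<Rightarrow> (nat \<Rightarrow> (nat \<Rightarrow> 'a) \<Rightarrow> (nat \<Rightarrow> 'a))
    \<Rightarrow> ('a, 'c) module \<Rightarrow> nat \<Rightarrow> ((nat \<Rightarrow> 'a) \<Rightarrow> 'c) set" where
  "hom_coboundaries R b d M i =
     (case i of
        0 \<Rightarrow> {\<zero>\<^bsub>hom_module R (free_module R (b 0)) M\<^esub>}
      | Suc l \<Rightarrow> hom_coboundary R b d l ` carrier (hom_module R (free_module R (b l)) M))"

definition hom_cohomology ::
  "('a, 'r) ring_scheme \<Rightarrow> (nat \<Rightarrow> nat) \<Rightarrow> (nat \<Rightarrow> (nat \<Rightarrow> 'a) \<Rightarrow> (nat \<Rightarrow> 'a))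
    \<Rightarrow> ('a, 'c) module \<Rightarrow> nat \<Rightarrow> ('a, ((nat \<Rightarrow> 'a) \<Rightarrow> 'c) set) module" where
  "hom_cohomology R b d M i =
     quotient_module
       ((hom_module R (free_module R (b i)) M)\<lparr>carrier := hom_cocycles R b d M i\<rparr>)
       (hom_coboundaries R b d M i)"

text \<open>
  \<open>Ext\<^sup>i\<^sub>R(N, M)\<close>, computed from a chosen resolution of \<open>N\<close> by finitely generated free modules.
  The value is meaningful for finitely generated \<open>N\<close> over a Noetherian ring \<open>R\<close>, where such a
  resolution exists; its isomorphism class does not depend on the choice.
\<close>

definition ext_module ::
  "('a, 'r) ring_scheme \<Rightarrow> ('a, 'b) module \<Rightarrow> ('a, 'c) module \<Rightarrow> nat
    \<Rightarrow> ('a, ((nat \<Rightarrow> 'a) \<Rightarrow> 'c) set) module" where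
  "ext_module R N M i =
     (case (SOME (b, \<epsilon>, d). free_resolution R N b \<epsilon> d) of (b, \<epsilon>, d) \<Rightarrow> hom_cohomology R b d M i)"

definition is_zero_module :: "('a, 'b) module \<Rightarrow> bool" where
  "is_zero_module M \<longleftrightarrow> carrier M = {\<zero>\<^bsub>M\<^esub>}"


end

theory Submission
  imports Defs
begin

text \<open>
  Suppose \<open>R\<close> is not Gorenstein; then its socle is not cyclic. Write \<open>a = \<lambda>(m\<^sup>2)\<close> and
  \<open>e = \<mu>(m)\<close>, so that \<open>\<lambda>(R) = 1 + e + a\<close>. As a quotient of syzygies of \<open>k\<close>, \<open>M\<close> is killed
  by the socle. Take a minimal injective resolution
  \<open>M \<rightarrow> E\<^bsup>s 0\<^esup> \<rightarrow> E\<^bsup>s 1\<^esup> \<rightarrow> \<dots>\<close>. Endomorphisms of \<open>E\<close> are scalars, so \<open>Hom(E, -)\<close> turns it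
  into a complex \<open>R\<^bsup>s 0\<^esup> \<rightarrow> R\<^bsup>s 1\<^esup> \<rightarrow> \<dots>\<close> whose cohomology is \<open>Ext(E, M)\<close>; it is exact in
  three consecutive places. There, an element \<open>y\<close> of the socle, put in one coordinate, is the
  image of a tuple \<open>v\<close>, and a unit entry of \<open>v\<close> would force the socle to annihilate
  \<open>{x \<in> E. y x = 0}\<close>, hence to be contained in \<open>R y\<close>. So \<open>v\<close> has entries in \<open>m\<close>. It follows
  that the socle is \<open>m\<^sup>2\<close> and that the maps send \<open>m R\<^bsup>s q\<^esup>\<close> onto \<open>m\<^sup>2 R\<^bsup>s (q+1)\<^esup>\<close>, and the
  annihilator of \<open>m\<^sup>2\<close> in \<open>E\<^bsup>s q\<^esup>\<close> onto the socle of \<open>E\<^bsup>s (q+1)\<^esup>\<close>. Counting lengths in the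
  two complexes gives \<open>s (q+2) = e s (q+1) - a s q\<close> and \<open>a s (q+2) = e s (q+1) - s q\<close>, each
  for two consecutive \<open>q\<close>. Since \<open>a \<noteq> 1\<close>, this forces \<open>e = a + 1\<close>, that is
  \<open>\<lambda>(R) = 2 \<mu>(m)\<close>.
\<close>

section \<open>Modules, homomorphisms and submodules\<close>

text \<open>Ext is defined by free resolutions of E, while the argument needs an injective
  resolution of M. Balancing Ext is therefore part of the proof, but only the passage of vanishing
  from one side to the other is carried out.

  The socle kills every kernel in the injective resolution. The first kernel is M. In a later one, a
  socle multiple of an element comes from the socle of the preceding term, which minimality puts
  into the kernel. M itself is killed because a noncyclic socle lies in m, while the positive
  syzygies of k sit inside m times a free module.

  The two length counts describe the same numbers s q from two sides: Matlis duality exchanges R and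
  E, and a moves to the other end of the recurrence. Subtracting gives (1 - a)(s (q+2) - s q) = 0,
  hence period two, and then (1 + a)^2 = e^2. Each recurrence takes two adjacent exact places and is
  wanted twice, whence three consecutive degrees.

  As m^3 = 0, all modules involved have finite length. Lengths are measured by chains between two
  submodules, so the counting never forms a quotient.\<close>

lemma rmod_homI:
  assumes "\<And>x. x \<in> carrier A \<Longrightarrow> f x \<in> carrier B"
    and "\<And>x y. x \<in> carrier A \<Longrightarrow> y \<in> carrier A \<Longrightarrow> f (x \<oplus>\<^bsub>A\<^esub> y) = f x \<oplus>\<^bsub>B\<^esub> f y"
    and "\<And>r x. r \<in> carrier R \<Longrightarrow> x \<in> carrier A \<Longrightarrow> f (r \<odot>\<^bsub>A\<^esub> x) = r \<odot>\<^bsub>B\<^esub> f x"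
  shows "f \<in> rmod_hom R A B"
  using assms by (auto simp: rmod_hom_def)

lemma rmod_hom_closed: "f \<in> rmod_hom R A B \<Longrightarrow> x \<in> carrier A \<Longrightarrow> f x \<in> carrier B"
  and rmod_hom_add: "f \<in> rmod_hom R A B \<Longrightarrow> x \<in> carrier A \<Longrightarrow> y \<in> carrier A
    \<Longrightarrow> f (x \<oplus>\<^bsub>A\<^esub> y) = f x \<oplus>\<^bsub>B\<^esub> f y"
  and rmod_hom_smult: "f \<in> rmod_hom R A B \<Longrightarrow> r \<in> carrier R \<Longrightarrow> x \<in> carrier A
    \<Longrightarrow> f (r \<odot>\<^bsub>A\<^esub> x) = r \<odot>\<^bsub>B\<^esub> f x"
  by (auto simp: rmod_hom_def)

lemmas rmod_homD = rmod_hom_closed rmod_hom_add rmod_hom_smult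

lemma rmod_hom_zero:
  assumes "module R A" "module R B" "f \<in> rmod_hom R A B"
  shows "f \<zero>\<^bsub>A\<^esub> = \<zero>\<^bsub>B\<^esub>"
proof -
  interpret A: module R A by fact
  interpret B: module R B by fact
  have "f (\<zero>\<^bsub>R\<^esub> \<odot>\<^bsub>A\<^esub> \<zero>\<^bsub>A\<^esub>) = \<zero>\<^bsub>R\<^esub> \<odot>\<^bsub>B\<^esub> f \<zero>\<^bsub>A\<^esub>"
    by (intro rmod_homD[OF assms(3)]) auto
  then show ?thesis using rmod_homD(1)[OF assms(3), of "\<zero>\<^bsub>A\<^esub>"] by simp
qed

lemma rmod_hom_minus:
  assumes "module R A" "module R B" "f \<in> rmod_hom R A B" "x \<in> carrier A" "y \<in> carrier A"
  shows "f (x \<ominus>\<^bsub>A\<^esub> y) = f x \<ominus>\<^bsub>B\<^esub> f y"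
proof -
  interpret A: module R A by fact
  interpret B: module R B by fact
  \<comment> \<open>Homomorphisms are only assumed to respect sums and scalars, so negation is
    turned into multiplication by -1.\<close>
  have neg: "\<ominus>\<^bsub>A\<^esub> y = (\<ominus>\<^bsub>R\<^esub> \<one>\<^bsub>R\<^esub>) \<odot>\<^bsub>A\<^esub> y" "\<ominus>\<^bsub>B\<^esub> f y = (\<ominus>\<^bsub>R\<^esub> \<one>\<^bsub>R\<^esub>) \<odot>\<^bsub>B\<^esub> f y"
    using assms by (simp_all add: A.smult_l_minus B.smult_l_minus rmod_homD[OF assms(3)])
  show ?thesis unfolding a_minus_def neg
    using assms(4,5) by (simp add: rmod_homD[OF assms(3)])
qed

lemma (in abelian_group) minus_eq_zero_iff:
  "x \<in> carrier G \<Longrightarrow> y \<in> carrier G \<Longrightarrow> x \<ominus> y = \<zero> \<longleftrightarrow> x = y"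
  by (metis a_inv_closed a_minus_def local.minus_minus minus_equality r_neg)

lemma (in abelian_group) minus_add_cancel:
  "x \<in> carrier G \<Longrightarrow> y \<in> carrier G \<Longrightarrow> (x \<ominus> y) \<oplus> y = x"
  by (simp add: a_minus_def a_assoc l_neg)

lemma rmod_hom_diff:
  assumes "module R A" "module R B" "f \<in> rmod_hom R A B" "g \<in> rmod_hom R A B"
  shows "(\<lambda>x. f x \<ominus>\<^bsub>B\<^esub> g x) \<in> rmod_hom R A B"
proof -
  interpret A: module R A by fact
  interpret B: module R B by fact
  show ?thesis
  proof (rule rmod_homI)
    fix x y assume xy: "x \<in> carrier A" "y \<in> carrier A"
    then have "f x \<in> carrier B" "f y \<in> carrier B" "g x \<in> carrier B" "g y \<in> carrier B"
      using assms by (auto intro: rmod_homD)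
    then show "f (x \<oplus>\<^bsub>A\<^esub> y) \<ominus>\<^bsub>B\<^esub> g (x \<oplus>\<^bsub>A\<^esub> y) = f x \<ominus>\<^bsub>B\<^esub> g x \<oplus>\<^bsub>B\<^esub> (f y \<ominus>\<^bsub>B\<^esub> g y)"
      using xy by (simp add: rmod_homD[OF assms(3)] rmod_homD[OF assms(4)] a_minus_def
          B.M.minus_add B.M.a_ac)
  next
    fix r x assume rx: "r \<in> carrier R" "x \<in> carrier A"
    then have "f x \<in> carrier B" "g x \<in> carrier B"
      using assms by (auto intro: rmod_homD)
    then show "f (r \<odot>\<^bsub>A\<^esub> x) \<ominus>\<^bsub>B\<^esub> g (r \<odot>\<^bsub>A\<^esub> x) = r \<odot>\<^bsub>B\<^esub> (f x \<ominus>\<^bsub>B\<^esub> g x)"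
      using rx by (simp add: rmod_homD[OF assms(3)] rmod_homD[OF assms(4)] a_minus_def
          B.smult_r_distr B.smult_r_minus)
  qed (use assms in \<open>auto intro: rmod_homD B.M.minus_closed\<close>)
qed

section \<open>Submodules: intersections, sums and cyclic submodules\<close>

context module
begin

lemma submoduleI_smult:
  assumes "H \<subseteq> carrier M" "\<zero>\<^bsub>M\<^esub> \<in> H"
    and "\<And>a b. a \<in> H \<Longrightarrow> b \<in> H \<Longrightarrow> a \<oplus>\<^bsub>M\<^esub> b \<in> H"
    and "\<And>a x. a \<in> carrier R \<Longrightarrow> x \<in> H \<Longrightarrow> a \<odot>\<^bsub>M\<^esub> x \<in> H"
  shows "submodule H R M"
proof (rule submoduleI)
  fix a assume "a \<in> H"
  then have "(\<ominus>\<^bsub>R\<^esub> \<one>\<^bsub>R\<^esub>) \<odot>\<^bsub>M\<^esub> a \<in> H" "a \<in> carrier M" using assms by auto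
  then show "\<ominus>\<^bsub>M\<^esub> a \<in> H" by (simp add: smult_l_minus)
qed (use assms in auto)

lemma submodule_in_carrier: "submodule H R M \<Longrightarrow> x \<in> H \<Longrightarrow> x \<in> carrier M"
  using submoduleE(1) by blast

lemma submodule_zero: "submodule H R M \<Longrightarrow> \<zero>\<^bsub>M\<^esub> \<in> H"
  by (metis submoduleE(1,2,4) R.zero_closed smult_l_null subset_eq ex_in_conv)

lemma submodule_minus: "submodule H R M \<Longrightarrow> x \<in> H \<Longrightarrow> y \<in> H \<Longrightarrow> x \<ominus>\<^bsub>M\<^esub> y \<in> H"
  unfolding a_minus_def by (simp add: submoduleE)

lemmas submoduleD = submodule_in_carrier submodule_zero submoduleE(5) submoduleE(4)
  submodule_minus

lemma submodule_zero_module: "submodule {\<zero>\<^bsub>M\<^esub>} R M"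
  by (rule submoduleI_smult) auto

lemma submodule_Int: "submodule H R M \<Longrightarrow> submodule K R M \<Longrightarrow> submodule (H \<inter> K) R M"
  by (rule submoduleI_smult) (use submoduleD in \<open>blast+\<close>)

definition submodule_sum :: "'c set \<Rightarrow> 'c set \<Rightarrow> 'c set" where
  "submodule_sum H K = {x \<oplus>\<^bsub>M\<^esub> y | x y. x \<in> H \<and> y \<in> K}"

lemma submodule_sum:
  assumes H: "submodule H R M" and K: "submodule K R M"
  shows "submodule (submodule_sum H K) R M"
proof (rule submoduleI_smult)
  show "\<zero>\<^bsub>M\<^esub> \<in> submodule_sum H K"
    using submodule_zero[OF H] submodule_zero[OF K] unfolding submodule_sum_def
    by (auto intro!: exI[of _ "\<zero>\<^bsub>M\<^esub>"])
next
  fix a b assume "a \<in> submodule_sum H K" "b \<in> submodule_sum H K"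
  then obtain x y x' y' where *: "x \<in> H" "y \<in> K" "x' \<in> H" "y' \<in> K"
    "a = x \<oplus>\<^bsub>M\<^esub> y" "b = x' \<oplus>\<^bsub>M\<^esub> y'" by (auto simp: submodule_sum_def)
  then have c: "x \<in> carrier M" "y \<in> carrier M" "x' \<in> carrier M" "y' \<in> carrier M"
    using submodule_in_carrier[OF H] submodule_in_carrier[OF K] by auto
  have "a \<oplus>\<^bsub>M\<^esub> b = (x \<oplus>\<^bsub>M\<^esub> x') \<oplus>\<^bsub>M\<^esub> (y \<oplus>\<^bsub>M\<^esub> y')" using * c by (simp add: M.a_ac)
  then show "a \<oplus>\<^bsub>M\<^esub> b \<in> submodule_sum H K"
    using * submoduleD(3)[OF H] submoduleD(3)[OF K] unfolding submodule_sum_def by blast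
next
  fix r a assume r: "r \<in> carrier R" and "a \<in> submodule_sum H K"
  then obtain x y where *: "x \<in> H" "y \<in> K" "a = x \<oplus>\<^bsub>M\<^esub> y" by (auto simp: submodule_sum_def)
  then have "r \<odot>\<^bsub>M\<^esub> a = r \<odot>\<^bsub>M\<^esub> x \<oplus>\<^bsub>M\<^esub> r \<odot>\<^bsub>M\<^esub> y"
    using submodule_in_carrier[OF H *(1)] submodule_in_carrier[OF K *(2)] r
    by (simp add: smult_r_distr)
  then show "r \<odot>\<^bsub>M\<^esub> a \<in> submodule_sum H K"
    using * r submoduleD(4)[OF H] submoduleD(4)[OF K] unfolding submodule_sum_def by blast
qed (use submodule_in_carrier[OF H] submodule_in_carrier[OF K] in
  \<open>auto simp: submodule_sum_def\<close>)

lemma submodule_sum_upper: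
  assumes "submodule H R M" "submodule K R M"
  shows "H \<subseteq> submodule_sum H K" "K \<subseteq> submodule_sum H K"
proof -
  show "H \<subseteq> submodule_sum H K"
  proof
    fix x assume "x \<in> H"
    then show "x \<in> submodule_sum H K" unfolding submodule_sum_def
      using submodule_in_carrier[OF assms(1)] submodule_zero[OF assms(2)]
      by (intro CollectI exI[of _ x] exI[of _ "\<zero>\<^bsub>M\<^esub>"]) auto
  qed
  show "K \<subseteq> submodule_sum H K"
  proof
    fix x assume "x \<in> K"
    then show "x \<in> submodule_sum H K" unfolding submodule_sum_def
      using submodule_in_carrier[OF assms(2)] submodule_zero[OF assms(1)]
      by (intro CollectI exI[of _ "\<zero>\<^bsub>M\<^esub>"] exI[of _ x]) auto
  qed
qed

lemma submodule_sum_least: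
  "submodule N R M \<Longrightarrow> H \<subseteq> N \<Longrightarrow> K \<subseteq> N \<Longrightarrow> submodule_sum H K \<subseteq> N"
  unfolding submodule_sum_def using submoduleD(3) by blast

definition cyc :: "'c \<Rightarrow> 'c set" where
  "cyc x = {r \<odot>\<^bsub>M\<^esub> x | r. r \<in> carrier R}"

lemma submodule_cyc: "x \<in> carrier M \<Longrightarrow> submodule (cyc x) R M"
proof (rule submoduleI_smult)
  assume x: "x \<in> carrier M"
  show "cyc x \<subseteq> carrier M" using x by (auto simp: cyc_def)
  show "\<zero>\<^bsub>M\<^esub> \<in> cyc x" unfolding cyc_def using x by (intro CollectI exI[of _ "\<zero>\<^bsub>R\<^esub>"]) simp
  fix a b assume "a \<in> cyc x" "b \<in> cyc x"
  then obtain r t where rt: "r \<in> carrier R" "t \<in> carrier R" "a = r \<odot>\<^bsub>M\<^esub> x" "b = t \<odot>\<^bsub>M\<^esub> x"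
    by (auto simp: cyc_def)
  then show "a \<oplus>\<^bsub>M\<^esub> b \<in> cyc x" unfolding cyc_def using x
    by (intro CollectI exI[of _ "r \<oplus>\<^bsub>R\<^esub> t"]) (simp add: smult_l_distr)
next
  assume x: "x \<in> carrier M"
  fix c a assume c: "c \<in> carrier R" and "a \<in> cyc x"
  then obtain r where "r \<in> carrier R" "a = r \<odot>\<^bsub>M\<^esub> x" by (auto simp: cyc_def)
  then show "c \<odot>\<^bsub>M\<^esub> a \<in> cyc x" unfolding cyc_def using x c
    by (intro CollectI exI[of _ "c \<otimes>\<^bsub>R\<^esub> r"]) (simp add: smult_assoc1)
qed

lemma cyc_self: "x \<in> carrier M \<Longrightarrow> x \<in> cyc x"
  unfolding cyc_def by (intro CollectI exI[of _ "\<one>\<^bsub>R\<^esub>"]) simp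

lemma cyc_least: "submodule N R M \<Longrightarrow> x \<in> N \<Longrightarrow> cyc x \<subseteq> N"
  unfolding cyc_def using submoduleD(4) by blast

end

section \<open>Preimages, images, and factoring a map through an image\<close>

lemma submodule_vimage:
  assumes A: "module R A" and B: "module R B" and f: "f \<in> rmod_hom R A B" and K: "submodule K R B"
  shows "submodule {x \<in> carrier A. f x \<in> K} R A"
proof -
  interpret A: module R A by fact
  interpret B: module R B by fact
  show ?thesis
    by (rule A.submoduleI_smult)
      (use B.submoduleD[OF K] in \<open>auto simp: rmod_homD[OF f] rmod_hom_zero[OF A B f]\<close>)
qed

lemma submodule_image:
  assumes A: "module R A" and B: "module R B" and f: "f \<in> rmod_hom R A B" and H: "submodule H R A"
  shows "submodule (f ` H) R B"
proof -
  interpret A: module R A by fact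
  interpret B: module R B by fact
  note sub = A.submoduleD[OF H]
  show ?thesis
  proof (rule B.submoduleI_smult)
    show "f ` H \<subseteq> carrier B" using sub(1) rmod_homD(1)[OF f] by auto
    show "\<zero>\<^bsub>B\<^esub> \<in> f ` H" using sub(2) rmod_hom_zero[OF A B f] by (metis imageI)
    fix a b assume "a \<in> f ` H" "b \<in> f ` H"
    then obtain x y where "x \<in> H" "y \<in> H" "a = f x" "b = f y" by auto
    then show "a \<oplus>\<^bsub>B\<^esub> b \<in> f ` H"
      using sub by (intro image_eqI[of _ _ "x \<oplus>\<^bsub>A\<^esub> y"]) (simp_all add: rmod_homD[OF f])
  next
    fix r a assume r: "r \<in> carrier R" and "a \<in> f ` H"
    then obtain x where "x \<in> H" "a = f x" by auto
    then show "r \<odot>\<^bsub>B\<^esub> a \<in> f ` H"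
      using r sub by (intro image_eqI[of _ _ "r \<odot>\<^bsub>A\<^esub> x"]) (simp_all add: rmod_homD[OF f])
  qed
qed

lemma submodule_kernel:
  assumes "module R A" "module R B" "f \<in> rmod_hom R A B"
  shows "submodule (rmod_kernel A B f) R A"
  using submodule_vimage[OF assms, of "{\<zero>\<^bsub>B\<^esub>}"] module.submodule_zero_module[OF assms(2)]
  by (simp add: rmod_kernel_def)

lemma rmod_hom_inj_on:
  assumes A: "module R A" and B: "module R B" and f: "f \<in> rmod_hom R A B"
    and ker: "rmod_kernel A B f \<subseteq> {\<zero>\<^bsub>A\<^esub>}"
  shows "inj_on f (carrier A)"
proof (rule inj_onI)
  interpret A: module R A by fact
  interpret B: module R B by fact
  fix x y assume xy: "x \<in> carrier A" "y \<in> carrier A" "f x = f y"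
  then have "f (x \<ominus>\<^bsub>A\<^esub> y) = \<zero>\<^bsub>B\<^esub>"
    using rmod_homD(1)[OF f] by (simp add: rmod_hom_minus[OF A B f] B.M.minus_eq_zero_iff)
  then have "x \<ominus>\<^bsub>A\<^esub> y \<in> rmod_kernel A B f" using xy by (simp add: rmod_kernel_def)
  then show "x = y" using ker xy A.M.minus_eq_zero_iff by auto
qed

text \<open>As the kernel of f lies in that of g, the value g x depends on f x alone. The domain of
  h is only the image of f, since an extension to B would need an injective target.\<close>

lemma rmod_hom_factor:
  assumes A: "module R A" and B: "module R B" and C: "module R C"
    and f: "f \<in> rmod_hom R A B" and g: "g \<in> rmod_hom R A C"
    and ker: "\<And>x. x \<in> carrier A \<Longrightarrow> f x = \<zero>\<^bsub>B\<^esub> \<Longrightarrow> g x = \<zero>\<^bsub>C\<^esub>"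
  obtains h where "h \<in> rmod_hom R (B\<lparr>carrier := f ` carrier A\<rparr>) C"
    "\<And>x. x \<in> carrier A \<Longrightarrow> h (f x) = g x"
proof -
  interpret A: module R A by fact
  interpret B: module R B by fact
  interpret C: module R C by fact
  have eq: "g x = g y" if "x \<in> carrier A" "y \<in> carrier A" "f x = f y" for x y
  proof -
    have "f (x \<ominus>\<^bsub>A\<^esub> y) = \<zero>\<^bsub>B\<^esub>"
      using rmod_homD(1)[OF f] that by (simp add: rmod_hom_minus[OF A B f] B.M.minus_eq_zero_iff)
    then have "g (x \<ominus>\<^bsub>A\<^esub> y) = \<zero>\<^bsub>C\<^esub>" using that by (intro ker) auto
    then show ?thesis
      using that rmod_homD(1)[OF g] by (simp add: rmod_hom_minus[OF A C g] C.M.minus_eq_zero_iff)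
  qed
  define h where "h y = g (SOME x. x \<in> carrier A \<and> f x = y)" for y
  have h: "h (f x) = g x" if "x \<in> carrier A" for x
  proof -
    have "(SOME z. z \<in> carrier A \<and> f z = f x) \<in> carrier A \<and> f (SOME z. z \<in> carrier A \<and> f z = f x) = f x"
      by (rule someI[of _ x]) (use that in simp)
    then show ?thesis unfolding h_def using eq that by blast
  qed
  have "h \<in> rmod_hom R (B\<lparr>carrier := f ` carrier A\<rparr>) C"
  proof (rule rmod_homI)
    fix x assume "x \<in> carrier (B\<lparr>carrier := f ` carrier A\<rparr>)"
    then show "h x \<in> carrier C" using h rmod_homD(1)[OF g] by auto
  next
    fix x y assume "x \<in> carrier (B\<lparr>carrier := f ` carrier A\<rparr>)" "y \<in> carrier (B\<lparr>carrier := f ` carrier A\<rparr>)"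
    then obtain u v where *: "u \<in> carrier A" "v \<in> carrier A" "x = f u" "y = f v" by auto
    then show "h (x \<oplus>\<^bsub>B\<lparr>carrier := f ` carrier A\<rparr>\<^esub> y) = h x \<oplus>\<^bsub>C\<^esub> h y"
      using h[of "u \<oplus>\<^bsub>A\<^esub> v"] h by (simp add: rmod_homD[OF f] rmod_homD[OF g])
  next
    fix r x assume r: "r \<in> carrier R" and "x \<in> carrier (B\<lparr>carrier := f ` carrier A\<rparr>)"
    then obtain u where *: "u \<in> carrier A" "x = f u" by auto
    then show "h (r \<odot>\<^bsub>B\<lparr>carrier := f ` carrier A\<rparr>\<^esub> x) = r \<odot>\<^bsub>C\<^esub> h x"
      using r h[of "r \<odot>\<^bsub>A\<^esub> u"] h by (simp add: rmod_homD[OF f] rmod_homD[OF g])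
  qed
  then show ?thesis using h that by blast
qed

text \<open>The factorization through the image of f is extended from that submodule to B by
  injectivity. \<open>injective_module_extend\<close> allows arbitrary carrier types here.\<close>

lemma injective_extend_factor:
  assumes A: "module R A" and B: "module R B" and I: "injective_module R I"
    and f: "f \<in> rmod_hom R A B" and g: "g \<in> rmod_hom R A I"
    and ker: "\<And>x. x \<in> carrier A \<Longrightarrow> f x = \<zero>\<^bsub>B\<^esub> \<Longrightarrow> g x = \<zero>\<^bsub>I\<^esub>"
  obtains h where "h \<in> rmod_hom R B I" "\<And>x. x \<in> carrier A \<Longrightarrow> h (f x) = g x"
proof -
  interpret A: module R A by fact
  have I': "module R I" using I by (simp add: injective_module_def)
  obtain h where h: "h \<in> rmod_hom R (B\<lparr>carrier := f ` carrier A\<rparr>) I"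
    "\<And>x. x \<in> carrier A \<Longrightarrow> h (f x) = g x"
    using rmod_hom_factor[OF A B I' f g ker] by blast
  have sub: "submodule (f ` carrier A) R B"
    by (rule submodule_image[OF A B f A.carrier_is_submodule])
  have "module R (B\<lparr>carrier := f ` carrier A\<rparr>)"
    using submodule.submodule_is_module[OF sub B] .
  moreover have "(\<lambda>x. x) \<in> rmod_hom R (B\<lparr>carrier := f ` carrier A\<rparr>) B"
    using module.submoduleE(1)[OF B sub] by (auto simp: rmod_hom_def)
  ultimately obtain h' where "h' \<in> rmod_hom R B I" "\<forall>x\<in>f ` carrier A. h' x = h x"
    using injective_module_extend[OF I _ B _ _ h(1)] by (auto simp: inj_on_def)
  then show ?thesis using that h(2) by auto
qed

section \<open>Relative length\<close>

text \<open>Strict chains of n steps between A and B, peeled off from the top. Only the intermediate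
  members must be submodules, and the weak inclusion at the bottom makes the notion monotone in
  B.\<close>

primrec length_chain ::
  "('a, 'r) ring_scheme \<Rightarrow> ('a, 'b, 'm) module_scheme \<Rightarrow> 'b set \<Rightarrow> nat \<Rightarrow> 'b set \<Rightarrow> bool" where
  "length_chain R M A 0 B \<longleftrightarrow> A \<subseteq> B"
| "length_chain R M A (Suc n) B \<longleftrightarrow> (\<exists>D. submodule D R M \<and> D \<subset> B \<and> length_chain R M A n D)"

text \<open>The length of B/A without the quotient, so that all comparisons stay in one carrier
  type.\<close>

definition rel_length ::
  "('a, 'r) ring_scheme \<Rightarrow> ('a, 'b, 'm) module_scheme \<Rightarrow> 'b set \<Rightarrow> 'b set \<Rightarrow> enat" where
  "rel_length R M A B = Sup {enat n | n. length_chain R M A n B}"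

lemma length_chain_subset: "length_chain R M A n B \<Longrightarrow> A \<subseteq> B"
  by (induction n arbitrary: B) auto

lemma length_chain_mono: "length_chain R M A n B \<Longrightarrow> B \<subseteq> B' \<Longrightarrow> length_chain R M A n B'"
  by (cases n) (auto, blast)

lemma length_chain_Suc_le: "length_chain R M A (Suc n) B \<Longrightarrow> length_chain R M A n B"
  by (auto intro: length_chain_mono)

lemma length_chain_le: "length_chain R M A n B \<Longrightarrow> k \<le> n \<Longrightarrow> length_chain R M A k B"
  by (induction n) (auto simp: le_Suc_eq dest: length_chain_Suc_le simp del: length_chain.simps(2))

lemma enat_le_rel_length_iff:
  assumes "A \<subseteq> B"
  shows "enat n \<le> rel_length R M A B \<longleftrightarrow> length_chain R M A n B"
proof
  assume n: "enat n \<le> rel_length R M A B"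
  show "length_chain R M A n B"
  proof (cases n)
    case (Suc k)
    show ?thesis
    proof (rule ccontr)
      assume "\<not> length_chain R M A n B"
      \<comment> \<open>Chains can be shortened, so if none has n = k + 1 steps, none has more than
        k.\<close>
      then have "j \<le> k" if "length_chain R M A j B" for j
        using length_chain_le[OF that, of n] Suc by (cases "n \<le> j") auto
      then have "rel_length R M A B \<le> enat k"
        unfolding rel_length_def by (intro Sup_least) auto
      then have "enat n \<le> enat k" using n by (rule order_trans[rotated])
      then show False using Suc by simp
    qed
  qed (use assms in simp)
qed (auto simp: rel_length_def intro: Sup_upper)

lemma enat_eqI: "(\<And>n. enat n \<le> x \<longleftrightarrow> enat n \<le> y) \<Longrightarrow> x = (y :: enat)"
proof (rule antisym)
  have "a \<le> b" if "\<And>n. enat n \<le> a \<Longrightarrow> enat n \<le> b" for a b :: enat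
  proof (cases a)
    case infinity
    then show ?thesis using that by (cases b) (auto, metis Suc_n_not_le_n)
  qed (use that in auto)
  then show "(\<And>n. enat n \<le> x \<longleftrightarrow> enat n \<le> y) \<Longrightarrow> x \<le> y"
    "(\<And>n. enat n \<le> x \<longleftrightarrow> enat n \<le> y) \<Longrightarrow> y \<le> x" by blast+
qed

lemma enat_le_add_iff: "enat n \<le> x + y \<longleftrightarrow> (\<exists>p q. n = p + q \<and> enat p \<le> x \<and> enat q \<le> y)"
proof
  assume "enat n \<le> x + y"
  show "\<exists>p q. n = p + q \<and> enat p \<le> x \<and> enat q \<le> y"
  proof (cases "enat n \<le> x")
    case True
    then show ?thesis by (intro exI[of _ n] exI[of _ 0]) (simp add: zero_enat_def[symmetric])
  next
    case False
    then obtain a where "x = enat a" "a \<le> n" by (cases x) auto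
    with \<open>enat n \<le> x + y\<close> show ?thesis
      by (intro exI[of _ a] exI[of _ "n - a"]) (cases y; simp)
  qed
next
  assume "\<exists>p q. n = p + q \<and> enat p \<le> x \<and> enat q \<le> y"
  then show "enat n \<le> x + y" using add_mono[of "enat _" x "enat _" y] by auto
qed

lemma length_chain_concat:
  assumes "length_chain R M A p B" "submodule B R M" "length_chain R M B q C"
  shows "length_chain R M A (p + q) C"
  using assms(3)
proof (induction q arbitrary: C)
  case 0
  then show ?case using assms(1) length_chain_mono by auto
next
  case (Suc q)
  then show ?case by auto
qed

section \<open>Additivity of relative length and induction over submodules\<close>

context module
begin

text \<open>The modular law: a strict step from C to D must enlarge the intersection with B or the
  sum with B.\<close>

lemma modular_strict:
  assumes B: "submodule B R M" and C: "submodule C R M" and D: "submodule D R M"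
    and CD: "C \<subset> D" and eq: "D \<inter> B \<subseteq> C" "D \<subseteq> submodule_sum C B"
  shows False
proof -
  obtain x where x: "x \<in> D" "x \<notin> C" using CD by blast
  then obtain c b where cb: "c \<in> C" "b \<in> B" "x = c \<oplus>\<^bsub>M\<^esub> b"
    using eq(2) by (auto simp: submodule_sum_def)
  have car: "c \<in> carrier M" "b \<in> carrier M"
    using submodule_in_carrier[OF C cb(1)] submodule_in_carrier[OF B cb(2)] by auto
  have "b = x \<ominus>\<^bsub>M\<^esub> c" using car cb(3) by (simp add: a_minus_def M.a_ac M.r_neg)
  then have "b \<in> D" using submodule_minus[OF D x(1)] cb(1) CD by auto
  then have "b \<in> C" using eq(1) cb(2) by blast
  then show False using x(2) cb submoduleD(3)[OF C] by blast
qed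

text \<open>Intersect the chain with B and add B to it. By \<open>modular_strict\<close> every
  strict step survives in at least one of the two resulting chains; a step may survive in both,
  hence only an inequality for n.\<close>

lemma length_chain_split:
  assumes A: "submodule A R M" and B: "submodule B R M" "A \<subseteq> B" and C: "submodule C R M"
    and "length_chain R M A n C"
  shows "\<exists>p q. n \<le> p + q \<and> length_chain R M A p (C \<inter> B) \<and> length_chain R M B q (submodule_sum C B)"
  using assms(4,5)
proof (induction n arbitrary: C)
  case 0
  then have "length_chain R M A 0 (C \<inter> B)" "length_chain R M B 0 (submodule_sum C B)"
    using B submodule_sum_upper[of C B] by auto
  then show ?case by blast
next
  case (Suc n)
  then obtain D where D: "submodule D R M" "D \<subset> C" "length_chain R M A n D" by auto
  from Suc.IH[OF D(1,3)] obtain p q where pq: "n \<le> p + q" "length_chain R M A p (D \<inter> B)"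
    "length_chain R M B q (submodule_sum D B)" by blast
  have sub: "submodule (D \<inter> B) R M" "submodule (submodule_sum D B) R M"
    by (rule submodule_Int submodule_sum; fact)+
  have le: "submodule_sum D B \<subseteq> submodule_sum C B" "D \<inter> B \<subseteq> C \<inter> B"
    using D(2) by (auto simp: submodule_sum_def)
  from modular_strict[OF B(1) D(1) Suc.prems(1) D(2)]
  consider "D \<inter> B \<subset> C \<inter> B" | "submodule_sum D B \<subset> submodule_sum C B"
    using le submodule_sum_upper[OF Suc.prems(1) B(1)] by blast
  then show ?case
  proof cases
    case 1
    then have "length_chain R M A (Suc p) (C \<inter> B)" using pq(2) sub(1) by auto
    moreover have "length_chain R M B q (submodule_sum C B)" using pq(3) le length_chain_mono by blast
    ultimately show ?thesis using pq(1) by (intro exI[of _ "Suc p"] exI[of _ q]) simp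
  next
    case 2
    then have "length_chain R M B (Suc q) (submodule_sum C B)" using pq(3) sub(2) by auto
    moreover have "length_chain R M A p (C \<inter> B)" using pq(2) le length_chain_mono by blast
    ultimately show ?thesis using pq(1) by (intro exI[of _ p] exI[of _ "Suc q"]) simp
  qed
qed

lemma rel_length_add:
  assumes A: "submodule A R M" and B: "submodule B R M" and C: "submodule C R M"
    and AB: "A \<subseteq> B" and BC: "B \<subseteq> C"
  shows "rel_length R M A C = rel_length R M A B + rel_length R M B C"
proof (rule enat_eqI)
  fix n
  have "length_chain R M A n C \<longleftrightarrow>
    (\<exists>p q. n = p + q \<and> length_chain R M A p B \<and> length_chain R M B q C)"
  proof
    assume "length_chain R M A n C"
    from length_chain_split[OF A B AB C this] obtain p q where pq: "n \<le> p + q"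
      "length_chain R M A p (C \<inter> B)" "length_chain R M B q (submodule_sum C B)" by blast
    then have *: "length_chain R M A p B" "length_chain R M B q C"
      using BC submodule_sum_least[OF C order_refl BC] length_chain_mono by blast+
    \<comment> \<open>With truncated subtraction n - (n - p) is the minimum of n and p; both chains
      are shortened until their lengths add up to n exactly.\<close>
    have "length_chain R M A (n - (n - p)) B" "length_chain R M B (n - p) C"
      using length_chain_le[OF *(1)] length_chain_le[OF *(2)] pq(1) by auto
    then show "\<exists>p q. n = p + q \<and> length_chain R M A p B \<and> length_chain R M B q C"
      by (intro exI[of _ "n - (n - p)"] exI[of _ "n - p"]) auto
  qed (use length_chain_concat B in blast)
  then show "enat n \<le> rel_length R M A C \<longleftrightarrow> enat n \<le> rel_length R M A B + rel_length R M B C"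
    using AB BC by (simp add: enat_le_rel_length_iff enat_le_add_iff)
qed

abbreviation len :: "'c set \<Rightarrow> enat" where
  "len B \<equiv> rel_length R M {\<zero>\<^bsub>M\<^esub>} B"

lemma rel_length_self: "rel_length R M A A = 0"
proof (rule enat_eqI)
  fix n
  have "length_chain R M A n A \<longleftrightarrow> n = 0"
    using length_chain_subset by (cases n) fastforce+
  then show "enat n \<le> rel_length R M A A \<longleftrightarrow> enat n \<le> 0"
    by (simp add: enat_le_rel_length_iff zero_enat_def)
qed

lemma len_mono:
  assumes "submodule A R M" "submodule B R M" "A \<subseteq> B"
  shows "len A \<le> len B"
  using rel_length_add[OF submodule_zero_module assms(1,2) _ assms(3)] submodule_zero[OF assms(1)]
  by simp

lemma len_strict_mono:
  assumes A: "submodule A R M" and B: "submodule B R M" and AB: "A \<subset> B" and fin: "len B \<noteq> \<infinity>"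
  shows "len A < len B"
proof -
  have "enat 1 \<le> rel_length R M A B"
    using AB A by (subst enat_le_rel_length_iff) auto
  moreover have "len B = len A + rel_length R M A B"
    using rel_length_add[OF submodule_zero_module A B] submodule_zero[OF A] AB by auto
  ultimately show ?thesis using fin by (cases "len A"; cases "rel_length R M A B") auto
qed

text \<open>In finite length a proper submodule has strictly smaller length, so this is induction on
  a natural number.\<close>

lemma wf_submodule_induct [consumes 2, case_names less]:
  assumes N: "submodule N R M" and fin: "len (carrier M) \<noteq> \<infinity>"
    and step: "\<And>N. submodule N R M \<Longrightarrow> (\<And>K. submodule K R M \<Longrightarrow> K \<subset> N \<Longrightarrow> P K) \<Longrightarrow> P N"
  shows "P N"
proof -
  have fin': "len N \<noteq> \<infinity>" if "submodule N R M" for N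
    using len_mono[OF that carrier_is_submodule submoduleE(1)[OF that]] fin enat_ile by fastforce
  have "\<forall>N. submodule N R M \<longrightarrow> len N = enat k \<longrightarrow> P N" for k
  proof (induction k rule: less_induct)
    case (less k)
    show ?case
    proof (intro allI impI)
      fix N assume N: "submodule N R M" "len N = enat k"
      show "P N"
      proof (rule step[OF N(1)])
        fix K assume K: "submodule K R M" "K \<subset> N"
        then have "len K < enat k" using len_strict_mono[OF K(1) N(1) K(2)] N(2) by simp
        then obtain l where "len K = enat l" "l < k" by (cases "len K") auto
        then show "P K" using less K(1) by blast
      qed
    qed
  qed
  moreover obtain k where "len N = enat k" using fin'[OF N] by auto
  ultimately show ?thesis using N by blast
qed

end

lemma module_length_eq_len:
  assumes "module R M"
  shows "module_length R M = module.len R M (carrier M)"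
proof -
  interpret module R M by fact
  \<comment> \<open>The indexed chain is only required to end inside B. Then C n < C (n+1) inside B
    counts as one step, and conversely B itself can be put on top.\<close>
  have iff: "(\<exists>C. (\<forall>i\<le>n. submodule (C i) R M) \<and> (\<forall>i<n. C i \<subset> C (Suc i)) \<and> C n \<subseteq> B)
      \<longleftrightarrow> length_chain R M {\<zero>\<^bsub>M\<^esub>} n B" if "submodule B R M" for n B
    using that
  proof (induction n arbitrary: B)
    case 0
    have "(\<exists>C. submodule (C 0) R M \<and> C 0 \<subseteq> B)" using 0 by (intro exI[of _ "\<lambda>_. B"]) simp
    then show ?case using submodule_zero[OF 0] by auto
  next
    case (Suc n)
    show ?case
    proof
      assume "\<exists>C. (\<forall>i\<le>Suc n. submodule (C i) R M) \<and> (\<forall>i<Suc n. C i \<subset> C (Suc i)) \<and> C (Suc n) \<subseteq> B"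
      then obtain C where C: "\<forall>i\<le>Suc n. submodule (C i) R M" "\<forall>i<Suc n. C i \<subset> C (Suc i)"
        "C (Suc n) \<subseteq> B" by blast
      have "submodule (C n) R M" using C(1) by simp
      from Suc.IH[OF this] have "length_chain R M {\<zero>\<^bsub>M\<^esub>} n (C n)"
        using C(1,2) by (metis le_SucI less_SucI order_refl)
      moreover have "C n \<subset> B" using C(2,3) by blast
      ultimately show "length_chain R M {\<zero>\<^bsub>M\<^esub>} (Suc n) B"
        using \<open>submodule (C n) R M\<close> unfolding length_chain.simps by blast
    next
      assume "length_chain R M {\<zero>\<^bsub>M\<^esub>} (Suc n) B"
      then obtain D where D: "submodule D R M" "D \<subset> B" "length_chain R M {\<zero>\<^bsub>M\<^esub>} n D" by auto
      then obtain C where C: "\<forall>i\<le>n. submodule (C i) R M" "\<forall>i<n. C i \<subset> C (Suc i)" "C n \<subseteq> D"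
        using Suc.IH[OF D(1)] by auto
      let ?C = "C(Suc n := B)"
      have "(\<forall>i\<le>Suc n. submodule (?C i) R M)" using C(1) Suc.prems by (auto simp: le_Suc_eq)
      moreover have "\<forall>i<Suc n. ?C i \<subset> ?C (Suc i)" using C(2,3) D(2) by (auto simp: less_Suc_eq)
      ultimately show "\<exists>C. (\<forall>i\<le>Suc n. submodule (C i) R M) \<and> (\<forall>i<Suc n. C i \<subset> C (Suc i))
          \<and> C (Suc n) \<subseteq> B" by (intro exI[of _ ?C]) simp
    qed
  qed
  have "(\<exists>C. (\<forall>i\<le>n. submodule (C i) R M) \<and> (\<forall>i<n. C i \<subset> C (Suc i)))
      \<longleftrightarrow> length_chain R M {\<zero>\<^bsub>M\<^esub>} n (carrier M)" for n
    unfolding iff[OF carrier_is_submodule, symmetric] using submoduleE(1) by blast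
  then show ?thesis by (simp add: module_length_def rel_length_def)
qed

text \<open>The correspondence theorem for chains: a submodule goes to its image, and back to its
  preimage in N. All members of the chain contain the kernel part of N, so this part does not change
  in the induction.\<close>

lemma length_chain_hom_iff:
  assumes A: "module R A" and B: "module R B" and f: "f \<in> rmod_hom R A B"
    and N: "submodule N R A"
  shows "length_chain R A (N \<inter> rmod_kernel A B f) n N \<longleftrightarrow> length_chain R B {\<zero>\<^bsub>B\<^esub>} n (f ` N)"
  using N
proof (induction n arbitrary: N)
  case 0
  interpret A: module R A by fact
  interpret B: module R B by fact
  have "\<zero>\<^bsub>B\<^esub> \<in> f ` N" by (rule B.submodule_zero[OF submodule_image[OF A B f 0]])
  then show ?case by auto
next
  case (Suc n)
  interpret A: module R A by fact
  interpret B: module R B by fact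
  note N = A.submodule_in_carrier[OF Suc.prems]
  show ?case
  proof
    assume "length_chain R A (N \<inter> rmod_kernel A B f) (Suc n) N"
    then obtain D where D: "submodule D R A" "D \<subset> N"
      "length_chain R A (N \<inter> rmod_kernel A B f) n D" by auto
    have "D \<inter> rmod_kernel A B f = N \<inter> rmod_kernel A B f"
      using length_chain_subset[OF D(3)] D(2) by blast
    then have "length_chain R B {\<zero>\<^bsub>B\<^esub>} n (f ` D)" using Suc.IH[OF D(1)] D(3) by simp
    moreover have "f ` D \<noteq> f ` N"
    proof
      assume eq: "f ` D = f ` N"
      obtain x where x: "x \<in> N" "x \<notin> D" using D(2) by blast
      then have "f x \<in> f ` D" using eq by blast
      then obtain y where y: "y \<in> D" "f x = f y" by auto
      have xy: "x \<in> carrier A" "y \<in> carrier A" using x y D(2) N by auto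
      then have "f (x \<ominus>\<^bsub>A\<^esub> y) = \<zero>\<^bsub>B\<^esub>"
        using y(2) rmod_homD(1)[OF f] by (simp add: rmod_hom_minus[OF A B f] B.M.minus_eq_zero_iff)
      then have "x \<ominus>\<^bsub>A\<^esub> y \<in> N \<inter> rmod_kernel A B f"
        using A.submodule_minus[OF Suc.prems x(1)] y(1) D(2) xy by (auto simp: rmod_kernel_def)
      then have "x \<ominus>\<^bsub>A\<^esub> y \<in> D" using length_chain_subset[OF D(3)] by blast
      then have "(x \<ominus>\<^bsub>A\<^esub> y) \<oplus>\<^bsub>A\<^esub> y \<in> D" using y(1) A.submoduleD(3)[OF D(1)] by blast
      then show False using x(2) xy by (simp add: A.M.minus_add_cancel)
    qed
    ultimately show "length_chain R B {\<zero>\<^bsub>B\<^esub>} (Suc n) (f ` N)"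
      using D(2) submodule_image[OF A B f D(1)] by (auto intro!: exI[of _ "f ` D"])
  next
    assume "length_chain R B {\<zero>\<^bsub>B\<^esub>} (Suc n) (f ` N)"
    then obtain D' where D': "submodule D' R B" "D' \<subset> f ` N" "length_chain R B {\<zero>\<^bsub>B\<^esub>} n D'" by auto
    define D where "D = N \<inter> {x \<in> carrier A. f x \<in> D'}"
    have D: "submodule D R A" unfolding D_def
      by (intro A.submodule_Int Suc.prems submodule_vimage[OF A B f D'(1)])
    have im: "f ` D = D'" using D'(2) N unfolding D_def by auto
    have ker: "D \<inter> rmod_kernel A B f = N \<inter> rmod_kernel A B f"
      using B.submodule_zero[OF D'(1)] by (auto simp: D_def rmod_kernel_def)
    have "length_chain R A (N \<inter> rmod_kernel A B f) n D"
      using Suc.IH[OF D] D'(3) im ker by simp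
    moreover have "D \<subset> N" using D'(2) im unfolding D_def by blast
    ultimately show "length_chain R A (N \<inter> rmod_kernel A B f) (Suc n) N" using D by auto
  qed
qed

text \<open>The length form of the isomorphism theorem for N modulo kernel; every later length count
  is an instance of it.\<close>

lemma len_hom:
  assumes A: "module R A" and B: "module R B" and f: "f \<in> rmod_hom R A B"
    and N: "submodule N R A"
  shows "module.len R A N = module.len R A (N \<inter> rmod_kernel A B f) + module.len R B (f ` N)"
proof -
  interpret A: module R A by fact
  interpret B: module R B by fact
  have K: "submodule (N \<inter> rmod_kernel A B f) R A"
    by (intro A.submodule_Int N submodule_kernel[OF A B f])
  have "rel_length R A (N \<inter> rmod_kernel A B f) N = B.len (f ` N)"
    unfolding rel_length_def length_chain_hom_iff[OF A B f N] ..
  moreover have "{\<zero>\<^bsub>A\<^esub>} \<subseteq> N \<inter> rmod_kernel A B f" using A.submodule_zero[OF K] by auto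
  ultimately show ?thesis
    using A.rel_length_add[OF A.submodule_zero_module K N] by simp
qed

lemma len_hom_inj:
  assumes A: "module R A" and B: "module R B" and f: "f \<in> rmod_hom R A B"
    and N: "submodule N R A" and ker: "N \<inter> rmod_kernel A B f \<subseteq> {\<zero>\<^bsub>A\<^esub>}"
  shows "module.len R B (f ` N) = module.len R A N"
proof -
  interpret A: module R A by fact
  interpret B: module R B by fact
  have "N \<inter> rmod_kernel A B f = {\<zero>\<^bsub>A\<^esub>}"
    using ker A.submodule_zero[OF A.submodule_Int[OF N submodule_kernel[OF A B f]]] by blast
  then show ?thesis using len_hom[OF A B f N] by (simp add: A.rel_length_self)
qed

section \<open>Finite direct sums\<close>

lemma finite_direct_sum_simps [simp]:
  "carrier (finite_direct_sum I Y) = (\<Pi>\<^sub>E i\<in>I. carrier (Y i))"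
  "\<zero>\<^bsub>finite_direct_sum I Y\<^esub> = (\<lambda>i\<in>I. \<zero>\<^bsub>Y i\<^esub>)"
  "x \<oplus>\<^bsub>finite_direct_sum I Y\<^esub> y = (\<lambda>i\<in>I. x i \<oplus>\<^bsub>Y i\<^esub> y i)"
  "r \<odot>\<^bsub>finite_direct_sum I Y\<^esub> x = (\<lambda>i\<in>I. r \<odot>\<^bsub>Y i\<^esub> x i)"
  by (simp_all add: finite_direct_sum_def)

lemma module_finite_direct_sum:
  assumes R: "cring R" and Y: "\<And>i. i \<in> I \<Longrightarrow> module R (Y i)"
  shows "module R (finite_direct_sum I Y)"
proof (rule moduleI[OF R])
  have ab: "abelian_group (Y i)" if "i \<in> I" for i
    using Y[OF that] by (simp add: module_def)
  note cl = PiE_mem abelian_groupE[OF ab] abelian_monoid.a_closed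
  show "abelian_group (finite_direct_sum I Y)"
  proof (rule abelian_groupI)
    fix x assume x: "x \<in> carrier (finite_direct_sum I Y)"
    then show "\<exists>y\<in>carrier (finite_direct_sum I Y).
        y \<oplus>\<^bsub>finite_direct_sum I Y\<^esub> x = \<zero>\<^bsub>finite_direct_sum I Y\<^esub>"
      by (intro bexI[of _ "\<lambda>i\<in>I. \<ominus>\<^bsub>Y i\<^esub> x i"])
        (auto intro!: restrict_ext abelian_group.l_neg[OF ab] abelian_group.a_inv_closed[OF ab])
    show "\<zero>\<^bsub>finite_direct_sum I Y\<^esub> \<oplus>\<^bsub>finite_direct_sum I Y\<^esub> x = x"
      using x by (auto intro!: extensionalityI[of _ I] abelian_groupE(5)[OF ab] simp: PiE_def)
  next
    fix x y assume "x \<in> carrier (finite_direct_sum I Y)" "y \<in> carrier (finite_direct_sum I Y)"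
    then show "x \<oplus>\<^bsub>finite_direct_sum I Y\<^esub> y \<in> carrier (finite_direct_sum I Y)"
      "x \<oplus>\<^bsub>finite_direct_sum I Y\<^esub> y = y \<oplus>\<^bsub>finite_direct_sum I Y\<^esub> x"
      by (auto intro!: restrict_ext abelian_groupE(1,4)[OF ab])
  next
    fix x y z assume "x \<in> carrier (finite_direct_sum I Y)" "y \<in> carrier (finite_direct_sum I Y)"
      "z \<in> carrier (finite_direct_sum I Y)"
    then show "x \<oplus>\<^bsub>finite_direct_sum I Y\<^esub> y \<oplus>\<^bsub>finite_direct_sum I Y\<^esub> z =
        x \<oplus>\<^bsub>finite_direct_sum I Y\<^esub> (y \<oplus>\<^bsub>finite_direct_sum I Y\<^esub> z)"
      by (auto intro!: restrict_ext abelian_groupE(3)[OF ab])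
  qed (auto intro!: abelian_groupE(2)[OF ab])
next
  fix a x assume "a \<in> carrier R" "x \<in> carrier (finite_direct_sum I Y)"
  then show "a \<odot>\<^bsub>finite_direct_sum I Y\<^esub> x \<in> carrier (finite_direct_sum I Y)"
    by (auto intro!: module.smult_closed[OF Y])
next
  fix a b x assume ab: "a \<in> carrier R" "b \<in> carrier R" "x \<in> carrier (finite_direct_sum I Y)"
  then show "(a \<oplus>\<^bsub>R\<^esub> b) \<odot>\<^bsub>finite_direct_sum I Y\<^esub> x =
      a \<odot>\<^bsub>finite_direct_sum I Y\<^esub> x \<oplus>\<^bsub>finite_direct_sum I Y\<^esub> b \<odot>\<^bsub>finite_direct_sum I Y\<^esub> x"
    by (auto intro!: restrict_ext module.smult_l_distr[OF Y])
  show "(a \<otimes>\<^bsub>R\<^esub> b) \<odot>\<^bsub>finite_direct_sum I Y\<^esub> x =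
      a \<odot>\<^bsub>finite_direct_sum I Y\<^esub> (b \<odot>\<^bsub>finite_direct_sum I Y\<^esub> x)"
    using ab by (auto intro!: restrict_ext module.smult_assoc1[OF Y])
next
  fix a x y assume "a \<in> carrier R" "x \<in> carrier (finite_direct_sum I Y)"
    "y \<in> carrier (finite_direct_sum I Y)"
  then show "a \<odot>\<^bsub>finite_direct_sum I Y\<^esub> (x \<oplus>\<^bsub>finite_direct_sum I Y\<^esub> y) =
      a \<odot>\<^bsub>finite_direct_sum I Y\<^esub> x \<oplus>\<^bsub>finite_direct_sum I Y\<^esub> a \<odot>\<^bsub>finite_direct_sum I Y\<^esub> y"
    by (auto intro!: restrict_ext module.smult_r_distr[OF Y])
next
  fix x assume "x \<in> carrier (finite_direct_sum I Y)"
  then show "\<one>\<^bsub>R\<^esub> \<odot>\<^bsub>finite_direct_sum I Y\<^esub> x = x"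
    by (auto intro!: extensionalityI[of _ I] module.smult_one[OF Y] simp: PiE_def)
qed

definition single :: "'i set \<Rightarrow> ('i \<Rightarrow> ('a, 'b) module) \<Rightarrow> 'i \<Rightarrow> 'b \<Rightarrow> 'i \<Rightarrow> 'b" where
  "single I Y l z = (\<lambda>i\<in>I. if i = l then z else \<zero>\<^bsub>Y i\<^esub>)"

lemma submodule_PiE:
  assumes R: "cring R" and Y: "\<And>i. i \<in> I \<Longrightarrow> module R (Y i)"
    and B: "\<And>i. i \<in> I \<Longrightarrow> submodule (B i) R (Y i)"
  shows "submodule (\<Pi>\<^sub>E i\<in>I. B i) R (finite_direct_sum I Y)"
proof (rule module.submoduleI_smult[OF module_finite_direct_sum[OF R Y]])
  note D = module.submoduleD[OF Y B]
  show "(\<Pi>\<^sub>E i\<in>I. B i) \<subseteq> carrier (finite_direct_sum I Y)" using D(1) by (auto simp: PiE_iff)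
  show "\<zero>\<^bsub>finite_direct_sum I Y\<^esub> \<in> (\<Pi>\<^sub>E i\<in>I. B i)" using D(2) by auto
  show "a \<oplus>\<^bsub>finite_direct_sum I Y\<^esub> b \<in> (\<Pi>\<^sub>E i\<in>I. B i)"
    if "a \<in> (\<Pi>\<^sub>E i\<in>I. B i)" "b \<in> (\<Pi>\<^sub>E i\<in>I. B i)" for a b using that D(3) by (auto simp: PiE_iff)
  show "a \<odot>\<^bsub>finite_direct_sum I Y\<^esub> x \<in> (\<Pi>\<^sub>E i\<in>I. B i)"
    if "a \<in> carrier R" "x \<in> (\<Pi>\<^sub>E i\<in>I. B i)" for a x using that D(4) by (auto simp: PiE_iff)
qed

text \<open>A tuple is the sum of its coordinate vectors. The induction adds them one at a time,
  with k coordinates filled in and the others zero.\<close>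

lemma PiE_lessThan_subset_submodule:
  fixes s :: nat
  assumes R: "cring R" and Y: "\<And>i. i < s \<Longrightarrow> module R (Y i)"
    and B: "\<And>i. i < s \<Longrightarrow> submodule (B i) R (Y i)"
    and N: "submodule N R (finite_direct_sum {..<s} Y)"
    and gen: "\<And>l z. l < s \<Longrightarrow> z \<in> B l \<Longrightarrow> single {..<s} Y l z \<in> N"
  shows "(\<Pi>\<^sub>E i\<in>{..<s}. B i) \<subseteq> N"
proof
  fix w assume w: "w \<in> (\<Pi>\<^sub>E i\<in>{..<s}. B i)"
  have F: "module R (finite_direct_sum {..<s} Y)" by (rule module_finite_direct_sum[OF R]) (simp add: Y)
  note ab = module.axioms(2)[OF Y]
  have wc: "w i \<in> carrier (Y i)" if "i < s" for i
    using w that module.submodule_in_carrier[OF Y B] by (auto simp: PiE_iff)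
  have "k \<le> s \<Longrightarrow> (\<lambda>i\<in>{..<s}. if i < k then w i else \<zero>\<^bsub>Y i\<^esub>) \<in> N" for k
  proof (induction k)
    case 0
    have "(\<lambda>i\<in>{..<s}. if i < 0 then w i else \<zero>\<^bsub>Y i\<^esub>) = \<zero>\<^bsub>finite_direct_sum {..<s} Y\<^esub>"
      by (auto intro!: restrict_ext)
    then show ?case using module.submodule_zero[OF F N] by (simp only:)
  next
    case (Suc k)
    then have "k < s" by simp
    have "(\<lambda>i\<in>{..<s}. if i < k then w i else \<zero>\<^bsub>Y i\<^esub>) \<in> N"
      by (rule Suc.IH) (use Suc.prems in simp)
    moreover have "single {..<s} Y k (w k) \<in> N" using w \<open>k < s\<close> by (intro gen) auto
    ultimately have "(\<lambda>i\<in>{..<s}. if i < k then w i else \<zero>\<^bsub>Y i\<^esub>) \<oplus>\<^bsub>finite_direct_sum {..<s} Y\<^esub>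
        single {..<s} Y k (w k) \<in> N"
      by (intro module.submoduleD(3)[OF F N])
    also have "(\<lambda>i\<in>{..<s}. if i < k then w i else \<zero>\<^bsub>Y i\<^esub>) \<oplus>\<^bsub>finite_direct_sum {..<s} Y\<^esub>
        single {..<s} Y k (w k) = (\<lambda>i\<in>{..<s}. if i < Suc k then w i else \<zero>\<^bsub>Y i\<^esub>)"
    proof -
      have "(if i < k then w i else \<zero>\<^bsub>Y i\<^esub>) \<oplus>\<^bsub>Y i\<^esub> (if i = k then w k else \<zero>\<^bsub>Y i\<^esub>) =
          (if i < Suc k then w i else \<zero>\<^bsub>Y i\<^esub>)" if "i < s" for i
      proof -
        interpret abelian_group "Y i" using ab[OF that] .
        show ?thesis
          by (cases "i = k") (use l_zero[OF wc[OF that]] r_zero[OF wc[OF that]] in auto)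
      qed
      then show ?thesis by (auto simp: single_def intro!: restrict_ext)
    qed
    finally show ?case .
  qed
  from this[of s] have "(\<lambda>i\<in>{..<s}. if i < s then w i else \<zero>\<^bsub>Y i\<^esub>) \<in> N" by simp
  also have "(\<lambda>i\<in>{..<s}. if i < s then w i else \<zero>\<^bsub>Y i\<^esub>) = w"
    using w by (intro extensionalityI[of _ "{..<s}"]) (auto simp: PiE_iff)
  finally show "w \<in> N" .
qed

text \<open>Induction on s: forgetting the last coordinate maps onto the smaller product, and
  evaluation at s identifies the kernel of this map with B s.\<close>

lemma len_PiE:
  fixes s :: nat
  assumes R: "cring R" and Y: "\<And>i. i < s \<Longrightarrow> module R (Y i)"
    and B: "\<And>i. i < s \<Longrightarrow> submodule (B i) R (Y i)"
  shows "module.len R (finite_direct_sum {..<s} Y) (\<Pi>\<^sub>E i\<in>{..<s}. B i) =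
    (\<Sum>i<s. module.len R (Y i) (B i))"
  using Y B
proof (induction s)
  case 0
  have F: "module R (finite_direct_sum {} Y)" by (rule module_finite_direct_sum[OF R]) simp
  \<comment> \<open>The empty direct sum has the single element
    \<open>\<lambda>_. undefined\<close>, which is its zero.\<close>
  show ?case using module.rel_length_self[OF F, of "{\<lambda>_. undefined}"] by simp
next
  case (Suc s)
  let ?F = "finite_direct_sum {..<Suc s} Y" and ?G = "finite_direct_sum {..<s} Y"
  have F: "module R ?F" and G: "module R ?G"
    by (rule module_finite_direct_sum[OF R]; simp add: Suc.prems)+
  interpret F: module R ?F by fact
  interpret G: module R ?G by fact
  have Ys: "module R (Y s)" by (simp add: Suc.prems)
  interpret Ys: module R "Y s" by fact
  let ?N = "\<Pi>\<^sub>E i\<in>{..<Suc s}. B i"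
  have N: "submodule ?N R ?F" by (rule submodule_PiE[OF R]) (auto simp: Suc.prems)
  note D = module.submoduleD[OF Suc.prems]
  define f where "f x = restrict x {..<s}" for x :: "nat \<Rightarrow> 'c"
  have f: "f \<in> rmod_hom R ?F ?G"
    by (rule rmod_homI) (auto simp: f_def PiE_iff intro!: restrict_ext)
  have g: "(\<lambda>x. x s) \<in> rmod_hom R ?F (Y s)"
    by (rule rmod_homI) auto
  have fN: "f ` ?N = (\<Pi>\<^sub>E i\<in>{..<s}. B i)"
  proof
    show "f ` ?N \<subseteq> (\<Pi>\<^sub>E i\<in>{..<s}. B i)"
    proof (rule image_subsetI)
      fix x assume "x \<in> ?N"
      then show "f x \<in> (\<Pi>\<^sub>E i\<in>{..<s}. B i)"
        unfolding f_def by (intro restrict_PiE_iff[THEN iffD2]) (auto simp: PiE_iff)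
    qed
    show "(\<Pi>\<^sub>E i\<in>{..<s}. B i) \<subseteq> f ` ?N"
    proof
      fix x assume x: "x \<in> (\<Pi>\<^sub>E i\<in>{..<s}. B i)"
      show "x \<in> f ` ?N"
      proof (rule image_eqI)
        show "x = f (x(s := \<zero>\<^bsub>Y s\<^esub>))"
          using x by (auto simp: f_def fun_eq_iff PiE_iff extensional_def)
        show "x(s := \<zero>\<^bsub>Y s\<^esub>) \<in> ?N"
          using x D(2) by (auto simp: PiE_iff extensional_def less_Suc_eq)
      qed
    qed
  qed
  let ?K = "?N \<inter> rmod_kernel ?F ?G f"
  have K: "submodule ?K R ?F" by (intro F.submodule_Int N submodule_kernel[OF F G f])
  have K0: "x i = \<zero>\<^bsub>Y i\<^esub>" if "x \<in> ?K" "i < s" for x i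
  proof -
    have "f x = \<zero>\<^bsub>?G\<^esub>" using that(1) unfolding rmod_kernel_def by blast
    then have "restrict x {..<s} i = (\<lambda>i\<in>{..<s}. \<zero>\<^bsub>Y i\<^esub>) i"
      unfolding f_def finite_direct_sum_simps by (rule fun_cong)
    then show ?thesis using that(2) by simp
  qed
  have gK: "(\<lambda>x. x s) ` ?K = B s"
  proof
    show "(\<lambda>x. x s) ` ?K \<subseteq> B s" by auto
    show "B s \<subseteq> (\<lambda>x. x s) ` ?K"
    proof
      fix z assume z: "z \<in> B s"
      show "z \<in> (\<lambda>x. x s) ` ?K"
      proof (rule image_eqI[of _ _ "single {..<Suc s} Y s z"])
        show "z = (single {..<Suc s} Y s z) s" by (simp add: single_def)
        show "single {..<Suc s} Y s z \<in> ?K"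
          using z D(1,2) by (auto simp: single_def rmod_kernel_def f_def intro!: restrict_ext)
      qed
    qed
  qed
  have inj: "?K \<inter> rmod_kernel ?F (Y s) (\<lambda>x. x s) \<subseteq> {\<zero>\<^bsub>?F\<^esub>}"
  proof
    fix x assume x: "x \<in> ?K \<inter> rmod_kernel ?F (Y s) (\<lambda>x. x s)"
    show "x \<in> {\<zero>\<^bsub>?F\<^esub>}"
    proof -
      have *: "x s = \<zero>\<^bsub>Y s\<^esub>" "x \<in> ?K"
        using IntD2[OF x] IntD1[OF x] by (simp_all only: rmod_kernel_def mem_Collect_eq)
      moreover have "x \<in> ?N" using IntD1[OF *(2)] .
      ultimately have "x = (\<lambda>i\<in>{..<Suc s}. \<zero>\<^bsub>Y i\<^esub>)"
        by (intro extensionalityI[of _ "{..<Suc s}"]) (auto simp: K0[OF *(2)] less_Suc_eq PiE_def)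
      then show ?thesis by simp
    qed
  qed
  have "F.len ?N = F.len ?K + G.len (\<Pi>\<^sub>E i\<in>{..<s}. B i)"
    using len_hom[OF F G f N] fN by simp
  also have "F.len ?K = Ys.len (B s)" using len_hom_inj[OF F Ys g K inj] gK by simp
  also have "G.len (\<Pi>\<^sub>E i\<in>{..<s}. B i) = (\<Sum>i<s. module.len R (Y i) (B i))"
    by (rule Suc.IH) (auto simp: Suc.prems)
  finally show ?case by (simp add: add.commute)
qed

lemma module_free_module: "cring R \<Longrightarrow> module R (free_module R n)"
  unfolding free_module_def by (rule module_finite_direct_sum) (auto intro: module_self_module)

section \<open>Free resolutions and Ext\<close>

lemma free_module_simps [simp]:
  "carrier (free_module R n) = ({..<n} \<rightarrow>\<^sub>E carrier R)"
  "\<zero>\<^bsub>free_module R n\<^esub> = (\<lambda>i\<in>{..<n}. \<zero>\<^bsub>R\<^esub>)"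
  "x \<oplus>\<^bsub>free_module R n\<^esub> y = (\<lambda>i\<in>{..<n}. x i \<oplus>\<^bsub>R\<^esub> y i)"
  "r \<odot>\<^bsub>free_module R n\<^esub> x = (\<lambda>i\<in>{..<n}. r \<otimes>\<^bsub>R\<^esub> x i)"
  by (simp_all add: free_module_def)

lemma rmod_hom_zero_map:
  assumes "module R B"
  shows "(\<lambda>_. \<zero>\<^bsub>B\<^esub>) \<in> rmod_hom R A B"
proof -
  interpret module R B by fact
  show ?thesis by (rule rmod_homI) auto
qed

text \<open>The universal property of a free module, one basis vector at a time: the new last basis
  vector goes to x.\<close>

lemma free_hom_Suc:
  assumes A: "module R A" and g: "g \<in> rmod_hom R (free_module R n) A" and x: "x \<in> carrier A"
  shows "(\<lambda>v. g (restrict v {..<n}) \<oplus>\<^bsub>A\<^esub> v n \<odot>\<^bsub>A\<^esub> x) \<in> rmod_hom R (free_module R (Suc n)) A"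
proof -
  interpret A: module R A by fact
  have rc: "restrict v {..<n} \<in> carrier (free_module R n)" "v n \<in> carrier R"
    if "v \<in> carrier (free_module R (Suc n))" for v
    using that by (auto simp: PiE_iff)
  have gc: "g (restrict v {..<n}) \<in> carrier A" if "v \<in> carrier (free_module R (Suc n))" for v
    using rmod_homD(1)[OF g rc(1)[OF that]] .
  show ?thesis
  proof (rule rmod_homI)
    fix v assume v: "v \<in> carrier (free_module R (Suc n))"
    then show "g (restrict v {..<n}) \<oplus>\<^bsub>A\<^esub> v n \<odot>\<^bsub>A\<^esub> x \<in> carrier A"
      using gc[OF v] rc(2)[OF v] x by blast
  next
    fix v w assume v: "v \<in> carrier (free_module R (Suc n))" and w: "w \<in> carrier (free_module R (Suc n))"
    have "restrict (v \<oplus>\<^bsub>free_module R (Suc n)\<^esub> w) {..<n} =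
        restrict v {..<n} \<oplus>\<^bsub>free_module R n\<^esub> restrict w {..<n}"
      by (auto intro!: restrict_ext)
    then have "g (restrict (v \<oplus>\<^bsub>free_module R (Suc n)\<^esub> w) {..<n}) =
        g (restrict v {..<n}) \<oplus>\<^bsub>A\<^esub> g (restrict w {..<n})"
      by (simp only: rmod_homD(2)[OF g rc(1)[OF v] rc(1)[OF w]])
    then show "g (restrict (v \<oplus>\<^bsub>free_module R (Suc n)\<^esub> w) {..<n}) \<oplus>\<^bsub>A\<^esub>
        (v \<oplus>\<^bsub>free_module R (Suc n)\<^esub> w) n \<odot>\<^bsub>A\<^esub> x =
        g (restrict v {..<n}) \<oplus>\<^bsub>A\<^esub> v n \<odot>\<^bsub>A\<^esub> x \<oplus>\<^bsub>A\<^esub> (g (restrict w {..<n}) \<oplus>\<^bsub>A\<^esub> w n \<odot>\<^bsub>A\<^esub> x)"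
      using gc[OF v] gc[OF w] rc(2)[OF v] rc(2)[OF w] x
      by (simp add: A.smult_l_distr A.M.a_ac del: restrict_apply) (simp add: A.smult_l_distr A.M.a_ac)
  next
    fix r v assume r: "r \<in> carrier R" and v: "v \<in> carrier (free_module R (Suc n))"
    have "restrict (r \<odot>\<^bsub>free_module R (Suc n)\<^esub> v) {..<n} = r \<odot>\<^bsub>free_module R n\<^esub> restrict v {..<n}"
      by (auto intro!: restrict_ext)
    then have "g (restrict (r \<odot>\<^bsub>free_module R (Suc n)\<^esub> v) {..<n}) = r \<odot>\<^bsub>A\<^esub> g (restrict v {..<n})"
      by (simp only: rmod_homD(3)[OF g r rc(1)[OF v]])
    moreover have "(r \<odot>\<^bsub>free_module R (Suc n)\<^esub> v) n = r \<otimes>\<^bsub>R\<^esub> v n" by simp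
    ultimately show "g (restrict (r \<odot>\<^bsub>free_module R (Suc n)\<^esub> v) {..<n}) \<oplus>\<^bsub>A\<^esub>
        (r \<odot>\<^bsub>free_module R (Suc n)\<^esub> v) n \<odot>\<^bsub>A\<^esub> x = r \<odot>\<^bsub>A\<^esub> (g (restrict v {..<n}) \<oplus>\<^bsub>A\<^esub> v n \<odot>\<^bsub>A\<^esub> x)"
      using gc[OF v] rc(2)[OF v] x r by (simp only: A.smult_r_distr A.smult_closed A.smult_assoc1)
  qed
qed

lemma free_module_decompose:
  assumes R: "cring R" and v: "v \<in> carrier (free_module R (Suc n))"
  shows "v = (restrict v {..<n})(n := \<zero>\<^bsub>R\<^esub>) \<oplus>\<^bsub>free_module R (Suc n)\<^esub>
    v n \<odot>\<^bsub>free_module R (Suc n)\<^esub> single {..<Suc n} (\<lambda>_. self_module R) n \<one>\<^bsub>R\<^esub>"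
proof -
  interpret cring R by fact
  have c: "v i \<in> carrier R" if "i < Suc n" for i using v that by auto
  show ?thesis
  proof (rule extensionalityI[of _ "{..<Suc n}"])
    fix i assume "i \<in> {..<Suc n}"
    then show "v i = ((restrict v {..<n})(n := \<zero>\<^bsub>R\<^esub>) \<oplus>\<^bsub>free_module R (Suc n)\<^esub>
        v n \<odot>\<^bsub>free_module R (Suc n)\<^esub> single {..<Suc n} (\<lambda>_. self_module R) n \<one>\<^bsub>R\<^esub>) i"
      using c[of i] c[of n] by (auto simp: single_def less_Suc_eq)
  qed (use v in \<open>auto simp: PiE_def\<close>)
qed

lemma free_embed_hom:
  assumes "cring R"
  shows "(\<lambda>v. v(n := \<zero>\<^bsub>R\<^esub>)) \<in> rmod_hom R (free_module R n) (free_module R (Suc n))"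
proof -
  interpret cring R by fact
  show ?thesis
  proof (rule rmod_homI)
    fix x assume "x \<in> carrier (free_module R n)"
    then show "x(n := \<zero>\<^bsub>R\<^esub>) \<in> carrier (free_module R (Suc n))"
      by (auto simp: PiE_iff extensional_def less_Suc_eq)
  next
    fix x y assume "x \<in> carrier (free_module R n)" "y \<in> carrier (free_module R n)"
    show "(x \<oplus>\<^bsub>free_module R n\<^esub> y)(n := \<zero>\<^bsub>R\<^esub>) = x(n := \<zero>\<^bsub>R\<^esub>) \<oplus>\<^bsub>free_module R (Suc n)\<^esub> y(n := \<zero>\<^bsub>R\<^esub>)"
      by (auto simp: fun_eq_iff)
  next
    fix r x assume "r \<in> carrier R" "x \<in> carrier (free_module R n)"
    then show "(r \<odot>\<^bsub>free_module R n\<^esub> x)(n := \<zero>\<^bsub>R\<^esub>) = r \<odot>\<^bsub>free_module R (Suc n)\<^esub> x(n := \<zero>\<^bsub>R\<^esub>)"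
      by (auto simp: fun_eq_iff)
  qed
qed

text \<open>Projectivity of R^n, by choosing a preimage y for the value at the last basis vector.
  Only the values of f have to lie in the image of \<pi>, so that lifting works for maps into a
  kernel that is known to be an image.\<close>

lemma free_lift:
  assumes A: "module R A" and B: "module R B" and \<pi>: "\<pi> \<in> rmod_hom R B A"
    and f: "f \<in> rmod_hom R (free_module R n) A"
    and im: "\<And>v. v \<in> carrier (free_module R n) \<Longrightarrow> f v \<in> \<pi> ` carrier B"
  shows "\<exists>u\<in>rmod_hom R (free_module R n) B. \<forall>v\<in>carrier (free_module R n). \<pi> (u v) = f v"
  using f im
proof (induction n arbitrary: f)
  case 0
  interpret A: module R A by fact
  interpret B: module R B by fact
  have "f (\<zero>\<^bsub>free_module R 0\<^esub>) = \<zero>\<^bsub>A\<^esub>"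
    by (rule rmod_hom_zero[OF module_free_module[OF A.R.is_cring] A 0(1)])
  then show ?case
    by (intro bexI[OF _ rmod_hom_zero_map[OF B]]) (auto simp: rmod_hom_zero[OF B A \<pi>] restrict_def)
next
  case (Suc n)
  interpret A: module R A by fact
  interpret B: module R B by fact
  note F = module_free_module[OF A.R.is_cring]
  interpret F: module R "free_module R (Suc n)" by (rule F)
  let ?e = "\<lambda>v. v(n := \<zero>\<^bsub>R\<^esub>)"
  let ?u = "single {..<Suc n} (\<lambda>_. self_module R) n \<one>\<^bsub>R\<^esub>"
  note e = free_embed_hom[OF A.R.is_cring, of n]
  have uc: "?u \<in> carrier (free_module R (Suc n))" by (auto simp: single_def)
  have fe: "(\<lambda>v. f (?e v)) \<in> rmod_hom R (free_module R n) A"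
    by (rule rmod_hom_comp[OF e Suc.prems(1)])
  have "f (?e v) \<in> \<pi> ` carrier B" if "v \<in> carrier (free_module R n)" for v
    by (rule Suc.prems(2)[OF rmod_homD(1)[OF e that]])
  from Suc.IH[OF fe this] obtain u where u: "u \<in> rmod_hom R (free_module R n) B"
    "\<And>v. v \<in> carrier (free_module R n) \<Longrightarrow> \<pi> (u v) = f (?e v)" by blast
  obtain y where y: "y \<in> carrier B" "f ?u = \<pi> y" using Suc.prems(2)[OF uc] by blast
  show ?case
  proof (intro bexI ballI)
    show "(\<lambda>v. u (restrict v {..<n}) \<oplus>\<^bsub>B\<^esub> v n \<odot>\<^bsub>B\<^esub> y) \<in> rmod_hom R (free_module R (Suc n)) B"
      by (rule free_hom_Suc[OF B u(1) y(1)])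
    fix v assume v: "v \<in> carrier (free_module R (Suc n))"
    have rc: "restrict v {..<n} \<in> carrier (free_module R n)" and vn: "v n \<in> carrier R"
      using v by (auto simp: PiE_iff)
    have "\<pi> (u (restrict v {..<n}) \<oplus>\<^bsub>B\<^esub> v n \<odot>\<^bsub>B\<^esub> y) = f (?e (restrict v {..<n})) \<oplus>\<^bsub>A\<^esub> v n \<odot>\<^bsub>A\<^esub> f ?u"
      using rmod_homD(1)[OF u(1) rc] vn y u(2)[OF rc]
      by (simp only: rmod_homD(2,3)[OF \<pi>] B.smult_closed)
    also have "\<dots> = f (?e (restrict v {..<n}) \<oplus>\<^bsub>free_module R (Suc n)\<^esub> v n \<odot>\<^bsub>free_module R (Suc n)\<^esub> ?u)"
      by (simp only: rmod_homD(2)[OF Suc.prems(1) rmod_homD(1)[OF e rc] F.smult_closed[OF vn uc]]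
          rmod_homD(3)[OF Suc.prems(1) vn uc])
    also have "\<dots> = f v" by (simp only: free_module_decompose[OF A.R.is_cring v, symmetric])
    finally show "\<pi> (u (restrict v {..<n}) \<oplus>\<^bsub>B\<^esub> v n \<odot>\<^bsub>B\<^esub> y) = f v" .
  qed
qed

text \<open>If no finite family generated K, adding an element outside the current image would
  lengthen that image each time, beyond the finite length of A.\<close>

lemma finite_length_cover:
  assumes A: "module R A" and fin: "module.len R A (carrier A) \<noteq> \<infinity>" and K: "submodule K R A"
  shows "\<exists>n. \<exists>g\<in>rmod_hom R (free_module R n) A. g ` carrier (free_module R n) = K"
proof (rule ccontr)
  interpret A: module R A by fact
  note F = module_free_module[OF A.R.is_cring]
  assume no: "\<nexists>n. \<exists>g\<in>rmod_hom R (free_module R n) A. g ` carrier (free_module R n) = K"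
  have "\<exists>n. \<exists>g\<in>rmod_hom R (free_module R n) A. g ` carrier (free_module R n) \<subseteq> K
      \<and> enat k \<le> A.len (g ` carrier (free_module R n))" for k
  proof (induction k)
    case 0
    have "(\<lambda>_. \<zero>\<^bsub>A\<^esub>) ` carrier (free_module R 0) \<subseteq> K" using A.submodule_zero[OF K] by auto
    then show ?case using rmod_hom_zero_map[OF A] by (metis zero_enat_def zero_le)
  next
    case (Suc k)
    then obtain n g where g: "g \<in> rmod_hom R (free_module R n) A"
      "g ` carrier (free_module R n) \<subseteq> K" "enat k \<le> A.len (g ` carrier (free_module R n))" by blast
    then have "g ` carrier (free_module R n) \<noteq> K" using no by blast
    then obtain x where x: "x \<in> K" "x \<notin> g ` carrier (free_module R n)" using g(2) by blast
    have xc: "x \<in> carrier A" by (rule A.submodule_in_carrier[OF K x(1)])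
    define h where "h v = g (restrict v {..<n}) \<oplus>\<^bsub>A\<^esub> v n \<odot>\<^bsub>A\<^esub> x" for v
    have h: "h \<in> rmod_hom R (free_module R (Suc n)) A"
      unfolding h_def by (rule free_hom_Suc[OF A g(1) xc])
    have hK: "h ` carrier (free_module R (Suc n)) \<subseteq> K"
    proof (rule image_subsetI)
      fix v assume v: "v \<in> carrier (free_module R (Suc n))"
      then have "restrict v {..<n} \<in> carrier (free_module R n)" "v n \<in> carrier R"
        by (auto simp: PiE_iff)
      then show "h v \<in> K" unfolding h_def using g(2) x(1)
        by (intro A.submoduleD(3,4)[OF K]) auto
    qed
    have gh: "g ` carrier (free_module R n) \<subseteq> h ` carrier (free_module R (Suc n))"
    proof (rule image_subsetI)
      fix v assume v: "v \<in> carrier (free_module R n)"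
      have "restrict (v(n := \<zero>\<^bsub>R\<^esub>)) {..<n} = v"
        using v by (intro extensionalityI[of _ "{..<n}"]) (auto simp: PiE_def)
      then have "h (v(n := \<zero>\<^bsub>R\<^esub>)) = g v"
        using rmod_homD(1)[OF g(1) v] xc by (simp add: h_def)
      then show "g v \<in> h ` carrier (free_module R (Suc n))"
        using rmod_homD(1)[OF free_embed_hom[OF A.R.is_cring] v] by (metis imageI)
    qed
    have "x \<in> h ` carrier (free_module R (Suc n))"
    proof (rule image_eqI)
      show "single {..<Suc n} (\<lambda>_. self_module R) n \<one>\<^bsub>R\<^esub> \<in> carrier (free_module R (Suc n))"
        by (auto simp: single_def)
      have "restrict (single {..<Suc n} (\<lambda>_. self_module R) n \<one>\<^bsub>R\<^esub>) {..<n} = \<zero>\<^bsub>free_module R n\<^esub>"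
        by (auto simp: single_def intro!: restrict_ext)
      then show "x = h (single {..<Suc n} (\<lambda>_. self_module R) n \<one>\<^bsub>R\<^esub>)"
        using rmod_hom_zero[OF F A g(1)] xc by (simp only: h_def) (simp add: single_def)
    qed
    then have strict: "g ` carrier (free_module R n) \<subset> h ` carrier (free_module R (Suc n))"
      using gh x(2) by blast
    have sub: "submodule (g ` carrier (free_module R n)) R A"
      "submodule (h ` carrier (free_module R (Suc n))) R A"
      by (rule submodule_image[OF F A _ module.carrier_is_submodule[OF F]]; fact)+
    have "A.len (h ` carrier (free_module R (Suc n))) \<noteq> \<infinity>"
      using A.len_mono[OF sub(2) A.carrier_is_submodule A.submoduleE(1)[OF sub(2)]] fin enat_ile
      by fastforce
    then have "A.len (g ` carrier (free_module R n)) < A.len (h ` carrier (free_module R (Suc n)))"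
      by (rule A.len_strict_mono[OF sub strict])
    then have "enat (Suc k) \<le> A.len (h ` carrier (free_module R (Suc n)))"
      using g(3) by (metis Suc_ile_eq le_less_trans)
    then show ?case using h hK by blast
  qed
  moreover obtain c where c: "A.len (carrier A) = enat c" using fin by auto
  ultimately obtain n g where g: "g \<in> rmod_hom R (free_module R n) A"
    "enat (Suc c) \<le> A.len (g ` carrier (free_module R n))" by blast
  have sub: "submodule (g ` carrier (free_module R n)) R A"
    by (rule submodule_image[OF F A g(1) module.carrier_is_submodule[OF F]])
  show False
    using g(2) A.len_mono[OF sub A.carrier_is_submodule A.submoduleE(1)[OF sub]] c
    by (metis Suc_n_not_le_n enat_ord_simps(1) order_trans)
qed

lemma free_module_finite_length:
  assumes R: "cring R" and fin: "module.len R (self_module R) (carrier R) \<noteq> \<infinity>"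
  shows "module.len R (free_module R n) (carrier (free_module R n)) \<noteq> \<infinity>"
proof -
  interpret S: module R "self_module R" by (rule module_self_module[OF R])
  have "module.len R (free_module R n) (carrier (free_module R n)) = (\<Sum>i<n. S.len (carrier R))"
    unfolding free_module_def finite_direct_sum_simps
    using len_PiE[OF R, of n "\<lambda>_. self_module R" "\<lambda>_. carrier R"]
      S.module_axioms S.carrier_is_submodule by simp
  then show ?thesis using fin by (auto simp: of_nat_eq_enat)
qed

lemma free_resolution_exists:
  assumes N: "module R N" and finR: "module.len R (self_module R) (carrier R) \<noteq> \<infinity>"
    and finN: "module.len R N (carrier N) \<noteq> \<infinity>"
  shows "\<exists>b \<epsilon> d. free_resolution R N b \<epsilon> d"
proof -
  interpret N: module R N by fact
  note F = module_free_module[OF N.R.is_cring]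
  note finF = free_module_finite_length[OF N.R.is_cring finR]
  obtain b0 \<epsilon> where \<epsilon>: "\<epsilon> \<in> rmod_hom R (free_module R b0) N"
    "\<epsilon> ` carrier (free_module R b0) = carrier N"
    using finite_length_cover[OF N finN N.carrier_is_submodule] by blast
  \<comment> \<open>A state (b, c, d) is one differential from R^c to R^b. P carries the condition
    at the augmentation for n = 0, and Q demands exactness between neighbours.\<close>
  define P where "P n s \<longleftrightarrow> (case s of (b, c, d) \<Rightarrow>
      d \<in> rmod_hom R (free_module R c) (free_module R b) \<and>
      (n = 0 \<longrightarrow> b = b0 \<and> d ` carrier (free_module R c) = rmod_kernel (free_module R b) N \<epsilon>))" for n :: nat and s
  define Q where "Q s s' \<longleftrightarrow> (case (s, s') of ((b, c, d), (b', c', d')) \<Rightarrow>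
      b' = c \<and> d' ` carrier (free_module R c') = rmod_kernel (free_module R c) (free_module R b) d)" for s s'
  have "\<exists>f. \<forall>n. P n (f n) \<and> Q (f n) (f (Suc n))"
  proof (rule dependent_nat_choice)
    show "\<exists>s. P 0 s"
      using finite_length_cover[OF F finF submodule_kernel[OF F N \<epsilon>(1)]] by (auto simp: P_def)
    fix s n assume "P n s"
    then obtain b c d where s: "s = (b, c, d)" and d: "d \<in> rmod_hom R (free_module R c) (free_module R b)"
      by (cases s) (auto simp: P_def)
    from finite_length_cover[OF F finF submodule_kernel[OF F F d]]
    obtain c' d' where "d' \<in> rmod_hom R (free_module R c') (free_module R c)"
      "d' ` carrier (free_module R c') = rmod_kernel (free_module R c) (free_module R b) d" by blast
    then have "P (Suc n) (c, c', d') \<and> Q s (c, c', d')" by (simp add: P_def Q_def s)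
    then show "\<exists>s'. P (Suc n) s' \<and> Q s s'" by blast
  qed
  then obtain f where f: "\<And>n. P n (f n)" "\<And>n. Q (f n) (f (Suc n))" by blast
  define b where "b n = fst (f n)" for n
  define d where "d n = snd (snd (f n))" for n
  have f_eq: "f n = (b n, b (Suc n), d n)" for n
    using f(2)[of n] by (auto simp: b_def d_def Q_def split: prod.splits)
  have "free_resolution R N b \<epsilon> d"
    unfolding free_resolution_def
  proof (intro conjI allI)
    have b0: "b 0 = b0" using f(1)[of 0] by (simp add: f_eq P_def)
    show "\<epsilon> \<in> rmod_hom R (free_module R (b 0)) N" "\<epsilon> ` carrier (free_module R (b 0)) = carrier N"
      using \<epsilon> unfolding b0 by blast+
    show "d i \<in> rmod_hom R (free_module R (b (Suc i))) (free_module R (b i))" for i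
      using f(1)[of i] by (simp add: f_eq P_def)
    show "d 0 ` carrier (free_module R (b 1)) = rmod_kernel (free_module R (b 0)) N \<epsilon>"
      using f(1)[of 0] by (simp add: f_eq P_def)
    show "d (Suc i) ` carrier (free_module R (b (Suc (Suc i)))) =
        rmod_kernel (free_module R (b (Suc i))) (free_module R (b i)) (d i)" for i
      using f(2)[of i] by (simp add: f_eq Q_def)
  qed
  then show ?thesis by blast
qed

text \<open>The resolution is selected by \<open>SOME\<close> from N alone, so a single choice
  serves every degree i.\<close>

lemma ext_module_resolution:
  assumes "\<exists>b \<epsilon> d. free_resolution R N b \<epsilon> d"
  obtains b \<epsilon> d where "free_resolution R N b \<epsilon> d"
    "\<And>(M :: ('a, 'c) module) i. ext_module R N M i = hom_cohomology R b d M i"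
proof -
  define t where "t = (SOME (b, \<epsilon>, d). free_resolution R N b \<epsilon> d)"
  obtain b \<epsilon> d where t: "t = (b, \<epsilon>, d)" by (cases t)
  have "case t of (b, \<epsilon>, d) \<Rightarrow> free_resolution R N b \<epsilon> d"
    unfolding t_def by (rule someI_ex) (use assms in auto)
  then show ?thesis
    by (intro that[of b \<epsilon> d]) (simp_all add: t ext_module_def t_def[symmetric])
qed

text \<open>In a zero quotient the coset of f is the set of coboundaries, and f lies in its own
  coset because zero is a coboundary.\<close>

lemma hom_cohomology_zeroD:
  assumes R: "cring R" and M: "module R M"
    and zero: "is_zero_module (hom_cohomology R b d M (Suc i))"
    and f: "f \<in> rmod_hom R (free_module R (b (Suc i))) M"
    and cocycle: "\<And>x. x \<in> carrier (free_module R (b (Suc (Suc i)))) \<Longrightarrow> f (d (Suc i) x) = \<zero>\<^bsub>M\<^esub>"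
    and d: "\<And>i. d i \<in> rmod_hom R (free_module R (b (Suc i))) (free_module R (b i))"
  shows "\<exists>g\<in>rmod_hom R (free_module R (b i)) M. \<forall>x\<in>carrier (free_module R (b (Suc i))). f x = g (d i x)"
proof -
  interpret M: module R M by fact
  let ?F = "\<lambda>i. free_module R (b i)"
  interpret F: module R "?F (Suc i)" by (rule module_free_module[OF R])
  let ?H = "\<lambda>i. hom_module R (?F i) M"
  \<comment> \<open>Elements of \<open>hom_module\<close> are extensional, so f must be cut down to
    its domain before it can count as a cochain.\<close>
  define f' where "f' = restrict f (carrier (?F (Suc i)))"
  have f'c: "f' \<in> carrier (?H (Suc i))"
    unfolding f'_def hom_module_def using f
    by (auto simp: rmod_hom_def F.M.add.m_closed simp del: free_module_simps)
  have "hom_coboundary R b d (Suc i) f' = \<zero>\<^bsub>?H (Suc (Suc i))\<^esub>"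
    unfolding hom_coboundary_def hom_module_def f'_def
    using cocycle rmod_homD(1)[OF d] by (auto intro!: restrict_ext simp del: free_module_simps)
  then have f': "f' \<in> hom_cocycles R b d M (Suc i)"
    using f'c by (simp add: hom_cocycles_def rmod_kernel_def)
  define B where "B = hom_coboundaries R b d M (Suc i)"
  let ?Z = "(?H (Suc i))\<lparr>carrier := hom_cocycles R b d M (Suc i)\<rparr>"
  have "(\<lambda>x\<in>carrier (?F (Suc i)). \<zero>\<^bsub>M\<^esub>) \<in> B"
    unfolding B_def hom_coboundaries_def nat.case
  proof (rule image_eqI)
    show "(\<lambda>x\<in>carrier (?F i). \<zero>\<^bsub>M\<^esub>) \<in> carrier (?H i)"
      using module.smult_closed[OF module_free_module[OF R]]
        abelian_groupE(1)[OF module.axioms(2)[OF module_free_module[OF R]]]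
      by (auto simp: hom_module_def rmod_hom_def simp del: free_module_simps)
    show "(\<lambda>x\<in>carrier (?F (Suc i)). \<zero>\<^bsub>M\<^esub>) =
        hom_coboundary R b d i (\<lambda>x\<in>carrier (?F i). \<zero>\<^bsub>M\<^esub>)"
      unfolding hom_coboundary_def
      using rmod_homD(1)[OF d] by (auto intro!: restrict_ext simp del: free_module_simps)
  qed
  then have "(\<lambda>x\<in>carrier (?F (Suc i)). \<zero>\<^bsub>M\<^esub>) \<oplus>\<^bsub>?Z\<^esub> f' \<in> B +>\<^bsub>?Z\<^esub> f'"
    unfolding a_r_coset_def' by blast
  also have "(\<lambda>x\<in>carrier (?F (Suc i)). \<zero>\<^bsub>M\<^esub>) \<oplus>\<^bsub>?Z\<^esub> f' = f'"
    unfolding f'_def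
    using rmod_homD(1)[OF f] by (auto simp: hom_module_def intro!: restrict_ext simp del: free_module_simps)
  also have "B +>\<^bsub>?Z\<^esub> f' = B"
  proof -
    have "B +>\<^bsub>?Z\<^esub> f' \<in> carrier (hom_cohomology R b d M (Suc i))"
      using f' unfolding hom_cohomology_def quotient_module_def B_def
      by (auto simp: A_RCOSETS_def')
    then show ?thesis using zero unfolding is_zero_module_def
      by (simp add: hom_cohomology_def quotient_module_def B_def)
  qed
  finally have "f' \<in> hom_coboundary R b d i ` carrier (?H i)"
    by (simp add: B_def hom_coboundaries_def)
  then obtain g where g: "g \<in> carrier (?H i)" "f' = hom_coboundary R b d i g" by blast
  show ?thesis
  proof (rule bexI[of _ g])
    show "g \<in> rmod_hom R (?F i) M" using g(1) by (simp add: hom_module_def)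
    show "\<forall>x\<in>carrier (?F (Suc i)). f x = g (d i x)"
    proof
      fix x assume x: "x \<in> carrier (?F (Suc i))"
      have "f' x = hom_coboundary R b d i g x" using g(2) by simp
      then show "f x = g (d i x)" using x
        by (simp add: f'_def hom_coboundary_def del: free_module_simps)
    qed
  qed
qed

section \<open>Injective direct sums and the balancing of Ext\<close>

lemma injective_finite_direct_sum:
  assumes R: "cring R" and Y: "\<And>i. i \<in> I \<Longrightarrow> injective_module R (Y i)"
  shows "injective_module R (finite_direct_sum I Y)"
proof -
  have Ym: "module R (Y i)" if "i \<in> I" for i
    using Y[OF that] by (simp add: injective_module_def)
  have *: "\<exists>h\<in>rmod_hom R B (finite_direct_sum I Y). \<forall>x\<in>carrier A. h (f x) = g x"
    if A: "module R A" and B: "module R B" and f: "f \<in> rmod_hom R A B" "inj_on f (carrier A)"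
      and g: "g \<in> rmod_hom R A (finite_direct_sum I Y)"
    for A :: "('a, 'a module_universe) module" and B :: "('a, 'a module_universe) module" and f g
  proof -
    have "(\<lambda>x. g x i) \<in> rmod_hom R A (Y i)" if i: "i \<in> I" for i
      using rmod_homD[OF g] i by (intro rmod_homI) (auto simp: PiE_iff)
    then have "\<exists>h\<in>rmod_hom R B (Y i). \<forall>x\<in>carrier A. h (f x) = g x i" if "i \<in> I" for i
      using Y[OF that] A B f that unfolding injective_module_def by blast
    then obtain h where h: "\<And>i. i \<in> I \<Longrightarrow> h i \<in> rmod_hom R B (Y i)"
      "\<And>i x. i \<in> I \<Longrightarrow> x \<in> carrier A \<Longrightarrow> h i (f x) = g x i" by metis
    show ?thesis
    proof (intro bexI ballI)
      show "(\<lambda>x. \<lambda>i\<in>I. h i x) \<in> rmod_hom R B (finite_direct_sum I Y)"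
        using rmod_homD[OF h(1)] by (intro rmod_homI) (auto intro!: restrict_ext)
      fix x assume x: "x \<in> carrier A"
      show "(\<lambda>i\<in>I. h i (f x)) = g x"
        using rmod_homD(1)[OF g x] h(2)[OF _ x]
        by (intro extensionalityI[of _ I]) (auto simp: PiE_def)
    qed
  qed
  show ?thesis unfolding injective_module_def
  proof (intro conjI allI impI)
    show "module R (finite_direct_sum I Y)" by (rule module_finite_direct_sum[OF R Ym])
  qed (elim conjE, rule *)
qed

text \<open>
  Dimension shifting along the double complex \<open>Hom(F p, I q)\<close>: vanishing of cohomology moves
  from position \<open>(p + 1, q)\<close> to \<open>(p, q + 1)\<close>.
\<close>

locale ext_double_complex =
  fixes R :: "('a, 'r) ring_scheme" and N :: "('a, 'b) module" and M :: "('a, 'c) module"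
    and b :: "nat \<Rightarrow> nat" and \<epsilon> :: "(nat \<Rightarrow> 'a) \<Rightarrow> 'b" and d :: "nat \<Rightarrow> (nat \<Rightarrow> 'a) \<Rightarrow> (nat \<Rightarrow> 'a)"
    and I :: "nat \<Rightarrow> ('a, 'i) module" and \<phi> :: "'c \<Rightarrow> 'i" and \<delta> :: "nat \<Rightarrow> 'i \<Rightarrow> 'i"
  assumes N: "module R N" and M: "module R M"
    and res: "free_resolution R N b \<epsilon> d"
    and inj: "\<And>q. injective_module R (I q)"
    and \<phi>: "\<phi> \<in> rmod_hom R M (I 0)" "inj_on \<phi> (carrier M)"
    and \<delta>: "\<And>q. \<delta> q \<in> rmod_hom R (I q) (I (Suc q))"
    and exact0: "rmod_kernel (I 0) (I 1) (\<delta> 0) = \<phi> ` carrier M"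
    and exact: "\<And>q. rmod_kernel (I (Suc q)) (I (Suc (Suc q))) (\<delta> (Suc q)) = \<delta> q ` carrier (I q)"
begin

lemma R: "cring R" using N by (simp add: module_def)

lemma I: "module R (I q)" using inj by (simp add: injective_module_def)

abbreviation F where "F p \<equiv> free_module R (b p)"

lemma F: "module R (F p)" by (rule module_free_module[OF R])

lemma d: "d i \<in> rmod_hom R (F (Suc i)) (F i)"
  and \<epsilon>: "\<epsilon> \<in> rmod_hom R (F 0) N" "\<epsilon> ` carrier (F 0) = carrier N"
  and d0: "d 0 ` carrier (F 1) = rmod_kernel (F 0) N \<epsilon>"
  and dSuc: "d (Suc i) ` carrier (F (Suc (Suc i))) = rmod_kernel (F (Suc i)) (F i) (d i)"
  using res unfolding free_resolution_def by blast+

lemma dd: "x \<in> carrier (F (Suc (Suc i))) \<Longrightarrow> d i (d (Suc i) x) = \<zero>\<^bsub>F i\<^esub>"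
  using dSuc[of i] unfolding rmod_kernel_def by blast

lemma \<epsilon>d: "x \<in> carrier (F (Suc 0)) \<Longrightarrow> \<epsilon> (d 0 x) = \<zero>\<^bsub>N\<^esub>"
  using d0 unfolding rmod_kernel_def One_nat_def by blast

definition vanishes :: "nat \<Rightarrow> nat \<Rightarrow> bool" where
  "vanishes p q \<longleftrightarrow> (\<forall>f\<in>rmod_hom R (F (Suc p)) (I q).
     (\<forall>x\<in>carrier (F (Suc p)). \<delta> q (f x) = \<zero>\<^bsub>I (Suc q)\<^esub>) \<longrightarrow>
     (\<forall>x\<in>carrier (F (Suc (Suc p))). f (d (Suc p) x) = \<zero>\<^bsub>I q\<^esub>) \<longrightarrow>
     (\<exists>g\<in>rmod_hom R (F p) (I q). (\<forall>x\<in>carrier (F p). \<delta> q (g x) = \<zero>\<^bsub>I (Suc q)\<^esub>) \<and>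
        (\<forall>x\<in>carrier (F (Suc p)). f x = g (d p x))))"

lemma vanishesE:
  assumes "vanishes p q" "f \<in> rmod_hom R (F (Suc p)) (I q)"
    and "\<And>x. x \<in> carrier (F (Suc p)) \<Longrightarrow> \<delta> q (f x) = \<zero>\<^bsub>I (Suc q)\<^esub>"
    and "\<And>x. x \<in> carrier (F (Suc (Suc p))) \<Longrightarrow> f (d (Suc p) x) = \<zero>\<^bsub>I q\<^esub>"
  obtains g where "g \<in> rmod_hom R (F p) (I q)"
    "\<And>x. x \<in> carrier (F p) \<Longrightarrow> \<delta> q (g x) = \<zero>\<^bsub>I (Suc q)\<^esub>"
    "\<And>x. x \<in> carrier (F (Suc p)) \<Longrightarrow> f x = g (d p x)"
  using assms unfolding vanishes_def by blast

text \<open>Z 0 is the copy of M in I 0, so maps into it are pulled back along \<phi>, where the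
  vanishing of Ext(N, M) applies.\<close>

lemma vanishes_0:
  assumes zero: "is_zero_module (hom_cohomology R b d M (Suc p))"
  shows "vanishes p 0"
  unfolding vanishes_def
proof (intro ballI impI)
  fix f assume f: "f \<in> rmod_hom R (F (Suc p)) (I 0)"
    and cyc: "\<forall>x\<in>carrier (F (Suc p)). \<delta> 0 (f x) = \<zero>\<^bsub>I (Suc 0)\<^esub>"
    and coc: "\<forall>x\<in>carrier (F (Suc (Suc p))). f (d (Suc p) x) = \<zero>\<^bsub>I 0\<^esub>"
  have "f v \<in> \<phi> ` carrier M" if "v \<in> carrier (F (Suc p))" for v
    using cyc that rmod_homD(1)[OF f that] exact0 unfolding rmod_kernel_def by auto
  from free_lift[OF I M \<phi>(1) f this] obtain u where u: "u \<in> rmod_hom R (F (Suc p)) M"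
    "\<And>v. v \<in> carrier (F (Suc p)) \<Longrightarrow> \<phi> (u v) = f v" by blast
  have "u (d (Suc p) x) = \<zero>\<^bsub>M\<^esub>" if x: "x \<in> carrier (F (Suc (Suc p)))" for x
  proof -
    have dx: "d (Suc p) x \<in> carrier (F (Suc p))" by (rule rmod_homD(1)[OF d x])
    have "\<phi> (u (d (Suc p) x)) = \<phi> \<zero>\<^bsub>M\<^esub>"
      using u(2)[OF dx] coc x rmod_hom_zero[OF M I \<phi>(1)] by simp
    then show ?thesis
      using inj_onD[OF \<phi>(2) _ rmod_homD(1)[OF u(1) dx]]
        abelian_groupE(2)[OF module.axioms(2)[OF M]] by blast
  qed
  from hom_cohomology_zeroD[OF R M zero u(1) this d]
  obtain g where g: "g \<in> rmod_hom R (F p) M" "\<And>x. x \<in> carrier (F (Suc p)) \<Longrightarrow> u x = g (d p x)"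
    by blast
  show "\<exists>g\<in>rmod_hom R (F p) (I 0). (\<forall>x\<in>carrier (F p). \<delta> 0 (g x) = \<zero>\<^bsub>I (Suc 0)\<^esub>) \<and>
      (\<forall>x\<in>carrier (F (Suc p)). f x = g (d p x))"
  proof (intro bexI conjI ballI)
    show "(\<lambda>x. \<phi> (g x)) \<in> rmod_hom R (F p) (I 0)" by (rule rmod_hom_comp[OF g(1) \<phi>(1)])
    show "\<delta> 0 (\<phi> (g x)) = \<zero>\<^bsub>I (Suc 0)\<^esub>" if "x \<in> carrier (F p)" for x
      using rmod_homD(1)[OF g(1) that] exact0 unfolding rmod_kernel_def by auto
    show "f x = \<phi> (g (d p x))" if "x \<in> carrier (F (Suc p))" for x
      using u(2)[OF that] g(2)[OF that] by simp
  qed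
qed

lemma lift_through_\<delta>:
  assumes f: "f \<in> rmod_hom R (F p) (I (Suc q))"
    and cyc: "\<And>x. x \<in> carrier (F p) \<Longrightarrow> \<delta> (Suc q) (f x) = \<zero>\<^bsub>I (Suc (Suc q))\<^esub>"
  obtains u where "u \<in> rmod_hom R (F p) (I q)" "\<And>x. x \<in> carrier (F p) \<Longrightarrow> \<delta> q (u x) = f x"
proof -
  have "f v \<in> \<delta> q ` carrier (I q)" if "v \<in> carrier (F p)" for v
    using cyc that rmod_homD(1)[OF f that] exact[of q, symmetric] unfolding rmod_kernel_def by auto
  from free_lift[OF I I \<delta> f this] show ?thesis using that by blast
qed

text \<open>The connecting map for 0 -> Z q -> I q -> Z (q+1) -> 0, by hand. Lift f to u with values
  in I q. Then u after d is a cocycle in Z q, so it equals g after d. Hence u - g vanishes on the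
  kernel of d p and extends, by injectivity, to w on F p; \<delta> q after w bounds f, since
  \<delta> q kills g.\<close>

lemma vanishes_shift:
  assumes v: "vanishes (Suc p) q"
  shows "vanishes p (Suc q)"
  unfolding vanishes_def
proof (intro ballI impI)
  fix f assume f: "f \<in> rmod_hom R (F (Suc p)) (I (Suc q))"
    and cyc: "\<forall>x\<in>carrier (F (Suc p)). \<delta> (Suc q) (f x) = \<zero>\<^bsub>I (Suc (Suc q))\<^esub>"
    and coc: "\<forall>x\<in>carrier (F (Suc (Suc p))). f (d (Suc p) x) = \<zero>\<^bsub>I (Suc q)\<^esub>"
  interpret Iq: module R "I q" by (rule I)
  interpret Iq1: module R "I (Suc q)" by (rule I)
  obtain u where u: "u \<in> rmod_hom R (F (Suc p)) (I q)"
    "\<And>x. x \<in> carrier (F (Suc p)) \<Longrightarrow> \<delta> q (u x) = f x"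
    using lift_through_\<delta>[OF f] cyc by blast
  have ud: "(\<lambda>x. u (d (Suc p) x)) \<in> rmod_hom R (F (Suc (Suc p))) (I q)"
    by (rule rmod_hom_comp[OF d u(1)])
  have "\<delta> q (u (d (Suc p) x)) = \<zero>\<^bsub>I (Suc q)\<^esub>" if "x \<in> carrier (F (Suc (Suc p)))" for x
    using u(2)[OF rmod_homD(1)[OF d that]] coc that by simp
  moreover have *: "u (d (Suc p) (d (Suc (Suc p)) x)) = \<zero>\<^bsub>I q\<^esub>"
    if "x \<in> carrier (F (Suc (Suc (Suc p))))" for x
    using dd[OF that] rmod_hom_zero[OF F I u(1)] by simp
  ultimately obtain g where g: "g \<in> rmod_hom R (F (Suc p)) (I q)"
    "\<And>x. x \<in> carrier (F (Suc p)) \<Longrightarrow> \<delta> q (g x) = \<zero>\<^bsub>I (Suc q)\<^esub>"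
    "\<And>x. x \<in> carrier (F (Suc (Suc p))) \<Longrightarrow> u (d (Suc p) x) = g (d (Suc p) x)"
    using vanishesE[OF v ud] by blast
  have ug: "(\<lambda>x. u x \<ominus>\<^bsub>I q\<^esub> g x) \<in> rmod_hom R (F (Suc p)) (I q)"
    by (rule rmod_hom_diff[OF F I u(1) g(1)])
  have "u x \<ominus>\<^bsub>I q\<^esub> g x = \<zero>\<^bsub>I q\<^esub>" if "x \<in> carrier (F (Suc p))" "d p x = \<zero>\<^bsub>F p\<^esub>" for x
  proof -
    have "x \<in> d (Suc p) ` carrier (F (Suc (Suc p)))"
      unfolding dSuc rmod_kernel_def using that by blast
    then obtain y where y: "y \<in> carrier (F (Suc (Suc p)))" "x = d (Suc p) y" by blast
    then show ?thesis
      using g(3)[OF y(1)] rmod_homD(1)[OF u(1) that(1)] rmod_homD(1)[OF g(1) that(1)]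
      by (simp add: Iq.M.minus_eq_zero_iff)
  qed
  then obtain w where w: "w \<in> rmod_hom R (F p) (I q)"
    "\<And>x. x \<in> carrier (F (Suc p)) \<Longrightarrow> w (d p x) = u x \<ominus>\<^bsub>I q\<^esub> g x"
    using injective_extend_factor[OF F F inj d ug] by blast
  show "\<exists>g\<in>rmod_hom R (F p) (I (Suc q)). (\<forall>x\<in>carrier (F p). \<delta> (Suc q) (g x) = \<zero>\<^bsub>I (Suc (Suc q))\<^esub>) \<and>
      (\<forall>x\<in>carrier (F (Suc p)). f x = g (d p x))"
  proof (intro bexI conjI ballI)
    show "(\<lambda>x. \<delta> q (w x)) \<in> rmod_hom R (F p) (I (Suc q))" by (rule rmod_hom_comp[OF w(1) \<delta>])
    show "\<delta> (Suc q) (\<delta> q (w x)) = \<zero>\<^bsub>I (Suc (Suc q))\<^esub>" if "x \<in> carrier (F p)" for x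
      using rmod_homD(1)[OF w(1) that] exact[of q] unfolding rmod_kernel_def by blast
    show "f x = \<delta> q (w (d p x))" if x: "x \<in> carrier (F (Suc p))" for x
      using w(2)[OF x] rmod_hom_minus[OF I I \<delta> rmod_homD(1)[OF u(1) x] rmod_homD(1)[OF g(1) x]]
        u(2)[OF x] g(2)[OF x] rmod_homD(1)[OF f x] by (simp add: a_minus_def)
  qed
qed

text \<open>Shifting turns Ext^(i+1)(N, M) = 0 into Ext^1(N, Z i) = 0. The same chase is then made
  once more with \<epsilon> in place of a differential: u - g vanishes on the kernel of \<epsilon>
  and descends to N.\<close>

lemma hom_exact:
  assumes zero: "is_zero_module (hom_cohomology R b d M (Suc i))"
    and f: "f \<in> rmod_hom R N (I (Suc i))"
    and cyc: "\<And>x. x \<in> carrier N \<Longrightarrow> \<delta> (Suc i) (f x) = \<zero>\<^bsub>I (Suc (Suc i))\<^esub>"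
  shows "\<exists>w\<in>rmod_hom R N (I i). \<forall>x\<in>carrier N. f x = \<delta> i (w x)"
proof -
  \<comment> \<open>The positions (i - k, k) run along the antidiagonal from the Ext side to the
    injective side.\<close>
  have "vanishes (i - k) k" if "k \<le> i" for k
    using that
  proof (induction k)
    case (Suc k)
    then have "vanishes (Suc (i - Suc k)) k" using Suc by (simp add: Suc_diff_Suc)
    then show ?case by (rule vanishes_shift)
  qed (use vanishes_0[OF zero] in simp)
  from this[of i] have v: "vanishes 0 i" by simp
  interpret Ii: module R "I i" by (rule I)
  interpret Ii1: module R "I (Suc i)" by (rule I)
  have f\<epsilon>: "(\<lambda>x. f (\<epsilon> x)) \<in> rmod_hom R (F 0) (I (Suc i))" by (rule rmod_hom_comp[OF \<epsilon>(1) f])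
  obtain u where u: "u \<in> rmod_hom R (F 0) (I i)"
    "\<And>x. x \<in> carrier (F 0) \<Longrightarrow> \<delta> i (u x) = f (\<epsilon> x)"
    using lift_through_\<delta>[OF f\<epsilon>] cyc rmod_homD(1)[OF \<epsilon>(1)] by blast
  have ud: "(\<lambda>x. u (d 0 x)) \<in> rmod_hom R (F (Suc 0)) (I i)"
    by (rule rmod_hom_comp[OF d u(1)])
  have "\<delta> i (u (d 0 x)) = \<zero>\<^bsub>I (Suc i)\<^esub>" if "x \<in> carrier (F (Suc 0))" for x
    using u(2)[OF rmod_homD(1)[OF d that]] \<epsilon>d[OF that] rmod_hom_zero[OF N I f] by simp
  moreover have *: "u (d 0 (d (Suc 0) x)) = \<zero>\<^bsub>I i\<^esub>" if "x \<in> carrier (F (Suc (Suc 0)))" for x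
    using dd[OF that] rmod_hom_zero[OF F I u(1)] by simp
  ultimately obtain g where g: "g \<in> rmod_hom R (F 0) (I i)"
    "\<And>x. x \<in> carrier (F 0) \<Longrightarrow> \<delta> i (g x) = \<zero>\<^bsub>I (Suc i)\<^esub>"
    "\<And>x. x \<in> carrier (F (Suc 0)) \<Longrightarrow> u (d 0 x) = g (d 0 x)"
    using vanishesE[OF v ud] by blast
  have ug: "(\<lambda>x. u x \<ominus>\<^bsub>I i\<^esub> g x) \<in> rmod_hom R (F 0) (I i)"
    by (rule rmod_hom_diff[OF F I u(1) g(1)])
  have "u x \<ominus>\<^bsub>I i\<^esub> g x = \<zero>\<^bsub>I i\<^esub>" if "x \<in> carrier (F 0)" "\<epsilon> x = \<zero>\<^bsub>N\<^esub>" for x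
  proof -
    have "x \<in> d 0 ` carrier (F (Suc 0))"
      unfolding d0[unfolded One_nat_def] rmod_kernel_def using that by blast
    then obtain y where y: "y \<in> carrier (F (Suc 0))" "x = d 0 y" by blast
    then show ?thesis
      using g(3)[OF y(1)] rmod_homD(1)[OF u(1) that(1)] rmod_homD(1)[OF g(1) that(1)]
      by (simp add: Ii.M.minus_eq_zero_iff)
  qed
  then obtain w where w: "w \<in> rmod_hom R (N\<lparr>carrier := \<epsilon> ` carrier (F 0)\<rparr>) (I i)"
    "\<And>x. x \<in> carrier (F 0) \<Longrightarrow> w (\<epsilon> x) = u x \<ominus>\<^bsub>I i\<^esub> g x"
    using rmod_hom_factor[OF F N I \<epsilon>(1) ug] by blast
  have "w \<in> rmod_hom R N (I i)" using w(1) \<epsilon>(2) by simp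
  moreover have "f y = \<delta> i (w y)" if "y \<in> carrier N" for y
  proof -
    have "y \<in> \<epsilon> ` carrier (F 0)" unfolding \<epsilon>(2) by (rule that)
    then obtain x where x: "x \<in> carrier (F 0)" "y = \<epsilon> x" by blast
    show ?thesis
      using w(2)[OF x(1)] rmod_hom_minus[OF I I \<delta> rmod_homD(1)[OF u(1) x(1)] rmod_homD(1)[OF g(1) x(1)]]
        u(2)[OF x(1)] g(2)[OF x(1)] rmod_homD(1)[OF f that] x(2) by (simp add: a_minus_def)
  qed
  ultimately show ?thesis by blast
qed

end

section \<open>Matlis duality over a local ring with \<open>m\<^sup>3 = 0\<close>\<close>

lemma (in abelian_group) cross_diff:
  assumes c: "a \<in> carrier G" "b \<in> carrier G" "x \<in> carrier G" "y \<in> carrier G"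
    and eq: "a \<oplus> x = b \<oplus> y"
  shows "x \<ominus> y = b \<ominus> a"
proof -
  have "x = \<ominus> a \<oplus> (b \<oplus> y)" unfolding eq[symmetric] using c by (simp add: r_neg1)
  then have "x \<ominus> y = \<ominus> a \<oplus> (b \<oplus> y) \<oplus> \<ominus> y" by (simp add: a_minus_def)
  also have "\<dots> = b \<ominus> a" using c by (simp add: a_minus_def a_assoc r_neg) (simp add: a_comm)
  finally show ?thesis .
qed

lemma (in module) smult_swap:
  "r \<in> carrier R \<Longrightarrow> s \<in> carrier R \<Longrightarrow> x \<in> carrier M \<Longrightarrow> r \<odot>\<^bsub>M\<^esub> (s \<odot>\<^bsub>M\<^esub> x) = s \<odot>\<^bsub>M\<^esub> (r \<odot>\<^bsub>M\<^esub> x)"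
  by (simp add: smult_assoc1[symmetric] R.m_comm)

text \<open>Locality appears as invertibility outside m. Ideals are treated as submodules of
  \<open>self_module R\<close>, which makes the length calculus apply to them directly.\<close>

locale cube_zero_ring = R?: cring R for R (structure) +
  fixes m :: "'a set"
  assumes m_ideal: "submodule m R (self_module R)"
    and one_notin: "\<one> \<notin> m"
    and unit: "\<And>r. r \<in> carrier R \<Longrightarrow> r \<notin> m \<Longrightarrow> \<exists>s\<in>carrier R. s \<otimes> r = \<one>"
    and cube: "\<And>a b c. a \<in> m \<Longrightarrow> b \<in> m \<Longrightarrow> c \<in> m \<Longrightarrow> a \<otimes> b \<otimes> c = \<zero>"
begin

sublocale S: module R "self_module R" by (rule module_self_module) (rule R.is_cring)

lemma m_carrier: "c \<in> m \<Longrightarrow> c \<in> carrier R"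
  using S.submodule_in_carrier[OF m_ideal] by simp

lemma ideal_carrier: "submodule J R (self_module R) \<Longrightarrow> x \<in> J \<Longrightarrow> x \<in> carrier R"
  using S.submodule_in_carrier by simp

lemma m_mult: "r \<in> carrier R \<Longrightarrow> c \<in> m \<Longrightarrow> r \<otimes> c \<in> m"
  using S.submoduleD(4)[OF m_ideal] by simp

lemma unit_cancel:
  assumes A: "module R A" and r: "r \<in> carrier R" "r \<notin> m" and x: "x \<in> carrier A"
  obtains s where "s \<in> carrier R" "s \<odot>\<^bsub>A\<^esub> (r \<odot>\<^bsub>A\<^esub> x) = x"
proof -
  interpret A: module R A by fact
  obtain s where s: "s \<in> carrier R" "s \<otimes> r = \<one>" using unit r by blast
  then have "s \<odot>\<^bsub>A\<^esub> (r \<odot>\<^bsub>A\<^esub> x) = x"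
    using r x by (simp add: A.smult_assoc1[symmetric])
  then show ?thesis using that s(1) by blast
qed

text \<open>N/D is nonzero and killed by m^3, so it has a nonzero socle: if each element outside D
  could be multiplied by m to stay outside D, three multiplications would give zero outside
  D.\<close>

lemma relative_socle_exists:
  assumes A: "module R A" and D: "submodule D R A" and N: "submodule N R A" and DN: "D \<subset> N"
  shows "\<exists>x\<in>N. x \<notin> D \<and> (\<forall>c\<in>m. c \<odot>\<^bsub>A\<^esub> x \<in> D)"
proof (rule ccontr)
  interpret A: module R A by fact
  assume no: "\<not> ?thesis"
  then have *: "\<exists>c\<in>m. c \<odot>\<^bsub>A\<^esub> x \<notin> D" if "x \<in> N" "x \<notin> D" for x using that by blast
  obtain x where x: "x \<in> N" "x \<notin> D" using DN by blast
  have xc: "x \<in> carrier A" by (rule A.submodule_in_carrier[OF N x(1)])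
  obtain c where c: "c \<in> m" "c \<odot>\<^bsub>A\<^esub> x \<notin> D" using *[OF x] by blast
  then have cN: "c \<odot>\<^bsub>A\<^esub> x \<in> N" using A.submoduleD(4)[OF N m_carrier x(1)] by blast
  obtain e where e: "e \<in> m" "e \<odot>\<^bsub>A\<^esub> (c \<odot>\<^bsub>A\<^esub> x) \<notin> D" using *[OF cN c(2)] by blast
  then have eN: "e \<odot>\<^bsub>A\<^esub> (c \<odot>\<^bsub>A\<^esub> x) \<in> N" using A.submoduleD(4)[OF N m_carrier cN] by blast
  obtain f where f: "f \<in> m" "f \<odot>\<^bsub>A\<^esub> (e \<odot>\<^bsub>A\<^esub> (c \<odot>\<^bsub>A\<^esub> x)) \<notin> D" using *[OF eN e(2)] by blast
  have "f \<odot>\<^bsub>A\<^esub> (e \<odot>\<^bsub>A\<^esub> (c \<odot>\<^bsub>A\<^esub> x)) = (f \<otimes> e \<otimes> c) \<odot>\<^bsub>A\<^esub> x"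
    using m_carrier[OF f(1)] m_carrier[OF e(1)] m_carrier[OF c(1)] xc by (simp add: A.smult_assoc1)
  also have "\<dots> = \<zero>\<^bsub>A\<^esub>" using cube[OF f(1) e(1) c(1)] xc by simp
  finally show False using f(2) A.submodule_zero[OF D] by simp
qed

definition soc :: "'a set" where
  "soc = {y \<in> carrier R. \<forall>c\<in>m. c \<otimes> y = \<zero>}"

lemma soc_carrier: "y \<in> soc \<Longrightarrow> y \<in> carrier R" and soc_mult: "y \<in> soc \<Longrightarrow> c \<in> m \<Longrightarrow> c \<otimes> y = \<zero>"
  by (auto simp: soc_def)

lemma submodule_soc: "submodule soc R (self_module R)"
proof (rule S.submoduleI_smult)
  fix a x assume "a \<in> carrier R" "x \<in> soc"
  moreover from this have "c \<otimes> (a \<otimes> x) = \<zero>" if "c \<in> m" for c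
    using that m_carrier[OF that] by (simp add: soc_def m_lcomm)
  ultimately show "a \<odot>\<^bsub>self_module R\<^esub> x \<in> soc" by (simp add: soc_def)
qed (auto simp: soc_def r_distr m_carrier)

text \<open>A socle element outside m is a unit and would generate the socle. This excludes in
  particular that R is a field.\<close>

lemma soc_le_m:
  assumes not_cyclic: "\<And>y. y \<in> soc \<Longrightarrow> \<not> soc \<subseteq> S.cyc y"
  shows "soc \<subseteq> m"
proof (rule ccontr)
  assume "\<not> soc \<subseteq> m"
  then obtain y where y: "y \<in> soc" "y \<notin> m" by blast
  obtain t where t: "t \<in> carrier R" "t \<otimes> y = \<one>" using unit[OF soc_carrier[OF y(1)] y(2)] by blast
  have "z \<in> S.cyc y" if z: "z \<in> soc" for z
  proof -
    have "z = (z \<otimes> t) \<otimes> y"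
      using t soc_carrier[OF y(1)] soc_carrier[OF z] by (simp add: m_assoc)
    then show ?thesis unfolding S.cyc_def using soc_carrier[OF z] t(1) by auto
  qed
  then show False using not_cyclic[OF y(1)] by blast
qed

lemma ideal_meets_soc:
  assumes J: "submodule J R (self_module R)" and y: "y \<in> J" "y \<noteq> \<zero>"
  obtains z where "z \<in> J" "z \<in> soc" "z \<noteq> \<zero>"
proof -
  have z: "submodule {\<zero>} R (self_module R)" using S.submodule_zero_module by simp
  have "{\<zero>} \<subset> J" using S.submodule_zero[OF J] y by auto
  from relative_socle_exists[OF S.module_axioms z J this]
  obtain x where "x \<in> J" "x \<notin> {\<zero>}" "\<And>c. c \<in> m \<Longrightarrow> c \<odot>\<^bsub>self_module R\<^esub> x \<in> {\<zero>}" by blast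
  then show ?thesis using that ideal_carrier[OF J] by (auto simp: soc_def)
qed

text \<open>The square of m as an intersection, so that containment in an ideal is checked on
  products and no finite sums of products occur.\<close>

definition m2 :: "'a set" where
  "m2 = \<Inter>{N. submodule N R (self_module R) \<and> (\<forall>a\<in>m. \<forall>b\<in>m. a \<otimes> b \<in> N)}"

lemma m2_least: "submodule N R (self_module R) \<Longrightarrow> (\<And>a b. a \<in> m \<Longrightarrow> b \<in> m \<Longrightarrow> a \<otimes> b \<in> N) \<Longrightarrow> m2 \<subseteq> N"
  unfolding m2_def by blast

lemma m2_mult: "a \<in> m \<Longrightarrow> b \<in> m \<Longrightarrow> a \<otimes> b \<in> m2"
  unfolding m2_def by blast

lemma m2_le_m: "m2 \<subseteq> m"
  using m_ideal m_mult m_carrier by (intro m2_least) auto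

lemma submodule_m2: "submodule m2 R (self_module R)"
proof (rule S.submoduleI_smult)
  show "m2 \<subseteq> carrier (self_module R)" using m2_le_m m_carrier by auto
  show "\<zero>\<^bsub>self_module R\<^esub> \<in> m2" unfolding m2_def using S.submodule_zero by blast
  show "x \<oplus>\<^bsub>self_module R\<^esub> y \<in> m2" if "x \<in> m2" "y \<in> m2" for x y
    using that S.submoduleD(3) unfolding m2_def by blast
  show "r \<odot>\<^bsub>self_module R\<^esub> x \<in> m2" if "r \<in> carrier R" "x \<in> m2" for r x
    using that S.submoduleD(4) unfolding m2_def by blast
qed

lemma m2_le_soc: "m2 \<subseteq> soc"
proof (rule m2_least[OF submodule_soc])
  fix a b assume ab: "a \<in> m" "b \<in> m"
  have "c \<otimes> (a \<otimes> b) = \<zero>" if "c \<in> m" for c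
    using cube[OF that ab] that ab m_carrier by (simp add: m_assoc)
  then show "a \<otimes> b \<in> soc" using ab m_carrier by (simp add: soc_def)
qed

end

locale cube_zero_local = cube_zero_ring R m for R (structure) and m +
  assumes fin_length: "rel_length R (self_module R) {\<zero>} (carrier R) \<noteq> \<infinity>"
begin

lemma fin_length': "S.len (carrier (self_module R)) \<noteq> \<infinity>"
  using fin_length by simp

lemma fin_length_sub:
  assumes "submodule J R (self_module R)"
  shows "S.len J \<noteq> \<infinity>"
proof -
  have "S.len J \<le> S.len (carrier (self_module R))"
    by (rule S.len_mono[OF assms S.carrier_is_submodule S.submoduleE(1)[OF assms]])
  then show ?thesis using fin_length' enat_ile by fastforce
qed

end

text \<open>The injective hull of k is used through two properties: E is injective, and its socle is
  R x0, a copy of k. Essentiality of k in E is converted into the second one.\<close>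

locale cube_zero_matlis = cube_zero_local R m for R (structure) and m +
  fixes E :: "('a, 'e) module" and x0 :: 'e
  assumes E_inj: "injective_module R E"
    and x0: "x0 \<in> carrier E" "x0 \<noteq> \<zero>\<^bsub>E\<^esub>" "\<And>c. c \<in> m \<Longrightarrow> c \<odot>\<^bsub>E\<^esub> x0 = \<zero>\<^bsub>E\<^esub>"
    and socE: "\<And>x. x \<in> carrier E \<Longrightarrow> (\<And>c. c \<in> m \<Longrightarrow> c \<odot>\<^bsub>E\<^esub> x = \<zero>\<^bsub>E\<^esub>) \<Longrightarrow> x \<in> {r \<odot>\<^bsub>E\<^esub> x0 | r. r \<in> carrier R}"
begin

sublocale E: module R E using E_inj by (simp add: injective_module_def)

lemma socE_unit:
  assumes x: "x \<in> carrier E" "\<And>c. c \<in> m \<Longrightarrow> c \<odot>\<^bsub>E\<^esub> x = \<zero>\<^bsub>E\<^esub>" "x \<noteq> \<zero>\<^bsub>E\<^esub>"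
  obtains s where "s \<in> carrier R" "s \<odot>\<^bsub>E\<^esub> x = x0"
proof -
  obtain r where r: "r \<in> carrier R" "x = r \<odot>\<^bsub>E\<^esub> x0" using socE[OF x(1,2)] by blast
  then have "r \<notin> m" using x(3) x0(3) by blast
  from unit_cancel[OF E.module_axioms r(1) this x0(1)] show ?thesis using that r(2) by blast
qed

text \<open>(D + R z)/D is a copy of k, so z can be sent to x0 and D to zero; injectivity extends
  this map to A. These functionals separate points from submodules, which is what the duality rests
  on.\<close>

lemma socE_functional:
  assumes A: "module R A" and D: "submodule D R A" and z: "z \<in> carrier A" "z \<notin> D"
    and mz: "\<And>c. c \<in> m \<Longrightarrow> c \<odot>\<^bsub>A\<^esub> z \<in> D"
  obtains \<psi> where "\<psi> \<in> rmod_hom R A E" "\<And>x. x \<in> D \<Longrightarrow> \<psi> x = \<zero>\<^bsub>E\<^esub>" "\<psi> z = x0"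
proof -
  interpret A: module R A by fact
  note Dc = A.submodule_in_carrier[OF D]
  define N where "N = A.submodule_sum D (A.cyc z)"
  have N: "submodule N R A" unfolding N_def by (intro A.submodule_sum D A.submodule_cyc z)
  note Nc = A.submodule_in_carrier[OF N]
  have Nmod: "module R (A\<lparr>carrier := N\<rparr>)" using submodule.submodule_is_module[OF N A] .
  define g where "g n = (THE e. \<exists>r\<in>carrier R. \<exists>d\<in>D. n = d \<oplus>\<^bsub>A\<^esub> r \<odot>\<^bsub>A\<^esub> z \<and> e = r \<odot>\<^bsub>E\<^esub> x0)" for n
  have uniq: "r \<odot>\<^bsub>E\<^esub> x0 = r' \<odot>\<^bsub>E\<^esub> x0" if "r \<in> carrier R" "r' \<in> carrier R" "d \<in> D" "d' \<in> D"
    "d \<oplus>\<^bsub>A\<^esub> r \<odot>\<^bsub>A\<^esub> z = d' \<oplus>\<^bsub>A\<^esub> r' \<odot>\<^bsub>A\<^esub> z" for r r' d d'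
  proof -
    note c = that(1,2) Dc[OF that(3)] Dc[OF that(4)] z(1)
    have "(r \<ominus> r') \<odot>\<^bsub>A\<^esub> z = r \<odot>\<^bsub>A\<^esub> z \<ominus>\<^bsub>A\<^esub> r' \<odot>\<^bsub>A\<^esub> z"
      using c by (simp add: a_minus_def A.smult_l_distr A.smult_l_minus)
    also have "\<dots> = d' \<ominus>\<^bsub>A\<^esub> d" using c by (intro A.M.cross_diff that(5)) auto
    finally have D': "(r \<ominus> r') \<odot>\<^bsub>A\<^esub> z \<in> D" using A.submodule_minus[OF D that(4,3)] by simp
    \<comment> \<open>A difference outside m is a unit and would bring z into D. So the ambiguity of
      the coefficient lies in m, which kills x0.\<close>
    have "r \<ominus> r' \<in> m"
    proof (rule ccontr)
      assume "r \<ominus> r' \<notin> m"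
      from unit_cancel[OF A _ this z(1)] obtain s where "s \<in> carrier R"
        "s \<odot>\<^bsub>A\<^esub> ((r \<ominus> r') \<odot>\<^bsub>A\<^esub> z) = z" using c by blast
      then show False using A.submoduleD(4)[OF D _ D'] z(2) by metis
    qed
    then have "(r \<ominus> r') \<odot>\<^bsub>E\<^esub> x0 = \<zero>\<^bsub>E\<^esub>" by (rule x0(3))
    then have "r \<odot>\<^bsub>E\<^esub> x0 \<ominus>\<^bsub>E\<^esub> r' \<odot>\<^bsub>E\<^esub> x0 = \<zero>\<^bsub>E\<^esub>"
      using c x0(1) by (simp add: a_minus_def E.smult_l_distr E.smult_l_minus)
    then show ?thesis using c x0(1) by (simp add: E.M.minus_eq_zero_iff)
  qed
  have g: "g (d \<oplus>\<^bsub>A\<^esub> r \<odot>\<^bsub>A\<^esub> z) = r \<odot>\<^bsub>E\<^esub> x0" if "d \<in> D" "r \<in> carrier R" for d r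
    unfolding g_def
  proof (rule the_equality)
    show "\<exists>r'\<in>carrier R. \<exists>d'\<in>D. d \<oplus>\<^bsub>A\<^esub> r \<odot>\<^bsub>A\<^esub> z = d' \<oplus>\<^bsub>A\<^esub> r' \<odot>\<^bsub>A\<^esub> z \<and> r \<odot>\<^bsub>E\<^esub> x0 = r' \<odot>\<^bsub>E\<^esub> x0"
      using that by blast
  next
    fix e assume "\<exists>r'\<in>carrier R. \<exists>d'\<in>D. d \<oplus>\<^bsub>A\<^esub> r \<odot>\<^bsub>A\<^esub> z = d' \<oplus>\<^bsub>A\<^esub> r' \<odot>\<^bsub>A\<^esub> z \<and> e = r' \<odot>\<^bsub>E\<^esub> x0"
    then obtain r' d' where "r' \<in> carrier R" "d' \<in> D"
      "d \<oplus>\<^bsub>A\<^esub> r \<odot>\<^bsub>A\<^esub> z = d' \<oplus>\<^bsub>A\<^esub> r' \<odot>\<^bsub>A\<^esub> z" "e = r' \<odot>\<^bsub>E\<^esub> x0" by blast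
    then show "e = r \<odot>\<^bsub>E\<^esub> x0" using uniq[of r r' d d'] that by metis
  qed
  have NE: "\<exists>d r. d \<in> D \<and> r \<in> carrier R \<and> n = d \<oplus>\<^bsub>A\<^esub> r \<odot>\<^bsub>A\<^esub> z" if "n \<in> N" for n
    using that unfolding N_def A.submodule_sum_def A.cyc_def by blast
  have gh: "g \<in> rmod_hom R (A\<lparr>carrier := N\<rparr>) E"
  proof (rule rmod_homI)
    fix n assume "n \<in> carrier (A\<lparr>carrier := N\<rparr>)"
    then have "n \<in> N" by simp
    then obtain d r where "d \<in> D" "r \<in> carrier R" "n = d \<oplus>\<^bsub>A\<^esub> r \<odot>\<^bsub>A\<^esub> z" using NE by blast
    then show "g n \<in> carrier E" using g x0(1) by simp
  next
    fix n n' assume "n \<in> carrier (A\<lparr>carrier := N\<rparr>)" "n' \<in> carrier (A\<lparr>carrier := N\<rparr>)"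
    then have "n \<in> N" "n' \<in> N" by simp_all
    then obtain d r d' r' where n: "d \<in> D" "r \<in> carrier R" "n = d \<oplus>\<^bsub>A\<^esub> r \<odot>\<^bsub>A\<^esub> z"
      "d' \<in> D" "r' \<in> carrier R" "n' = d' \<oplus>\<^bsub>A\<^esub> r' \<odot>\<^bsub>A\<^esub> z" using NE by metis
    have "n \<oplus>\<^bsub>A\<^esub> n' = (d \<oplus>\<^bsub>A\<^esub> d') \<oplus>\<^bsub>A\<^esub> (r \<oplus> r') \<odot>\<^bsub>A\<^esub> z"
      using n Dc z(1) by (simp add: A.smult_l_distr A.M.a_ac)
    then have "g (n \<oplus>\<^bsub>A\<^esub> n') = (r \<oplus> r') \<odot>\<^bsub>E\<^esub> x0"
      using g[OF A.submoduleD(3)[OF D n(1,4)]] n(2,5) by simp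
    then show "g (n \<oplus>\<^bsub>A\<lparr>carrier := N\<rparr>\<^esub> n') = g n \<oplus>\<^bsub>E\<^esub> g n'"
      using n g x0(1) by (simp add: E.smult_l_distr)
  next
    fix a n assume a: "a \<in> carrier R" and "n \<in> carrier (A\<lparr>carrier := N\<rparr>)"
    then have "n \<in> N" by simp
    then obtain d r where n: "d \<in> D" "r \<in> carrier R" "n = d \<oplus>\<^bsub>A\<^esub> r \<odot>\<^bsub>A\<^esub> z" using NE by blast
    have "a \<odot>\<^bsub>A\<^esub> n = a \<odot>\<^bsub>A\<^esub> d \<oplus>\<^bsub>A\<^esub> (a \<otimes> r) \<odot>\<^bsub>A\<^esub> z"
      using n Dc z(1) a by (simp add: A.smult_r_distr A.smult_assoc1)
    then have "g (a \<odot>\<^bsub>A\<^esub> n) = (a \<otimes> r) \<odot>\<^bsub>E\<^esub> x0"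
      using g[OF A.submoduleD(4)[OF D a n(1)]] n(2) a by simp
    then show "g (a \<odot>\<^bsub>A\<lparr>carrier := N\<rparr>\<^esub> n) = a \<odot>\<^bsub>E\<^esub> g n"
      using n g x0(1) a by (simp add: E.smult_assoc1)
  qed
  have incl: "(\<lambda>x. x) \<in> rmod_hom R (A\<lparr>carrier := N\<rparr>) A"
    using Nc by (auto simp: rmod_hom_def)
  obtain \<psi> where \<psi>: "\<psi> \<in> rmod_hom R A E" "\<And>x. x \<in> N \<Longrightarrow> \<psi> x = g x"
    using injective_module_extend[OF E_inj Nmod A incl _ gh] by (auto simp: inj_on_def)
  have sub: "D \<subseteq> N" "A.cyc z \<subseteq> N"
    unfolding N_def using A.submodule_sum_upper[OF D A.submodule_cyc[OF z(1)]] by blast+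
  show ?thesis
  proof
    show "\<psi> \<in> rmod_hom R A E" by (rule \<psi>(1))
    fix x assume x: "x \<in> D"
    have "x = x \<oplus>\<^bsub>A\<^esub> \<zero> \<odot>\<^bsub>A\<^esub> z" using Dc[OF x] z(1) by simp
    then show "\<psi> x = \<zero>\<^bsub>E\<^esub>" using g[OF x, of \<zero>] \<psi>(2)[of x] x sub(1) x0(1) by auto
  next
    have "z = \<zero>\<^bsub>A\<^esub> \<oplus>\<^bsub>A\<^esub> \<one> \<odot>\<^bsub>A\<^esub> z" using z(1) by simp
    then show "\<psi> z = x0"
      using g[OF A.submodule_zero[OF D], of \<one>] \<psi>(2)[of z] A.cyc_self[OF z(1)] sub(2) x0(1) by auto
  qed
qed

section \<open>Annihilators: the duality between ideals of R and submodules of E\<close>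

definition annE :: "'a set \<Rightarrow> 'e set" where
  "annE J = {x \<in> carrier E. \<forall>y\<in>J. y \<odot>\<^bsub>E\<^esub> x = \<zero>\<^bsub>E\<^esub>}"

definition annR :: "'e set \<Rightarrow> 'a set" where
  "annR V = {y \<in> carrier R. \<forall>x\<in>V. y \<odot>\<^bsub>E\<^esub> x = \<zero>\<^bsub>E\<^esub>}"

lemma submodule_annE: "J \<subseteq> carrier R \<Longrightarrow> submodule (annE J) R E"
proof (rule E.submoduleI_smult)
  fix a x assume J: "J \<subseteq> carrier R" and a: "a \<in> carrier R" and x: "x \<in> annE J"
  have "y \<odot>\<^bsub>E\<^esub> (a \<odot>\<^bsub>E\<^esub> x) = \<zero>\<^bsub>E\<^esub>" if y: "y \<in> J" for y
  proof -
    have "y \<odot>\<^bsub>E\<^esub> (a \<odot>\<^bsub>E\<^esub> x) = a \<odot>\<^bsub>E\<^esub> (y \<odot>\<^bsub>E\<^esub> x)"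
      using a x y J by (intro E.smult_swap) (auto simp: annE_def)
    then show ?thesis using a x y by (simp add: annE_def)
  qed
  then show "a \<odot>\<^bsub>E\<^esub> x \<in> annE J" using a x by (simp add: annE_def)
qed (auto simp: annE_def E.smult_r_distr subset_iff)

lemma submodule_annR: "V \<subseteq> carrier E \<Longrightarrow> submodule (annR V) R (self_module R)"
  by (rule S.submoduleI_smult) (auto simp: annR_def E.smult_l_distr E.smult_assoc1 subset_iff)

lemma ideal_subset: "submodule J R (self_module R) \<Longrightarrow> J \<subseteq> carrier R"
  using ideal_carrier by blast

lemma annE_anti: "J \<subseteq> K \<Longrightarrow> annE K \<subseteq> annE J" by (auto simp: annE_def)

lemma annR_anti: "V \<subseteq> W \<Longrightarrow> annR W \<subseteq> annR V" by (auto simp: annR_def)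

text \<open>If y kills \<open>annE J\<close> but is not in J, pick z in J + R y outside J with m z
  inside J, and a functional \<psi> that vanishes on J with \<psi> z = x0. As \<psi> is r -> r
  \<psi>(1), the element \<psi>(1) lies in \<open>annE J\<close>. Then y kills it, and \<psi> z =
  0.\<close>

lemma annR_annE:
  assumes J: "submodule J R (self_module R)"
  shows "annR (annE J) = J"
proof
  show "J \<subseteq> annR (annE J)" using ideal_carrier[OF J] by (auto simp: annR_def annE_def)
  show "annR (annE J) \<subseteq> J"
  proof (rule ccontr)
    assume "\<not> annR (annE J) \<subseteq> J"
    then obtain y where y: "y \<in> annR (annE J)" "y \<notin> J" by blast
    have yc: "y \<in> carrier R" using y(1) by (simp add: annR_def)
    let ?N = "S.submodule_sum J (S.cyc y)"
    have cy: "submodule (S.cyc y) R (self_module R)" using S.submodule_cyc yc by simp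
    have N: "submodule ?N R (self_module R)" by (intro S.submodule_sum J cy)
    have "y \<in> S.cyc y" using S.cyc_self yc by simp
    then have "J \<subset> ?N" using S.submodule_sum_upper[OF J cy] y(2) by blast
    from relative_socle_exists[OF S.module_axioms J N this] obtain z where z: "z \<in> ?N" "z \<notin> J"
      "\<And>c. c \<in> m \<Longrightarrow> c \<odot>\<^bsub>self_module R\<^esub> z \<in> J" by blast
    obtain j r where jr: "j \<in> J" "r \<in> carrier R" "z = j \<oplus> r \<otimes> y"
      using z(1) unfolding S.submodule_sum_def S.cyc_def by auto
    have "z \<in> carrier (self_module R)" using ideal_carrier[OF N z(1)] by simp
    from socE_functional[OF S.module_axioms J this z(2,3)] obtain \<psi> where
      \<psi>: "\<psi> \<in> rmod_hom R (self_module R) E" "\<And>x. x \<in> J \<Longrightarrow> \<psi> x = \<zero>\<^bsub>E\<^esub>" "\<psi> z = x0" by blast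
    have \<psi>1: "\<psi> \<one> \<in> carrier E" using rmod_homD(1)[OF \<psi>(1), of \<one>] by simp
    have \<psi>r: "\<psi> r = r \<odot>\<^bsub>E\<^esub> \<psi> \<one>" if "r \<in> carrier R" for r
      using rmod_homD(3)[OF \<psi>(1) that, of \<one>] that by simp
    have "x \<odot>\<^bsub>E\<^esub> \<psi> \<one> = \<zero>\<^bsub>E\<^esub>" if "x \<in> J" for x
      using \<psi>r[OF ideal_carrier[OF J that]] \<psi>(2)[OF that] by metis
    then have "\<psi> \<one> \<in> annE J" unfolding annE_def using \<psi>1 by blast
    then have "y \<odot>\<^bsub>E\<^esub> \<psi> \<one> = \<zero>\<^bsub>E\<^esub>" using y(1) by (simp add: annR_def)
    then have "\<psi> y = \<zero>\<^bsub>E\<^esub>" using \<psi>r[OF yc] by metis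
    moreover have "\<psi> z = \<psi> j \<oplus>\<^bsub>E\<^esub> r \<odot>\<^bsub>E\<^esub> \<psi> y"
      using rmod_homD(2)[OF \<psi>(1), of j "r \<otimes> y"] rmod_homD(3)[OF \<psi>(1), of r y]
        ideal_carrier[OF J jr(1)] jr yc by simp
    ultimately show False using \<psi>(2)[OF jr(1)] \<psi>(3) x0(2) jr(2) by simp
  qed
qed

text \<open>Elements of \<open>annR V\<close> carry x into the socle R x0. If they all kill x, the
  closure of V + R x is no larger than that of V. Otherwise some y0 in \<open>annR V\<close> has y0
  x = x0, and comparing with y0 reduces any w in the closure to an element of V plus a multiple of
  x.\<close>

lemma annE_annR_step:
  assumes V: "submodule V R E" and closed: "annE (annR V) = V"
    and x: "x \<in> carrier E" and mx: "\<And>c. c \<in> m \<Longrightarrow> c \<odot>\<^bsub>E\<^esub> x \<in> V"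
  shows "annE (annR (E.submodule_sum V (E.cyc x))) = E.submodule_sum V (E.cyc x)"
    (is "annE (annR ?V') = ?V'")
proof
  have V': "submodule ?V' R E" by (intro E.submodule_sum V E.submodule_cyc x)
  show "?V' \<subseteq> annE (annR ?V')"
    using E.submodule_in_carrier[OF V'] by (auto simp: annE_def annR_def)
  have up: "V \<subseteq> ?V'" "x \<in> ?V'"
    using E.submodule_sum_upper[OF V E.submodule_cyc[OF x]] E.cyc_self[OF x] by blast+
  let ?A = "annR V"
  have Ac: "y \<in> carrier R" if "y \<in> ?A" for y using that by (simp add: annR_def)
  have A: "submodule ?A R (self_module R)"
    by (rule submodule_annR) (use E.submodule_in_carrier[OF V] in blast)
  have A': "y \<in> annR ?V'" if y: "y \<in> ?A" "y \<odot>\<^bsub>E\<^esub> x = \<zero>\<^bsub>E\<^esub>" for y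
  proof -
    have "y \<odot>\<^bsub>E\<^esub> (v \<oplus>\<^bsub>E\<^esub> r \<odot>\<^bsub>E\<^esub> x) = \<zero>\<^bsub>E\<^esub>" if "v \<in> V" "r \<in> carrier R" for v r
    proof -
      have "y \<odot>\<^bsub>E\<^esub> (r \<odot>\<^bsub>E\<^esub> x) = r \<odot>\<^bsub>E\<^esub> (y \<odot>\<^bsub>E\<^esub> x)"
        using that Ac[OF y(1)] x by (intro E.smult_swap)
      then show ?thesis
        using that y Ac[OF y(1)] x E.submodule_in_carrier[OF V]
        by (simp add: E.smult_r_distr annR_def)
    qed
    then show ?thesis using Ac[OF y(1)]
      by (auto simp: annR_def E.submodule_sum_def E.cyc_def)
  qed
  have my: "c \<odot>\<^bsub>E\<^esub> (y \<odot>\<^bsub>E\<^esub> x) = \<zero>\<^bsub>E\<^esub>" if "c \<in> m" "y \<in> ?A" for c y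
  proof -
    have "c \<odot>\<^bsub>E\<^esub> (y \<odot>\<^bsub>E\<^esub> x) = y \<odot>\<^bsub>E\<^esub> (c \<odot>\<^bsub>E\<^esub> x)"
      using that m_carrier Ac x by (intro E.smult_swap)
    then show ?thesis using that(2) mx[OF that(1)] by (simp add: annR_def)
  qed
  show "annE (annR ?V') \<subseteq> ?V'"
  proof (cases "\<forall>y\<in>?A. y \<odot>\<^bsub>E\<^esub> x = \<zero>\<^bsub>E\<^esub>")
    case True
    then have "annR V \<subseteq> annR ?V'" using A' by blast
    then show ?thesis using annE_anti closed up(1) by blast
  next
    case False
    then obtain y1 where y1: "y1 \<in> ?A" "y1 \<odot>\<^bsub>E\<^esub> x \<noteq> \<zero>\<^bsub>E\<^esub>" by blast
    obtain t where t: "t \<in> carrier R" "t \<odot>\<^bsub>E\<^esub> (y1 \<odot>\<^bsub>E\<^esub> x) = x0"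
      using socE_unit[of "y1 \<odot>\<^bsub>E\<^esub> x"] my y1 Ac x by blast
    define y0 where "y0 = t \<otimes> y1"
    have y0A: "y0 \<in> ?A" using S.submoduleD(4)[OF A t(1) y1(1)] by (simp add: y0_def)
    have y0c: "y0 \<in> carrier R" by (rule Ac[OF y0A])
    have y0x: "y0 \<odot>\<^bsub>E\<^esub> x = x0" using t y1(1) Ac x by (simp add: y0_def E.smult_assoc1)
    show ?thesis
    proof
      fix w assume w: "w \<in> annE (annR ?V')"
      then have wc: "w \<in> carrier E" by (simp add: annE_def)
      have kill: "y \<odot>\<^bsub>E\<^esub> w = \<zero>\<^bsub>E\<^esub>" if "y \<in> ?A" "y \<odot>\<^bsub>E\<^esub> x = \<zero>\<^bsub>E\<^esub>" for y
        using w A'[OF that] by (simp add: annE_def)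
      have "c \<odot>\<^bsub>E\<^esub> (y0 \<odot>\<^bsub>E\<^esub> w) = \<zero>\<^bsub>E\<^esub>" if c: "c \<in> m" for c
      proof -
        have "c \<otimes> y0 \<in> ?A" using S.submoduleD(4)[OF A m_carrier[OF c] y0A] by simp
        moreover have "(c \<otimes> y0) \<odot>\<^bsub>E\<^esub> x = \<zero>\<^bsub>E\<^esub>"
          using my[OF c y0A] m_carrier[OF c] y0c x by (simp add: E.smult_assoc1)
        ultimately show ?thesis
          using kill[of "c \<otimes> y0"] m_carrier[OF c] y0c wc by (simp add: E.smult_assoc1)
      qed
      then obtain c where c: "c \<in> carrier R" "y0 \<odot>\<^bsub>E\<^esub> w = c \<odot>\<^bsub>E\<^esub> x0"
        using socE[of "y0 \<odot>\<^bsub>E\<^esub> w"] y0c wc by blast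
      \<comment> \<open>The scalar c makes y0 kill u. Any other y in \<open>annR V\<close> differs
        from a multiple of y0 by an element that kills x, hence also kills w; so all of
        \<open>annR V\<close> kills u.\<close>
      define u where "u = w \<ominus>\<^bsub>E\<^esub> c \<odot>\<^bsub>E\<^esub> x"
      have "y \<odot>\<^bsub>E\<^esub> u = \<zero>\<^bsub>E\<^esub>" if y: "y \<in> ?A" for y
      proof -
        note yc = Ac[OF y]
        obtain r where r: "r \<in> carrier R" "y \<odot>\<^bsub>E\<^esub> x = r \<odot>\<^bsub>E\<^esub> x0"
          using socE[of "y \<odot>\<^bsub>E\<^esub> x"] my[OF _ y] yc x by blast
        have diff: "(y \<ominus> r \<otimes> y0) \<odot>\<^bsub>E\<^esub> v = y \<odot>\<^bsub>E\<^esub> v \<ominus>\<^bsub>E\<^esub> r \<odot>\<^bsub>E\<^esub> (y0 \<odot>\<^bsub>E\<^esub> v)" if "v \<in> carrier E" for v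
          using that yc y0c r(1) by (simp add: a_minus_def E.smult_l_distr E.smult_l_minus E.smult_assoc1)
        have "y \<ominus> r \<otimes> y0 \<in> ?A"
        proof -
          have "y \<ominus>\<^bsub>self_module R\<^esub> (r \<otimes> y0) = (\<one> \<otimes> y) \<oplus> (\<ominus> \<one>) \<otimes> (r \<otimes> y0)"
            using yc y0c r(1) S.smult_l_minus[of \<one> "r \<otimes> y0"] by (simp add: a_minus_def)
          also have "\<dots> = y \<ominus> r \<otimes> y0" using yc y0c r(1) by (simp add: a_minus_def l_minus)
          finally show ?thesis
            using S.submodule_minus[OF A y, of "r \<otimes> y0"] S.submoduleD(4)[OF A r(1) y0A] by simp
        qed
        moreover have "(y \<ominus> r \<otimes> y0) \<odot>\<^bsub>E\<^esub> x = \<zero>\<^bsub>E\<^esub>"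
          using diff[OF x] r y0x x0(1) by (simp add: E.M.minus_eq_zero_iff)
        ultimately have "(y \<ominus> r \<otimes> y0) \<odot>\<^bsub>E\<^esub> w = \<zero>\<^bsub>E\<^esub>" by (rule kill)
        then have "y \<odot>\<^bsub>E\<^esub> w = r \<odot>\<^bsub>E\<^esub> (y0 \<odot>\<^bsub>E\<^esub> w)"
          using diff[OF wc] yc y0c r(1) wc by (simp add: E.M.minus_eq_zero_iff)
        also have "\<dots> = c \<odot>\<^bsub>E\<^esub> (y \<odot>\<^bsub>E\<^esub> x)"
          using c r x0(1) by (simp add: E.smult_swap[of r c])
        also have "\<dots> = y \<odot>\<^bsub>E\<^esub> (c \<odot>\<^bsub>E\<^esub> x)"
          using c(1) yc x by (intro E.smult_swap)
        finally show ?thesis unfolding u_def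
          using yc wc c(1) x by (simp add: a_minus_def E.smult_r_distr E.smult_r_minus E.M.r_neg)
      qed
      then have "u \<in> annE ?A" using wc c(1) x by (simp add: annE_def u_def)
      then have "u \<in> V" using closed by simp
      moreover have "w = u \<oplus>\<^bsub>E\<^esub> c \<odot>\<^bsub>E\<^esub> x"
        using wc c(1) x by (simp add: u_def E.M.minus_add_cancel)
      ultimately show "w \<in> ?V'"
        using c(1) unfolding E.submodule_sum_def E.cyc_def by blast
    qed
  qed
qed

text \<open>V is exhausted from 0 by adding relative socle elements, and each step keeps the double
  annihilator property. The induction runs over the shrinking ideals \<open>annR W\<close>, because
  finite length is known for R and is deduced for E only afterwards.\<close>

lemma annE_annR:
  assumes V: "submodule V R E"
  shows "annE (annR V) = V"
proof -
  have "\<forall>W. submodule W R E \<longrightarrow> annE (annR W) = W \<longrightarrow> W \<subseteq> V \<longrightarrow> annR W = J \<longrightarrow> annE (annR V) = V"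
    if "submodule J R (self_module R)" for J
    using that fin_length'
  proof (induction rule: S.wf_submodule_induct)
    case (less J)
    show ?case
    proof (intro allI impI)
      fix W assume W: "submodule W R E" "annE (annR W) = W" "W \<subseteq> V" "annR W = J"
      show "annE (annR V) = V"
      proof (cases "W = V")
        case False
        then have "W \<subset> V" using W(3) by blast
        from relative_socle_exists[OF E.module_axioms W(1) V this] obtain x where
          x: "x \<in> V" "x \<notin> W" "\<And>c. c \<in> m \<Longrightarrow> c \<odot>\<^bsub>E\<^esub> x \<in> W" by blast
        have xc: "x \<in> carrier E" by (rule E.submodule_in_carrier[OF V x(1)])
        let ?W = "E.submodule_sum W (E.cyc x)"
        have sub: "submodule ?W R E" by (intro E.submodule_sum W(1) E.submodule_cyc xc)
        have cl: "annE (annR ?W) = ?W" by (rule annE_annR_step[OF W(1,2) xc x(3)])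
        have "W \<subseteq> ?W" "x \<in> ?W"
          using E.submodule_sum_upper[OF W(1) E.submodule_cyc[OF xc]] E.cyc_self[OF xc] by blast+
        then have "annR ?W \<subset> J"
          using annR_anti[of W ?W] W(2,4) cl x(2) by auto
        moreover have "submodule (annR ?W) R (self_module R)"
          by (rule submodule_annR) (use E.submodule_in_carrier[OF sub] in blast)
        moreover have "?W \<subseteq> V" by (rule E.submodule_sum_least[OF V W(3) E.cyc_least[OF V x(1)]])
        ultimately show ?thesis using less.IH sub cl by blast
      qed (use W(2) in simp)
    qed
  qed
  moreover have "submodule {\<zero>\<^bsub>E\<^esub>} R E" by (rule E.submodule_zero_module)
  moreover have "annR {\<zero>\<^bsub>E\<^esub>} = carrier R" by (auto simp: annR_def)
  moreover have "annE (carrier R) = {\<zero>\<^bsub>E\<^esub>}"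
    unfolding annE_def using E.smult_one by force
  moreover have "submodule (carrier R) R (self_module R)" using S.carrier_is_submodule by simp
  ultimately show ?thesis using E.submodule_zero[OF V] by auto
qed

lemma annE_zero: "annE {\<zero>} = carrier E" by (auto simp: annE_def)

lemma annR_carrier: "annR (carrier E) = {\<zero>}"
  using annR_annE[of "{\<zero>}"] S.submodule_zero_module annE_zero by simp

lemma faithful: "y \<in> carrier R \<Longrightarrow> (\<And>x. x \<in> carrier E \<Longrightarrow> y \<odot>\<^bsub>E\<^esub> x = \<zero>\<^bsub>E\<^esub>) \<Longrightarrow> y = \<zero>"
  using annR_carrier by (auto simp: annR_def)

lemma annR_strict:
  assumes "submodule V R E" "submodule W R E" "V \<subset> W"
  shows "annR W \<subset> annR V"
  using annR_anti[of V W] annE_annR[OF assms(1)] annE_annR[OF assms(2)] assms(3) by auto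

lemma annE_strict:
  assumes "submodule J R (self_module R)" "submodule K R (self_module R)" "J \<subset> K"
  shows "annE K \<subset> annE J"
  using annE_anti[of J K] annR_annE[OF assms(1)] annR_annE[OF assms(2)] assms(3) by auto

text \<open>The inclusion-reversing bijection turns chains between J and R upside down into chains
  between 0 and \<open>annE J\<close>. Topmost steps become bottom steps, which is why concatenation
  is used in the inductions.\<close>

lemma rel_length_annE:
  assumes J: "submodule J R (self_module R)"
  shows "E.len (annE J) = rel_length R (self_module R) J (carrier R)"
proof -
  have 1: "length_chain R E (annE K) n (annE J)"
    if "length_chain R (self_module R) J n K" "submodule K R (self_module R)" for n K
    using that
  proof (induction n arbitrary: K)
    case 0
    then show ?case using annE_anti by simp
  next
    case (Suc n)
    then obtain D where D: "submodule D R (self_module R)" "D \<subset> K"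
      "length_chain R (self_module R) J n D" by auto
    have "length_chain R E (annE K) (Suc 0) (annE D)"
      using annE_strict[OF D(1) Suc.prems(2) D(2)] submodule_annE[OF ideal_subset[OF Suc.prems(2)]]
      by auto
    from length_chain_concat[OF this submodule_annE[OF ideal_subset[OF D(1)]] Suc.IH[OF D(3,1)]]
    show ?case by simp
  qed
  have 2: "length_chain R (self_module R) (annR W) n (annR V)"
    if "length_chain R E V n W" "submodule V R E" "submodule W R E" for n V W
    using that
  proof (induction n arbitrary: W)
    case 0
    then show ?case using annR_anti by simp
  next
    case (Suc n)
    then obtain D where D: "submodule D R E" "D \<subset> W" "length_chain R E V n D" by auto
    have sub: "submodule (annR U) R (self_module R)" if "submodule U R E" for U
      using submodule_annR E.submodule_in_carrier[OF that] by blast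
    have "length_chain R (self_module R) (annR W) (Suc 0) (annR D)"
      using annR_strict[OF D(1) Suc.prems(3) D(2)] sub[OF Suc.prems(3)] by auto
    from length_chain_concat[OF this sub[OF D(1)] Suc.IH[OF D(3) Suc.prems(2) D(1)]]
    show ?case by simp
  qed
  have c: "submodule (carrier R) R (self_module R)" using S.carrier_is_submodule by simp
  have cE: "annE (carrier R) = {\<zero>\<^bsub>E\<^esub>}" unfolding annE_def using E.smult_one by force
  have cR: "annR {\<zero>\<^bsub>E\<^esub>} = carrier R" by (auto simp: annR_def)
  have "length_chain R E {\<zero>\<^bsub>E\<^esub>} n (annE J) \<longleftrightarrow> length_chain R (self_module R) J n (carrier R)" for n
    using 1[of n "carrier R", unfolded cE, OF _ c]
      2[of "{\<zero>\<^bsub>E\<^esub>}" n "annE J", unfolded cR annR_annE[OF J],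
        OF _ E.submodule_zero_module submodule_annE[OF ideal_subset[OF J]]] by (rule iffI[rotated])
  then show ?thesis by (simp add: rel_length_def)
qed

lemma len_annE:
  assumes J: "submodule J R (self_module R)"
  shows "S.len J + E.len (annE J) = S.len (carrier R)"
proof -
  have c: "submodule (carrier R) R (self_module R)" using S.carrier_is_submodule by simp
  show ?thesis unfolding rel_length_annE[OF J]
    using S.rel_length_add[OF S.submodule_zero_module J c] S.submodule_zero[OF J] ideal_subset[OF J]
    by simp
qed

lemma len_E: "E.len (carrier E) = S.len (carrier R)"
  using len_annE[of "{\<zero>}"] S.submodule_zero_module annE_zero by (simp add: S.rel_length_self[of "{\<zero>}", simplified])

lemma fin_length_E: "E.len (carrier E) \<noteq> \<infinity>"
  using len_E fin_length by simp

text \<open>Suppose f is multiplication by y on V, and let g = f - y. For x outside V, g x turns out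
  to be r x with r in \<open>annR V\<close>, so f is multiplication by y + r on V + R x. Strictly
  smaller annihilators end the process at V = E.\<close>

lemma endomorphism:
  assumes f: "f \<in> rmod_hom R E E"
  obtains y where "y \<in> carrier R" "\<And>x. x \<in> carrier E \<Longrightarrow> f x = y \<odot>\<^bsub>E\<^esub> x"
proof -
  have "\<forall>V. submodule V R E \<longrightarrow> annR V = J \<longrightarrow> (\<exists>y\<in>carrier R. \<forall>x\<in>V. f x = y \<odot>\<^bsub>E\<^esub> x) \<longrightarrow>
      (\<exists>y\<in>carrier R. \<forall>x\<in>carrier E. f x = y \<odot>\<^bsub>E\<^esub> x)" if "submodule J R (self_module R)" for J
    using that fin_length'
  proof (induction rule: S.wf_submodule_induct)
    case (less J)
    show ?case
    proof (intro allI impI)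
      fix V assume V: "submodule V R E" "annR V = J" and "\<exists>y\<in>carrier R. \<forall>x\<in>V. f x = y \<odot>\<^bsub>E\<^esub> x"
      then obtain y where y: "y \<in> carrier R" "\<And>x. x \<in> V \<Longrightarrow> f x = y \<odot>\<^bsub>E\<^esub> x" by blast
      show "\<exists>y\<in>carrier R. \<forall>x\<in>carrier E. f x = y \<odot>\<^bsub>E\<^esub> x"
      proof (cases "V = carrier E")
        case True
        then show ?thesis using y by blast
      next
        case False
        then obtain x where x: "x \<in> carrier E" "x \<notin> V" using E.submodule_in_carrier[OF V(1)] by blast
        define g where "g v = f v \<ominus>\<^bsub>E\<^esub> y \<odot>\<^bsub>E\<^esub> v" for v
        have fc: "f v \<in> carrier E" if "v \<in> carrier E" for v by (rule rmod_homD(1)[OF f that])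
        have g: "g \<in> rmod_hom R E E" unfolding g_def
        proof (rule rmod_hom_diff[OF E.module_axioms E.module_axioms f])
          show "(\<odot>\<^bsub>E\<^esub>) y \<in> rmod_hom R E E"
            by (rule rmod_homI) (use y(1) in
              \<open>auto simp: E.smult_r_distr intro: E.smult_swap\<close>)
        qed
        have gV: "g v = \<zero>\<^bsub>E\<^esub>" if "v \<in> V" for v
          using y that fc E.submodule_in_carrier[OF V(1) that] by (simp add: g_def E.M.minus_eq_zero_iff)
        have gx: "g x \<in> carrier E" by (rule rmod_homD(1)[OF g x(1)])
        \<comment> \<open>If c kills U, then c x lies in the double annihilator of V, which is V,
          and c g x = g (c x) = 0. Hence g x is in the double annihilator of U, which is U.\<close>
        define U where "U = (\<lambda>r. r \<odot>\<^bsub>E\<^esub> x) ` annR V"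
        have A: "submodule (annR V) R (self_module R)"
          using submodule_annR E.submodule_in_carrier[OF V(1)] by blast
        have U: "submodule U R E" unfolding U_def
          by (rule submodule_image[OF S.module_axioms E.module_axioms _ A], rule rmod_homI)
            (use x(1) in \<open>auto simp: E.smult_l_distr E.smult_assoc1\<close>)
        have "g x \<in> annE (annR U)"
          unfolding annE_def
        proof (intro CollectI conjI gx ballI)
          fix c assume c: "c \<in> annR U"
          then have cc: "c \<in> carrier R" by (simp add: annR_def)
          have "r \<odot>\<^bsub>E\<^esub> (c \<odot>\<^bsub>E\<^esub> x) = \<zero>\<^bsub>E\<^esub>" if "r \<in> annR V" for r
          proof -
            have "r \<odot>\<^bsub>E\<^esub> (c \<odot>\<^bsub>E\<^esub> x) = c \<odot>\<^bsub>E\<^esub> (r \<odot>\<^bsub>E\<^esub> x)"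
              using that cc x(1) by (intro E.smult_swap) (auto simp: annR_def)
            then show ?thesis using c that by (auto simp: annR_def U_def)
          qed
          then have "c \<odot>\<^bsub>E\<^esub> x \<in> annE (annR V)" using cc x(1) by (simp add: annE_def)
          then have "g (c \<odot>\<^bsub>E\<^esub> x) = \<zero>\<^bsub>E\<^esub>" using annE_annR[OF V(1)] gV by simp
          then show "c \<odot>\<^bsub>E\<^esub> g x = \<zero>\<^bsub>E\<^esub>" using rmod_homD(3)[OF g cc x(1)] by simp
        qed
        then obtain r where r: "r \<in> annR V" "g x = r \<odot>\<^bsub>E\<^esub> x"
          using annE_annR[OF U] unfolding U_def by auto
        have rc: "r \<in> carrier R" using r(1) by (simp add: annR_def)
        let ?W = "E.submodule_sum V (E.cyc x)"
        have W: "submodule ?W R E" by (intro E.submodule_sum V(1) E.submodule_cyc x(1))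
        have "V \<subset> ?W"
          using E.submodule_sum_upper[OF V(1) E.submodule_cyc[OF x(1)]] E.cyc_self[OF x(1)] x(2) by blast
        then have "annR ?W \<subset> J" using annR_strict[OF V(1) W] V(2) by simp
        moreover have "submodule (annR ?W) R (self_module R)"
          using submodule_annR E.submodule_in_carrier[OF W] by blast
        moreover have "\<forall>w\<in>?W. f w = (y \<oplus> r) \<odot>\<^bsub>E\<^esub> w"
        proof
          fix w assume "w \<in> ?W"
          then obtain v c where w: "v \<in> V" "c \<in> carrier R" "w = v \<oplus>\<^bsub>E\<^esub> c \<odot>\<^bsub>E\<^esub> x"
            by (auto simp: E.submodule_sum_def E.cyc_def)
          have vc: "v \<in> carrier E" by (rule E.submodule_in_carrier[OF V(1) w(1)])
          have wc: "w \<in> carrier E" using w vc x(1) by simp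
          have "g w = g v \<oplus>\<^bsub>E\<^esub> c \<odot>\<^bsub>E\<^esub> g x"
            using w vc x(1) by (simp add: rmod_homD[OF g])
          also have "\<dots> = r \<odot>\<^bsub>E\<^esub> v \<oplus>\<^bsub>E\<^esub> r \<odot>\<^bsub>E\<^esub> (c \<odot>\<^bsub>E\<^esub> x)"
            using gV[OF w(1)] r w(1,2) rc x(1)
            by (simp add: annR_def E.smult_swap[of c r])
          also have "\<dots> = r \<odot>\<^bsub>E\<^esub> w" using w vc x(1) rc by (simp add: E.smult_r_distr)
          finally have "f w \<ominus>\<^bsub>E\<^esub> y \<odot>\<^bsub>E\<^esub> w = r \<odot>\<^bsub>E\<^esub> w" by (simp add: g_def)
          then have "f w = r \<odot>\<^bsub>E\<^esub> w \<oplus>\<^bsub>E\<^esub> y \<odot>\<^bsub>E\<^esub> w"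
            using E.M.minus_add_cancel[OF fc[OF wc], of "y \<odot>\<^bsub>E\<^esub> w"] y(1) wc by simp
          then show "f w = (y \<oplus> r) \<odot>\<^bsub>E\<^esub> w"
            using y(1) rc wc by (simp add: E.smult_l_distr E.M.a_comm)
        qed
        ultimately show ?thesis using less.IH W y(1) rc by blast
      qed
    qed
  qed
  moreover have "\<forall>x\<in>{\<zero>\<^bsub>E\<^esub>}. f x = \<zero> \<odot>\<^bsub>E\<^esub> x"
    using rmod_hom_zero[OF E.module_axioms E.module_axioms f] by simp
  moreover have "submodule (annR {\<zero>\<^bsub>E\<^esub>}) R (self_module R)" by (rule submodule_annR) simp
  ultimately show ?thesis using that E.submodule_zero_module by blast
qed

end

section \<open>Minimal injective resolutions\<close>

context cube_zero_matlis
begin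

abbreviation Es where "Es s \<equiv> finite_direct_sum {..<s::nat} (\<lambda>_. E)"
abbreviation Rs where "Rs s \<equiv> free_module R s"

lemma Es_inj: "injective_module R (Es s)"
  by (rule injective_finite_direct_sum[OF R.is_cring E_inj])

lemma Es: "module R (Es s)"
  using Es_inj by (simp add: injective_module_def)

lemma Rs: "module R (Rs s)" by (rule module_free_module[OF R.is_cring])

lemma len_Es: "submodule B R E \<Longrightarrow> rel_length R (Es s) {\<zero>\<^bsub>Es s\<^esub>} ({..<s} \<rightarrow>\<^sub>E B) = of_nat s * E.len B"
  using len_PiE[OF R.is_cring, of s "\<lambda>_. E" "\<lambda>_. B"] E.module_axioms by simp

lemma len_Rs:
  "submodule B R (self_module R) \<Longrightarrow> rel_length R (Rs s) {\<zero>\<^bsub>Rs s\<^esub>} ({..<s} \<rightarrow>\<^sub>E B) = of_nat s * S.len B"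
  using len_PiE[OF R.is_cring, of s "\<lambda>_. self_module R" "\<lambda>_. B"] S.module_axioms
  unfolding free_module_def by simp

lemma fin_length_Es: "rel_length R (Es s) {\<zero>\<^bsub>Es s\<^esub>} (carrier (Es s)) \<noteq> \<infinity>"
  using len_Es[OF E.carrier_is_submodule, of s] fin_length_E by (auto simp: of_nat_eq_enat)

definition in_soc :: "nat \<Rightarrow> (nat \<Rightarrow> 'e) \<Rightarrow> bool" where
  "in_soc s z \<longleftrightarrow> z \<in> carrier (Es s) \<and> (\<forall>c\<in>m. \<forall>i<s. c \<odot>\<^bsub>E\<^esub> z i = \<zero>\<^bsub>E\<^esub>)"

lemma in_socD: "in_soc s z \<Longrightarrow> c \<in> m \<Longrightarrow> i < s \<Longrightarrow> c \<odot>\<^bsub>E\<^esub> z i = \<zero>\<^bsub>E\<^esub>"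
  "in_soc s z \<Longrightarrow> z \<in> carrier (Es s)"
  by (auto simp: in_soc_def)

text \<open>
  Minimality enters as: every socle element of the target is the image of an element that is
  killed by \<open>m\<close> modulo \<open>D\<close>. One coordinate is added for each step of the kernel towards \<open>D\<close>.
\<close>

lemma embed_in_Es:
  assumes A: "module R A" and fin: "rel_length R A {\<zero>\<^bsub>A\<^esub>} (carrier A) \<noteq> \<infinity>"
    and D: "submodule D R A"
  shows "\<exists>t. \<exists>\<phi>\<in>rmod_hom R A (Es t). rmod_kernel A (Es t) \<phi> = D \<and>
    (\<forall>z. in_soc t z \<longrightarrow> z \<in> \<phi> ` carrier A)" (is ?goal)
proof -
  interpret A: module R A by fact
  define T where "T = {l \<in> carrier A. \<forall>c\<in>m. c \<odot>\<^bsub>A\<^esub> l \<in> D}"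
  have "\<forall>t. \<forall>\<phi>\<in>rmod_hom R A (Es t). rmod_kernel A (Es t) \<phi> = K \<longrightarrow> D \<subseteq> K \<longrightarrow>
      (\<forall>z. in_soc t z \<longrightarrow> z \<in> \<phi> ` T) \<longrightarrow> ?goal" if "submodule K R A" for K
    using that fin
  proof (induction rule: A.wf_submodule_induct)
    case (less K)
    show ?case
    proof (intro allI ballI impI)
      fix t \<phi> assume \<phi>: "\<phi> \<in> rmod_hom R A (Es t)" "rmod_kernel A (Es t) \<phi> = K" and DK: "D \<subseteq> K"
        and soc: "\<forall>z. in_soc t z \<longrightarrow> z \<in> \<phi> ` T"
      show ?goal
      proof (cases "D = K")
        case True
        have "T \<subseteq> carrier A" by (auto simp: T_def)
        then have "\<forall>z. in_soc t z \<longrightarrow> z \<in> \<phi> ` carrier A" using soc by blast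
        then show ?thesis using \<phi> True by blast
      next
        case False
        then have "D \<subset> K" using DK by blast
        from relative_socle_exists[OF A D less.hyps this] obtain x where
          x: "x \<in> K" "x \<notin> D" "\<And>c. c \<in> m \<Longrightarrow> c \<odot>\<^bsub>A\<^esub> x \<in> D" by blast
        have xc: "x \<in> carrier A" using A.submodule_in_carrier[OF less.hyps x(1)] .
        \<comment> \<open>The new coordinate \<psi> vanishes on D but not on x, so adjoining it
          shrinks the kernel K without losing D.\<close>
        obtain \<psi> where \<psi>: "\<psi> \<in> rmod_hom R A E" "\<And>x. x \<in> D \<Longrightarrow> \<psi> x = \<zero>\<^bsub>E\<^esub>" "\<psi> x = x0"
          using socE_functional[OF A D xc x(2,3)] by blast
        define \<phi>' where "\<phi>' l = (\<lambda>i\<in>{..<Suc t}. if i < t then \<phi> l i else \<psi> l)" for l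
        have \<phi>c: "\<phi> l i \<in> carrier E" if "l \<in> carrier A" "i < t" for l i
          using rmod_homD(1)[OF \<phi>(1) that(1)] that(2) by auto
        have \<phi>': "\<phi>' \<in> rmod_hom R A (Es (Suc t))"
        proof (rule rmod_homI)
          fix l assume "l \<in> carrier A"
          then show "\<phi>' l \<in> carrier (Es (Suc t))"
            using \<phi>c rmod_homD(1)[OF \<psi>(1)] by (auto simp: \<phi>'_def)
        next
          fix l k assume "l \<in> carrier A" "k \<in> carrier A"
          then show "\<phi>' (l \<oplus>\<^bsub>A\<^esub> k) = \<phi>' l \<oplus>\<^bsub>Es (Suc t)\<^esub> \<phi>' k"
            using rmod_homD(2)[OF \<phi>(1)] rmod_homD(2)[OF \<psi>(1)]
            by (auto simp: \<phi>'_def intro!: restrict_ext)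
        next
          fix r l assume "r \<in> carrier R" "l \<in> carrier A"
          then show "\<phi>' (r \<odot>\<^bsub>A\<^esub> l) = r \<odot>\<^bsub>Es (Suc t)\<^esub> \<phi>' l"
            using rmod_homD(3)[OF \<phi>(1)] rmod_homD(3)[OF \<psi>(1)]
            by (auto simp: \<phi>'_def intro!: restrict_ext)
        qed
        have ker: "\<phi> l = \<zero>\<^bsub>Es t\<^esub> \<and> \<psi> l = \<zero>\<^bsub>E\<^esub>" if l0: "\<phi>' l = \<zero>\<^bsub>Es (Suc t)\<^esub>" and lc: "l \<in> carrier A" for l
        proof
          have eq: "\<phi>' l i = \<zero>\<^bsub>E\<^esub>" if "i < Suc t" for i using that l0 by simp
          show "\<psi> l = \<zero>\<^bsub>E\<^esub>" using eq[of t] by (simp add: \<phi>'_def)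
          show "\<phi> l = \<zero>\<^bsub>Es t\<^esub>"
          proof (rule extensionalityI[of _ "{..<t}"])
            show "\<phi> l \<in> extensional {..<t}" using rmod_homD(1)[OF \<phi>(1) lc] by (simp add: PiE_def)
            show "\<phi> l i = \<zero>\<^bsub>Es t\<^esub> i" if "i \<in> {..<t}" for i using eq[of i] that by (simp add: \<phi>'_def)
          qed simp
        qed
        have ker': "\<phi>' l = \<zero>\<^bsub>Es (Suc t)\<^esub>" if l0: "\<phi> l = \<zero>\<^bsub>Es t\<^esub>" "\<psi> l = \<zero>\<^bsub>E\<^esub>" for l
        proof -
          have "\<phi> l i = \<zero>\<^bsub>E\<^esub>" if "i < t" for i using that l0 by simp
          then show ?thesis using l0(2) by (auto simp: \<phi>'_def intro!: restrict_ext)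
        qed
        let ?K = "rmod_kernel A (Es (Suc t)) \<phi>'"
        have K'sub: "submodule ?K R A" by (rule submodule_kernel[OF A Es \<phi>'])
        have "?K \<subseteq> K" using ker \<phi>(2) unfolding rmod_kernel_def by blast
        moreover have "x \<notin> ?K" using ker[of x] \<psi>(3) x0(2) xc unfolding rmod_kernel_def by auto
        ultimately have K': "?K \<subset> K" using x(1) by blast
        have DK': "D \<subseteq> ?K"
        proof
          fix l assume l: "l \<in> D"
          then have "l \<in> K" using DK by blast
          then have "\<phi> l = \<zero>\<^bsub>Es t\<^esub>" "l \<in> carrier A" using \<phi>(2) unfolding rmod_kernel_def by blast+
          then show "l \<in> ?K" using ker'[of l] \<psi>(2)[OF l] unfolding rmod_kernel_def by blast
        qed
        have "z \<in> \<phi>' ` T" if z: "in_soc (Suc t) z" for z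
        proof -
          have zc: "z i \<in> carrier E" if "i < Suc t" for i using in_socD(2)[OF z] that by auto
          have "in_soc t (restrict z {..<t})"
            using in_socD(1)[OF z] zc by (auto simp: in_soc_def)
          then obtain l where l: "l \<in> T" "restrict z {..<t} = \<phi> l" using soc by blast
          have lc: "l \<in> carrier A" using l(1) by (simp add: T_def)
          have \<psi>l: "\<psi> l \<in> carrier E" by (rule rmod_homD(1)[OF \<psi>(1) lc])
          define u where "u = z t \<ominus>\<^bsub>E\<^esub> \<psi> l"
          have u: "u \<in> carrier E" using zc[of t] \<psi>l by (simp add: u_def)
          have "c \<odot>\<^bsub>E\<^esub> u = \<zero>\<^bsub>E\<^esub>" if c: "c \<in> m" for c
          proof -
            have "c \<odot>\<^bsub>E\<^esub> \<psi> l = \<psi> (c \<odot>\<^bsub>A\<^esub> l)" using rmod_homD(3)[OF \<psi>(1) m_carrier[OF c] lc] by simp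
            also have "\<dots> = \<zero>\<^bsub>E\<^esub>" using l(1) c by (intro \<psi>(2)) (simp add: T_def)
            finally show ?thesis
              using in_socD(1)[OF z c, of t] m_carrier[OF c] zc[of t] \<psi>l
              by (simp add: u_def a_minus_def E.smult_r_distr E.smult_r_minus)
          qed
          then obtain r where r: "r \<in> carrier R" "u = r \<odot>\<^bsub>E\<^esub> x0" using socE[OF u] by blast
          \<comment> \<open>Since x is in the kernel K of \<phi> and \<psi> x = x0, adding r x
            leaves the first t coordinates alone and adds exactly the missing u = r x0 to the last
            one.\<close>
          define l' where "l' = l \<oplus>\<^bsub>A\<^esub> r \<odot>\<^bsub>A\<^esub> x"
          have l'c: "l' \<in> carrier A" using lc r(1) xc by (simp add: l'_def)
          have "c \<odot>\<^bsub>A\<^esub> l' \<in> D" if c: "c \<in> m" for c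
          proof -
            have "c \<odot>\<^bsub>A\<^esub> l' = c \<odot>\<^bsub>A\<^esub> l \<oplus>\<^bsub>A\<^esub> r \<odot>\<^bsub>A\<^esub> (c \<odot>\<^bsub>A\<^esub> x)"
              using m_carrier[OF c] lc r(1) xc
              by (simp add: l'_def A.smult_r_distr A.smult_swap[of c r])
            moreover have "c \<odot>\<^bsub>A\<^esub> l \<in> D" using l(1) c by (simp add: T_def)
            moreover have "r \<odot>\<^bsub>A\<^esub> (c \<odot>\<^bsub>A\<^esub> x) \<in> D" by (rule A.submoduleD(4)[OF D r(1) x(3)[OF c]])
            ultimately show ?thesis using A.submoduleD(3)[OF D] by metis
          qed
          then have "l' \<in> T" using l'c by (simp add: T_def)
          moreover have "\<phi>' l' = z"
          proof (rule extensionalityI[of _ "{..<Suc t}"])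
            show "\<phi>' l' \<in> extensional {..<Suc t}" by (simp add: \<phi>'_def)
            show "z \<in> extensional {..<Suc t}" using in_socD(2)[OF z] by (simp add: PiE_def)
            have "\<phi> x = \<zero>\<^bsub>Es t\<^esub>" using x(1) \<phi>(2) unfolding rmod_kernel_def by blast
            then have "\<phi> l' = \<phi> l \<oplus>\<^bsub>Es t\<^esub> r \<odot>\<^bsub>Es t\<^esub> \<zero>\<^bsub>Es t\<^esub>"
              using lc r(1) xc by (simp only: l'_def rmod_homD(2,3)[OF \<phi>(1)] A.smult_closed)
            then have 1: "\<phi> l' i = z i" if "i < t" for i
              using that fun_cong[OF l(2), of i] zc[of i] r(1) by simp
            have "\<psi> l' = \<psi> l \<oplus>\<^bsub>E\<^esub> u"
              using lc r xc \<psi>(3) by (simp add: l'_def rmod_homD(2,3)[OF \<psi>(1)])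
            then have 2: "\<psi> l' = z t"
              using E.M.minus_add_cancel[of "z t" "\<psi> l"] zc[of t] \<psi>l u
              by (simp add: u_def[symmetric] E.M.a_comm)
            show "\<phi>' l' i = z i" if "i \<in> {..<Suc t}" for i
              using that 1[of i] 2 by (auto simp: \<phi>'_def less_Suc_eq)
          qed
          ultimately show ?thesis by blast
        qed
        then show ?thesis using less.IH[OF K'sub K'] \<phi>' DK' by blast
      qed
    qed
  qed
  note step = this[OF A.carrier_is_submodule]
  \<comment> \<open>The construction starts with no coordinates, where the kernel is all of A and
    the socle condition is met by zero.\<close>
  have 0: "(\<lambda>_. \<zero>\<^bsub>Es 0\<^esub>) \<in> rmod_hom R A (Es 0)" by (rule rmod_hom_zero_map[OF Es])
  have 1: "rmod_kernel A (Es 0) (\<lambda>_. \<zero>\<^bsub>Es 0\<^esub>) = carrier A" by (simp add: rmod_kernel_def)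
  have 2: "D \<subseteq> carrier A" using A.submodule_in_carrier[OF D] by blast
  have 3: "\<forall>z. in_soc 0 z \<longrightarrow> z \<in> (\<lambda>_. \<zero>\<^bsub>Es 0\<^esub>) ` T"
  proof (intro allI impI)
    fix z assume "in_soc 0 z"
    then have "z = \<zero>\<^bsub>Es 0\<^esub>" by (simp add: in_soc_def restrict_def)
    moreover have "\<zero>\<^bsub>A\<^esub> \<in> T" using A.submodule_zero[OF D] m_carrier by (auto simp: T_def)
    ultimately show "z \<in> (\<lambda>_. \<zero>\<^bsub>Es 0\<^esub>) ` T" by blast
  qed
  show ?thesis
    by (rule step[THEN spec, THEN bspec, OF 0, THEN mp, OF 1, THEN mp, OF 2, THEN mp, OF 3])
qed

text \<open>\<open>embed_in_Es\<close> is applied to the zero submodule of M and then to each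
  successive image. A map out of the whole term with prescribed kernel stands in for an embedding of
  the cokernel, so all terms live in the type of tuples over E.\<close>

lemma minimal_injective_resolution:
  assumes M: "module R M" and fin: "rel_length R M {\<zero>\<^bsub>M\<^esub>} (carrier M) \<noteq> \<infinity>"
  obtains s \<phi> \<delta> where "\<phi> \<in> rmod_hom R M (Es (s 0))" "inj_on \<phi> (carrier M)"
    "\<And>z. in_soc (s 0) z \<Longrightarrow> z \<in> \<phi> ` carrier M"
    "\<And>q. \<delta> q \<in> rmod_hom R (Es (s q)) (Es (s (Suc q)))"
    "rmod_kernel (Es (s 0)) (Es (s 1)) (\<delta> 0) = \<phi> ` carrier M"
    "\<And>q. rmod_kernel (Es (s (Suc q))) (Es (s (Suc (Suc q)))) (\<delta> (Suc q)) = \<delta> q ` carrier (Es (s q))"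
    "\<And>q z. in_soc (s (Suc q)) z \<Longrightarrow> z \<in> \<delta> q ` carrier (Es (s q))"
proof -
  interpret M: module R M by fact
  obtain s0 \<phi> where \<phi>: "\<phi> \<in> rmod_hom R M (Es s0)" "rmod_kernel M (Es s0) \<phi> = {\<zero>\<^bsub>M\<^esub>}"
    "\<forall>z. in_soc s0 z \<longrightarrow> z \<in> \<phi> ` carrier M"
    using embed_in_Es[OF M fin M.submodule_zero_module] by blast
  \<comment> \<open>A state (b, c, d) is a differential from E^b to E^c; the source rank comes
    first, the reverse of the free case.\<close>
  define P where "P n x \<longleftrightarrow> (case x of (b, c, d) \<Rightarrow>
      d \<in> rmod_hom R (Es b) (Es c) \<and> (\<forall>z. in_soc c z \<longrightarrow> z \<in> d ` carrier (Es b)) \<and>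
      (n = 0 \<longrightarrow> b = s0 \<and> rmod_kernel (Es b) (Es c) d = \<phi> ` carrier M))" for n :: nat and x
  define Q where "Q x x' \<longleftrightarrow> (case (x, x') of ((b, c, d), (b', c', d')) \<Rightarrow>
      b' = c \<and> rmod_kernel (Es c) (Es c') d' = d ` carrier (Es b))" for x x'
  have "\<exists>f. \<forall>n. P n (f n) \<and> Q (f n) (f (Suc n))"
  proof (rule dependent_nat_choice)
    show "\<exists>x. P 0 x"
      using embed_in_Es[OF Es fin_length_Es submodule_image[OF M Es \<phi>(1) M.carrier_is_submodule]]
      unfolding P_def by auto
    fix x n assume "P n x"
    then obtain b c d where x: "x = (b, c, d)" and d: "d \<in> rmod_hom R (Es b) (Es c)"
      by (cases x) (auto simp: P_def)
    from embed_in_Es[OF Es fin_length_Es submodule_image[OF Es Es d module.carrier_is_submodule[OF Es]]]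
    obtain c' d' where "d' \<in> rmod_hom R (Es c) (Es c')"
      "rmod_kernel (Es c) (Es c') d' = d ` carrier (Es b)"
      "\<forall>z. in_soc c' z \<longrightarrow> z \<in> d' ` carrier (Es c)" by blast
    then have "P (Suc n) (c, c', d') \<and> Q x (c, c', d')" unfolding P_def Q_def x by simp
    then show "\<exists>x'. P (Suc n) x' \<and> Q x x'" by blast
  qed
  then obtain f where f: "\<And>n. P n (f n)" "\<And>n. Q (f n) (f (Suc n))" by blast
  define s where "s n = fst (f n)" for n
  define \<delta> where "\<delta> n = snd (snd (f n))" for n
  have f_eq: "f n = (s n, s (Suc n), \<delta> n)" for n
    using f(2)[of n] by (auto simp: s_def \<delta>_def Q_def split: prod.splits)
  have s0: "s 0 = s0" using f(1)[of 0] by (simp add: f_eq P_def)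
  show ?thesis
  proof
    show "\<phi> \<in> rmod_hom R M (Es (s 0))" unfolding s0 by (rule \<phi>(1))
    show "inj_on \<phi> (carrier M)" using rmod_hom_inj_on[OF M Es \<phi>(1)] \<phi>(2) by blast
    show "z \<in> \<phi> ` carrier M" if "in_soc (s 0) z" for z using \<phi>(3) that unfolding s0 by blast
    show "\<delta> q \<in> rmod_hom R (Es (s q)) (Es (s (Suc q)))" for q
      using f(1)[of q] unfolding f_eq P_def prod.case by blast
    show "rmod_kernel (Es (s 0)) (Es (s 1)) (\<delta> 0) = \<phi> ` carrier M"
      using f(1)[of 0] unfolding f_eq P_def prod.case One_nat_def by blast
    show "rmod_kernel (Es (s (Suc q))) (Es (s (Suc (Suc q)))) (\<delta> (Suc q)) = \<delta> q ` carrier (Es (s q))" for q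
      using f(2)[of q] unfolding f_eq Q_def prod.case by blast
    show "z \<in> \<delta> q ` carrier (Es (s q))" if "in_soc (s (Suc q)) z" for q z
      using f(1)[of q] that unfolding f_eq P_def prod.case by blast
  qed
qed

text \<open>Since endomorphisms of \<open>E\<close> are scalars, \<open>Hom(E, E\<^sup>s) = R\<^sup>s\<close>; a map \<open>E\<^sup>s \<rightarrow> E\<^sup>t\<close> then induces
  \<open>R\<^sup>s \<rightarrow> R\<^sup>t\<close>.\<close>

definition act :: "nat \<Rightarrow> (nat \<Rightarrow> 'a) \<Rightarrow> 'e \<Rightarrow> nat \<Rightarrow> 'e" where
  "act s v x = (\<lambda>i\<in>{..<s}. v i \<odot>\<^bsub>E\<^esub> x)"

lemma act_closed: "v \<in> carrier (Rs s) \<Longrightarrow> x \<in> carrier E \<Longrightarrow> act s v x \<in> carrier (Es s)"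
  by (auto simp: act_def)

lemma act_hom: "v \<in> carrier (Rs s) \<Longrightarrow> act s v \<in> rmod_hom R E (Es s)"
proof (rule rmod_homI)
  assume v: "v \<in> carrier (Rs s)"
  fix r x assume "r \<in> carrier R" "x \<in> carrier E"
  then have "v i \<odot>\<^bsub>E\<^esub> (r \<odot>\<^bsub>E\<^esub> x) = r \<odot>\<^bsub>E\<^esub> (v i \<odot>\<^bsub>E\<^esub> x)" if "i < s" for i
    using v that by (intro E.smult_swap) auto
  then show "act s v (r \<odot>\<^bsub>E\<^esub> x) = r \<odot>\<^bsub>Es s\<^esub> act s v x"
    by (auto simp: act_def intro!: restrict_ext)
qed (auto simp: act_def PiE_iff E.smult_r_distr intro!: restrict_ext)

lemma hom_eq_act:
  assumes f: "f \<in> rmod_hom R E (Es s)"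
  obtains v where "v \<in> carrier (Rs s)" "\<And>x. x \<in> carrier E \<Longrightarrow> f x = act s v x"
proof -
  have "\<exists>y\<in>carrier R. \<forall>x\<in>carrier E. f x i = y \<odot>\<^bsub>E\<^esub> x" if i: "i < s" for i
  proof -
    have "(\<lambda>x. f x i) \<in> rmod_hom R E E"
      using rmod_homD[OF f] i by (intro rmod_homI) (auto simp: PiE_iff)
    from endomorphism[OF this] show ?thesis by metis
  qed
  then obtain y where y: "\<And>i. i < s \<Longrightarrow> y i \<in> carrier R"
    "\<And>i x. i < s \<Longrightarrow> x \<in> carrier E \<Longrightarrow> f x i = y i \<odot>\<^bsub>E\<^esub> x" by metis
  show ?thesis
  proof
    show "restrict y {..<s} \<in> carrier (Rs s)" using y(1) by auto
    show "f x = act s (restrict y {..<s}) x" if x: "x \<in> carrier E" for x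
      using rmod_homD(1)[OF f x] y(2)[OF _ x]
      by (intro extensionalityI[of _ "{..<s}"]) (auto simp: act_def PiE_def)
  qed
qed

lemma act_eqD:
  assumes v: "v \<in> carrier (Rs s)" and w: "w \<in> carrier (Rs s)"
    and eq: "\<And>x. x \<in> carrier E \<Longrightarrow> act s v x = act s w x"
  shows "v = w"
proof (rule extensionalityI[of _ "{..<s}"])
  fix i assume i: "i \<in> {..<s}"
  then have c: "v i \<in> carrier R" "w i \<in> carrier R" using v w by auto
  have "v i \<ominus> w i = \<zero>"
  proof (rule faithful)
    fix x assume x: "x \<in> carrier E"
    have "v i \<odot>\<^bsub>E\<^esub> x = w i \<odot>\<^bsub>E\<^esub> x" using fun_cong[OF eq[OF x], of i] i by (simp add: act_def)
    then show "(v i \<ominus> w i) \<odot>\<^bsub>E\<^esub> x = \<zero>\<^bsub>E\<^esub>"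
      using c x by (simp add: a_minus_def E.smult_l_distr E.smult_l_minus E.M.r_neg)
  qed (use c in auto)
  then show "v i = w i" using c by (simp add: R.minus_eq_zero_iff)
qed (use v w in \<open>auto simp: PiE_def\<close>)

text \<open>Composing \<open>act s v\<close> with \<delta> is again given by a tuple, namely \<rho>
  v. E is faithful, so tuples are determined by their action, and this uniqueness makes \<rho>
  linear.\<close>

lemma induced_hom:
  assumes \<delta>: "\<delta> \<in> rmod_hom R (Es s) (Es t)"
  obtains \<rho> where "\<rho> \<in> rmod_hom R (Rs s) (Rs t)"
    "\<And>v x. v \<in> carrier (Rs s) \<Longrightarrow> x \<in> carrier E \<Longrightarrow> \<delta> (act s v x) = act t (\<rho> v) x"
proof -
  have "\<exists>w\<in>carrier (Rs t). \<forall>x\<in>carrier E. \<delta> (act s v x) = act t w x" if v: "v \<in> carrier (Rs s)" for v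
    by (rule hom_eq_act[OF rmod_hom_comp[OF act_hom[OF v] \<delta>]]) blast
  then obtain \<rho> where \<rho>: "\<And>v. v \<in> carrier (Rs s) \<Longrightarrow> \<rho> v \<in> carrier (Rs t)"
    "\<And>v x. v \<in> carrier (Rs s) \<Longrightarrow> x \<in> carrier E \<Longrightarrow> \<delta> (act s v x) = act t (\<rho> v) x" by metis
  interpret Rs: module R "Rs s" by (rule Rs)
  interpret Rt: module R "Rs t" by (rule Rs)
  have "\<rho> \<in> rmod_hom R (Rs s) (Rs t)"
  proof (rule rmod_homI)
    fix v w assume v: "v \<in> carrier (Rs s)" and w: "w \<in> carrier (Rs s)"
    show "\<rho> (v \<oplus>\<^bsub>Rs s\<^esub> w) = \<rho> v \<oplus>\<^bsub>Rs t\<^esub> \<rho> w"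
    proof (rule act_eqD)
      show "\<rho> (v \<oplus>\<^bsub>Rs s\<^esub> w) \<in> carrier (Rs t)" by (intro \<rho>(1) Rs.M.a_closed v w)
      show "\<rho> v \<oplus>\<^bsub>Rs t\<^esub> \<rho> w \<in> carrier (Rs t)" by (intro \<rho>(1) Rt.M.a_closed v w)
      fix x assume x: "x \<in> carrier E"
      have add: "act k (v \<oplus>\<^bsub>Rs k\<^esub> w) x = act k v x \<oplus>\<^bsub>Es k\<^esub> act k w x"
        if "v \<in> carrier (Rs k)" "w \<in> carrier (Rs k)" for k v w
        using that x by (auto simp: act_def E.smult_l_distr PiE_iff intro!: restrict_ext)
      have "act t (\<rho> (v \<oplus>\<^bsub>Rs s\<^esub> w)) x = \<delta> (act s v x \<oplus>\<^bsub>Es s\<^esub> act s w x)"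
        using \<rho>(2)[OF Rs.M.a_closed[OF v w] x] by (simp only: add[OF v w])
      also have "\<dots> = act t (\<rho> v) x \<oplus>\<^bsub>Es t\<^esub> act t (\<rho> w) x"
        using rmod_homD(2)[OF \<delta> act_closed[OF v x] act_closed[OF w x]]
        by (simp only: \<rho>(2)[OF v x] \<rho>(2)[OF w x])
      finally show "act t (\<rho> (v \<oplus>\<^bsub>Rs s\<^esub> w)) x = act t (\<rho> v \<oplus>\<^bsub>Rs t\<^esub> \<rho> w) x"
        by (simp only: add[OF \<rho>(1)[OF v] \<rho>(1)[OF w]])
    qed
  next
    fix r v assume r: "r \<in> carrier R" and v: "v \<in> carrier (Rs s)"
    show "\<rho> (r \<odot>\<^bsub>Rs s\<^esub> v) = r \<odot>\<^bsub>Rs t\<^esub> \<rho> v"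
    proof (rule act_eqD)
      show "\<rho> (r \<odot>\<^bsub>Rs s\<^esub> v) \<in> carrier (Rs t)" by (intro \<rho>(1) Rs.smult_closed r v)
      show "r \<odot>\<^bsub>Rs t\<^esub> \<rho> v \<in> carrier (Rs t)" by (intro \<rho>(1) Rt.smult_closed r v)
      fix x assume x: "x \<in> carrier E"
      have sm: "act k (r \<odot>\<^bsub>Rs k\<^esub> v) x = r \<odot>\<^bsub>Es k\<^esub> act k v x" if "v \<in> carrier (Rs k)" for k v
        using that x r by (auto simp: act_def E.smult_assoc1 PiE_iff intro!: restrict_ext)
      have "act t (\<rho> (r \<odot>\<^bsub>Rs s\<^esub> v)) x = \<delta> (r \<odot>\<^bsub>Es s\<^esub> act s v x)"
        using \<rho>(2)[OF Rs.smult_closed[OF r v] x] by (simp only: sm[OF v])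
      also have "\<dots> = r \<odot>\<^bsub>Es t\<^esub> act t (\<rho> v) x"
        using rmod_homD(3)[OF \<delta> r act_closed[OF v x]] by (simp only: \<rho>(2)[OF v x])
      finally show "act t (\<rho> (r \<odot>\<^bsub>Rs s\<^esub> v)) x = act t (r \<odot>\<^bsub>Rs t\<^esub> \<rho> v) x"
        by (simp only: sm[OF \<rho>(1)[OF v]])
    qed
  qed (rule \<rho>(1))
  then show ?thesis using that \<rho>(2) by blast
qed

end

section \<open>Counting lengths\<close>

context cube_zero_matlis
begin

lemma smult_unit_zero:
  assumes u: "u \<in> carrier R" "u \<notin> m" and z: "z \<in> carrier R" and x: "x \<in> carrier E"
    and zero: "z \<odot>\<^bsub>E\<^esub> (u \<odot>\<^bsub>E\<^esub> x) = \<zero>\<^bsub>E\<^esub>"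
  shows "z \<odot>\<^bsub>E\<^esub> x = \<zero>\<^bsub>E\<^esub>"
proof -
  obtain t where t: "t \<in> carrier R" "t \<odot>\<^bsub>E\<^esub> (u \<odot>\<^bsub>E\<^esub> x) = x"
    using unit_cancel[OF E.module_axioms u x] .
  have "z \<odot>\<^bsub>E\<^esub> x = t \<odot>\<^bsub>E\<^esub> (z \<odot>\<^bsub>E\<^esub> (u \<odot>\<^bsub>E\<^esub> x))"
    using E.smult_swap[OF z t(1), of "u \<odot>\<^bsub>E\<^esub> x"] t(2) u(1) x by simp
  then show ?thesis using zero t(1) by simp
qed

lemma annE_m: "annE m = E.cyc x0"
proof
  show "annE m \<subseteq> E.cyc x0"
    unfolding E.cyc_def by (rule subsetI, rule socE) (auto simp: annE_def)
  have "c \<odot>\<^bsub>E\<^esub> (r \<odot>\<^bsub>E\<^esub> x0) = \<zero>\<^bsub>E\<^esub>" if "c \<in> m" "r \<in> carrier R" for c r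
    using that E.smult_swap[OF m_carrier[OF that(1)] that(2) x0(1)] x0(3) by simp
  then show "E.cyc x0 \<subseteq> annE m" using x0(1) by (auto simp: E.cyc_def annE_def)
qed

text \<open>Every nonzero submodule of R x0 contains x0, by \<open>socE_unit\<close>.\<close>

lemma len_socE: "E.len (annE m) = 1"
proof (rule enat_eqI)
  fix n
  have sub: "submodule (annE m) R E" using submodule_annE m_carrier by blast
  have z: "{\<zero>\<^bsub>E\<^esub>} \<subset> annE m"
    using x0 E.submodule_zero[OF sub] by (auto simp: annE_def)
  have full: "D = annE m" if D: "submodule D R E" "D \<subseteq> annE m" "D \<noteq> {\<zero>\<^bsub>E\<^esub>}" for D
  proof -
    obtain x where x: "x \<in> D" "x \<noteq> \<zero>\<^bsub>E\<^esub>" using E.submodule_zero[OF D(1)] D(3) by blast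
    then have "x \<in> annE m" using D(2) by blast
    then obtain r where r: "r \<in> carrier R" "r \<odot>\<^bsub>E\<^esub> x = x0"
      using socE_unit[of x] x(2) by (auto simp: annE_def)
    then have "x0 \<in> D" using E.submoduleD(4)[OF D(1) r(1) x(1)] by simp
    then show ?thesis using E.cyc_least[OF D(1)] D(2) annE_m by blast
  qed
  have "length_chain R E {\<zero>\<^bsub>E\<^esub>} n (annE m) \<longleftrightarrow> n \<le> 1"
  proof
    assume n: "length_chain R E {\<zero>\<^bsub>E\<^esub>} n (annE m)"
    show "n \<le> 1"
    proof (rule ccontr)
      assume "\<not> n \<le> 1"
      then have "length_chain R E {\<zero>\<^bsub>E\<^esub>} (Suc (Suc 0)) (annE m)"
        using n by (intro length_chain_le[OF n]) simp
      then obtain D D' where D: "submodule D R E" "D \<subset> annE m" "D' \<subset> D" "{\<zero>\<^bsub>E\<^esub>} \<subseteq> D'" by auto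
      then have "D \<noteq> {\<zero>\<^bsub>E\<^esub>}" by blast
      then show False using full[OF D(1)] D(2) by blast
    qed
  next
    assume "n \<le> 1"
    moreover have "length_chain R E {\<zero>\<^bsub>E\<^esub>} 1 (annE m)"
      using z E.submodule_zero_module by auto
    ultimately show "length_chain R E {\<zero>\<^bsub>E\<^esub>} n (annE m)" by (rule length_chain_le[rotated])
  qed
  then show "enat n \<le> E.len (annE m) \<longleftrightarrow> enat n \<le> 1"
    using psubset_imp_subset[OF z] by (simp add: enat_le_rel_length_iff one_enat_def)
qed

lemma annE_m2_iff: "x \<in> annE m2 \<longleftrightarrow> x \<in> carrier E \<and> (\<forall>a\<in>m. \<forall>b\<in>m. (a \<otimes> b) \<odot>\<^bsub>E\<^esub> x = \<zero>\<^bsub>E\<^esub>)"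
proof
  assume "x \<in> annE m2"
  then show "x \<in> carrier E \<and> (\<forall>a\<in>m. \<forall>b\<in>m. (a \<otimes> b) \<odot>\<^bsub>E\<^esub> x = \<zero>\<^bsub>E\<^esub>)"
    using m2_mult by (auto simp: annE_def)
next
  assume x: "x \<in> carrier E \<and> (\<forall>a\<in>m. \<forall>b\<in>m. (a \<otimes> b) \<odot>\<^bsub>E\<^esub> x = \<zero>\<^bsub>E\<^esub>)"
  then have "m2 \<subseteq> annR {x}"
    using m_carrier by (intro m2_least submodule_annR) (auto simp: annR_def)
  then show "x \<in> annE m2" using x by (auto simp: annE_def annR_def)
qed

end

text \<open>M is remembered by two facts: \<open>ker0\<close>, as the kernel of the first map is a
  copy of M and the socle kills it, and \<open>s0\<close>, as M is nonzero. Minimality is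
  \<open>soc_ker\<close>, and \<open>soc_not_cyclic\<close> is what failure of the Gorenstein
  property gives.\<close>

locale minimal_injective_complex = cube_zero_matlis R m E x0
  for R (structure) and m and E :: "('a, 'e) module" and x0 +
  fixes s :: "nat \<Rightarrow> nat" and \<delta> :: "nat \<Rightarrow> (nat \<Rightarrow> 'e) \<Rightarrow> (nat \<Rightarrow> 'e)"
    and \<rho> :: "nat \<Rightarrow> (nat \<Rightarrow> 'a) \<Rightarrow> (nat \<Rightarrow> 'a)"
  assumes \<delta>: "\<And>q. \<delta> q \<in> rmod_hom R (Es (s q)) (Es (s (Suc q)))"
    and soc_ker: "\<And>q z. in_soc (s q) z \<Longrightarrow> \<delta> q z = \<zero>\<^bsub>Es (s (Suc q))\<^esub>"
    and exactE: "\<And>q. rmod_kernel (Es (s (Suc q))) (Es (s (Suc (Suc q)))) (\<delta> (Suc q)) = \<delta> q ` carrier (Es (s q))"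
    and \<rho>: "\<And>q. \<rho> q \<in> rmod_hom R (Rs (s q)) (Rs (s (Suc q)))"
    and \<rho>\<delta>: "\<And>q v x. v \<in> carrier (Rs (s q)) \<Longrightarrow> x \<in> carrier E \<Longrightarrow>
      \<delta> q (act (s q) v x) = act (s (Suc q)) (\<rho> q v) x"
    and ker0: "\<And>x y i. x \<in> rmod_kernel (Es (s 0)) (Es (s 1)) (\<delta> 0) \<Longrightarrow> y \<in> soc \<Longrightarrow> i < s 0 \<Longrightarrow>
      y \<odot>\<^bsub>E\<^esub> x i = \<zero>\<^bsub>E\<^esub>"
    and s0: "s 0 > 0"
    and soc_not_cyclic: "\<And>y. y \<in> soc \<Longrightarrow> \<not> soc \<subseteq> S.cyc y"
begin

abbreviation kerE where "kerE q \<equiv> rmod_kernel (Es (s q)) (Es (s (Suc q))) (\<delta> q)"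
abbreviation kerR where "kerR q \<equiv> rmod_kernel (Rs (s q)) (Rs (s (Suc q))) (\<rho> q)"

lemma act_zero: "x \<in> carrier E \<Longrightarrow> act k \<zero>\<^bsub>Rs k\<^esub> x = \<zero>\<^bsub>Es k\<^esub>"
  by (auto simp: act_def intro!: restrict_ext)

lemma soc_nonzero: obtains y where "y \<in> soc" "y \<noteq> \<zero>"
proof -
  have "\<zero> \<in> soc" using S.submodule_zero[OF submodule_soc] by simp
  from soc_not_cyclic[OF this] show ?thesis using that by (force simp: S.cyc_def)
qed

text \<open>In positive degree x = \<delta> w, and y w lies in the socle of the preceding term, so y
  x = \<delta> (y w) = 0 by minimality.\<close>

lemma kerE_soc:
  assumes x: "x \<in> kerE q" and y: "y \<in> soc" and i: "i < s q"
  shows "y \<odot>\<^bsub>E\<^esub> x i = \<zero>\<^bsub>E\<^esub>"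
proof (cases q)
  case 0
  then show ?thesis using ker0 x y i by simp
next
  case (Suc p)
  then obtain w where w: "w \<in> carrier (Es (s p))" "x = \<delta> p w" using x exactE[of p] by auto
  interpret Ep: module R "Es (s p)" by (rule Es)
  have "in_soc (s p) (y \<odot>\<^bsub>Es (s p)\<^esub> w)"
    unfolding in_soc_def
  proof (intro conjI ballI allI impI)
    show "y \<odot>\<^bsub>Es (s p)\<^esub> w \<in> carrier (Es (s p))" by (rule Ep.smult_closed[OF soc_carrier[OF y] w(1)])
    fix c k assume c: "c \<in> m" and k: "k < s p"
    have wk: "w k \<in> carrier E" using w(1) k by auto
    have "c \<odot>\<^bsub>E\<^esub> (y \<odot>\<^bsub>E\<^esub> w k) = (c \<otimes> y) \<odot>\<^bsub>E\<^esub> w k"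
      using E.smult_assoc1[OF m_carrier[OF c] soc_carrier[OF y] wk] by simp
    also have "\<dots> = \<zero>\<^bsub>E\<^esub>" using soc_mult[OF y c] wk by simp
    finally show "c \<odot>\<^bsub>E\<^esub> (y \<odot>\<^bsub>Es (s p)\<^esub> w) k = \<zero>\<^bsub>E\<^esub>" using k by simp
  qed
  from soc_ker[OF this] have "y \<odot>\<^bsub>Es (s (Suc p))\<^esub> \<delta> p w = \<zero>\<^bsub>Es (s (Suc p))\<^esub>"
    using rmod_homD(3)[OF \<delta> soc_carrier[OF y] w(1)] by simp
  from fun_cong[OF this, of i] show ?thesis using i w(2) Suc by simp
qed

lemma faithful_on_soc: "z \<in> soc \<Longrightarrow> z \<noteq> \<zero> \<Longrightarrow> \<exists>x\<in>carrier E. z \<odot>\<^bsub>E\<^esub> x \<noteq> \<zero>\<^bsub>E\<^esub>"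
  using faithful[OF soc_carrier] by blast

text \<open>If the next term were zero, the kernel would be all of E^(s q). The socle would kill E,
  although E is faithful and the socle is nonzero.\<close>

lemma s_pos: "s q > 0"
proof (induction q)
  case (Suc q)
  show ?case
  proof (rule ccontr)
    assume "\<not> s (Suc q) > 0"
    then have 0: "s (Suc q) = 0" by simp
    obtain y where y: "y \<in> soc" "y \<noteq> \<zero>" by (rule soc_nonzero)
    obtain x where x: "x \<in> carrier E" "y \<odot>\<^bsub>E\<^esub> x \<noteq> \<zero>\<^bsub>E\<^esub>" using faithful_on_soc[OF y] by blast
    define w where "w = (\<lambda>i\<in>{..<s q}. x)"
    have w: "w \<in> carrier (Es (s q))" using x(1) by (auto simp: w_def)
    have "\<delta> q w = \<zero>\<^bsub>Es (s (Suc q))\<^esub>" using rmod_homD(1)[OF \<delta> w] 0 by (simp add: restrict_def)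
    then have "w \<in> kerE q" using w by (simp add: rmod_kernel_def)
    from kerE_soc[OF this y(1) Suc] show False using x(2) Suc by (simp add: w_def)
  qed
qed (rule s0)

text \<open>The tuple of all v i x lies in the kernel of \<delta> q, so the socle kills it; at a
  unit entry the factor v k can be cancelled. Every proof that entries lie in m goes through
  this.\<close>

lemma unit_entry_ann:
  assumes v: "v \<in> carrier (Rs (s q))" and k: "k < s q" "v k \<notin> m"
    and x: "x \<in> carrier E" and ker: "act (s (Suc q)) (\<rho> q v) x = \<zero>\<^bsub>Es (s (Suc q))\<^esub>" and z: "z \<in> soc"
  shows "z \<odot>\<^bsub>E\<^esub> x = \<zero>\<^bsub>E\<^esub>"
proof -
  have "act (s q) v x \<in> kerE q"
    using act_closed[OF v x] \<rho>\<delta>[OF v x] ker unfolding rmod_kernel_def by simp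
  from kerE_soc[OF this z k(1)] have "z \<odot>\<^bsub>E\<^esub> (v k \<odot>\<^bsub>E\<^esub> x) = \<zero>\<^bsub>E\<^esub>" using k(1) by (simp add: act_def)
  moreover have "v k \<in> carrier R" using v k(1) by auto
  ultimately show ?thesis using smult_unit_zero[OF _ k(2) soc_carrier[OF z] x] by blast
qed

lemma kerR_le_m: "kerR q \<subseteq> ({..<s q} \<rightarrow>\<^sub>E m)"
proof
  fix v assume v: "v \<in> kerR q"
  then have vc: "v \<in> carrier (Rs (s q))" and v0: "\<rho> q v = \<zero>\<^bsub>Rs (s (Suc q))\<^esub>"
    by (auto simp: rmod_kernel_def)
  have "v k \<in> m" if k: "k < s q" for k
  proof (rule ccontr)
    assume vk: "v k \<notin> m"
    obtain z where z: "z \<in> soc" "z \<noteq> \<zero>" by (rule soc_nonzero)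
    have "z \<odot>\<^bsub>E\<^esub> x = \<zero>\<^bsub>E\<^esub>" if x: "x \<in> carrier E" for x
      by (rule unit_entry_ann[OF vc k vk x _ z(1)]) (simp only: v0 act_zero[OF x])
    then show False using faithful_on_soc[OF z] by blast
  qed
  then show "v \<in> ({..<s q} \<rightarrow>\<^sub>E m)" using vc by (auto simp: PiE_iff)
qed

text \<open>Membership in m^2 is tested on \<open>annE m2\<close> by the double annihilator. For x
  there, entries of v in m send x into the socle of E^(s q), which \<delta> kills.\<close>

lemma \<rho>_entries_m2:
  assumes v: "v \<in> ({..<s q} \<rightarrow>\<^sub>E m)"
  shows "\<rho> q v \<in> ({..<s (Suc q)} \<rightarrow>\<^sub>E m2)"
proof -
  have vc: "v \<in> carrier (Rs (s q))" using v m_carrier by (auto simp: PiE_iff)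
  have \<rho>c: "\<rho> q v \<in> carrier (Rs (s (Suc q)))" by (rule rmod_homD(1)[OF \<rho> vc])
  have "\<rho> q v l \<in> annR (annE m2)" if l: "l < s (Suc q)" for l
    unfolding annR_def
  proof (intro CollectI conjI ballI)
    show "\<rho> q v l \<in> carrier R" using \<rho>c l by auto
    fix x assume x: "x \<in> annE m2"
    then have xc: "x \<in> carrier E" by (simp add: annE_def)
    have "in_soc (s q) (act (s q) v x)"
      unfolding in_soc_def
    proof (intro conjI ballI allI impI)
      show "act (s q) v x \<in> carrier (Es (s q))" by (rule act_closed[OF vc xc])
      fix c i assume c: "c \<in> m" and i: "i < s q"
      then have vi: "v i \<in> m" using v by auto
      have "c \<odot>\<^bsub>E\<^esub> (v i \<odot>\<^bsub>E\<^esub> x) = (c \<otimes> v i) \<odot>\<^bsub>E\<^esub> x"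
        using m_carrier[OF c] m_carrier[OF vi] xc by (simp add: E.smult_assoc1)
      also have "\<dots> = \<zero>\<^bsub>E\<^esub>" using x c vi by (simp add: annE_m2_iff)
      finally show "c \<odot>\<^bsub>E\<^esub> act (s q) v x i = \<zero>\<^bsub>E\<^esub>" using i by (simp add: act_def)
    qed
    from soc_ker[OF this] have "act (s (Suc q)) (\<rho> q v) x = \<zero>\<^bsub>Es (s (Suc q))\<^esub>"
      using \<rho>\<delta>[OF vc xc] by simp
    from fun_cong[OF this, of l] show "\<rho> q v l \<odot>\<^bsub>E\<^esub> x = \<zero>\<^bsub>E\<^esub>" using l by (simp add: act_def)
  qed
  then have "\<rho> q v l \<in> m2" if "l < s (Suc q)" for l using that annR_annE[OF submodule_m2] by simp
  then show ?thesis using \<rho>c by (auto simp: PiE_iff)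
qed

text \<open>For c in m the tuple c x is in the socle, so c \<delta> x = \<delta> (c x) = 0 by
  minimality.\<close>

lemma \<delta>_annE_m2:
  assumes x: "x \<in> ({..<s q} \<rightarrow>\<^sub>E annE m2)"
  shows "\<delta> q x \<in> ({..<s (Suc q)} \<rightarrow>\<^sub>E annE m)"
proof -
  interpret Ep: module R "Es (s q)" by (rule Es)
  have xc: "x \<in> carrier (Es (s q))" using x by (auto simp: PiE_iff annE_def)
  have \<delta>c: "\<delta> q x \<in> carrier (Es (s (Suc q)))" by (rule rmod_homD(1)[OF \<delta> xc])
  have "c \<odot>\<^bsub>E\<^esub> \<delta> q x l = \<zero>\<^bsub>E\<^esub>" if c: "c \<in> m" and l: "l < s (Suc q)" for c l
  proof -
    have "in_soc (s q) (c \<odot>\<^bsub>Es (s q)\<^esub> x)"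
      unfolding in_soc_def
    proof (intro conjI ballI allI impI)
      show "c \<odot>\<^bsub>Es (s q)\<^esub> x \<in> carrier (Es (s q))" by (rule Ep.smult_closed[OF m_carrier[OF c] xc])
      fix b i assume b: "b \<in> m" and i: "i < s q"
      have xi: "x i \<in> annE m2" using x i by auto
      then have "b \<odot>\<^bsub>E\<^esub> (c \<odot>\<^bsub>E\<^esub> x i) = \<zero>\<^bsub>E\<^esub>"
        using b c m_carrier E.smult_assoc1[of b c "x i"] by (simp add: annE_m2_iff)
      then show "b \<odot>\<^bsub>E\<^esub> (c \<odot>\<^bsub>Es (s q)\<^esub> x) i = \<zero>\<^bsub>E\<^esub>" using i by simp
    qed
    from soc_ker[OF this] have "c \<odot>\<^bsub>Es (s (Suc q))\<^esub> \<delta> q x = \<zero>\<^bsub>Es (s (Suc q))\<^esub>"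
      using rmod_homD(3)[OF \<delta> m_carrier[OF c] xc] by simp
    from fun_cong[OF this, of l] show ?thesis using l by simp
  qed
  then show ?thesis using \<delta>c by (auto simp: PiE_iff annE_def)
qed

text \<open>Exactness of the R-complex at place q + 1, the part supplied by the vanishing of
  Ext^(q+1)(E, M); the other inclusion is \<open>\<rho>\<rho>\<close>.\<close>

abbreviation exactR :: "nat \<Rightarrow> bool" where
  "exactR q \<equiv> kerR (Suc q) \<subseteq> \<rho> q ` carrier (Rs (s q))"

abbreviation unitR where "unitR q l y \<equiv> single {..<s q} (\<lambda>_. self_module R) l y"

lemma act_unitR:
  "l < s q \<Longrightarrow> y \<in> carrier R \<Longrightarrow> x \<in> carrier E \<Longrightarrow> act (s q) (unitR q l y) x = single {..<s q} (\<lambda>_. E) l (y \<odot>\<^bsub>E\<^esub> x)"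
  by (auto simp: act_def single_def intro!: restrict_ext)

lemma soc_lift:
  assumes ex: "exactR q" and y: "y \<in> soc" and l: "l < s (Suc q)"
  obtains v where "v \<in> ({..<s q} \<rightarrow>\<^sub>E m)" "\<rho> q v = unitR (Suc q) l y"
proof -
  note yc = soc_carrier[OF y]
  have uc: "unitR (Suc q) l y \<in> carrier (Rs (s (Suc q)))" using yc by (auto simp: single_def)
  \<comment> \<open>The coordinate vector of y is a cycle: it sends each x into the socle of the
    next power of E, where \<delta> is zero.\<close>
  have "\<rho> (Suc q) (unitR (Suc q) l y) = \<zero>\<^bsub>Rs (s (Suc (Suc q)))\<^esub>"
  proof (rule act_eqD[OF rmod_homD(1)[OF \<rho> uc] abelian_groupE(2)[OF module.axioms(2)[OF Rs]]])
    fix x assume x: "x \<in> carrier E"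
    have "c \<odot>\<^bsub>E\<^esub> (y \<odot>\<^bsub>E\<^esub> x) = \<zero>\<^bsub>E\<^esub>" if "c \<in> m" for c
      using E.smult_assoc1[OF m_carrier[OF that] yc x] soc_mult[OF y that] x by simp
    then have "in_soc (s (Suc q)) (act (s (Suc q)) (unitR (Suc q) l y) x)"
      using act_closed[OF uc x] m_carrier unfolding act_unitR[OF l yc x]
      by (auto simp: in_soc_def single_def)
    from soc_ker[OF this] show "act (s (Suc (Suc q))) (\<rho> (Suc q) (unitR (Suc q) l y)) x =
        act (s (Suc (Suc q))) \<zero>\<^bsub>Rs (s (Suc (Suc q)))\<^esub> x"
      using \<rho>\<delta>[OF uc x] act_zero[OF x] by simp
  qed
  then have "unitR (Suc q) l y \<in> kerR (Suc q)" using uc unfolding rmod_kernel_def by blast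
  then obtain v where v: "v \<in> carrier (Rs (s q))" "unitR (Suc q) l y = \<rho> q v" using ex by blast
  have "v k \<in> m" if k: "k < s q" for k
  proof (rule ccontr)
    assume vk: "v k \<notin> m"
    have cy: "submodule (S.cyc y) R (self_module R)" using S.submodule_cyc yc by simp
    \<comment> \<open>On elements x with y x = 0 the tuple \<rho> v acts as zero, so a unit entry of
      v makes the whole socle kill them; the double annihilator of R y is R y.\<close>
    have "soc \<subseteq> annR (annE (S.cyc y))"
    proof
      fix z assume z: "z \<in> soc"
      have "z \<odot>\<^bsub>E\<^esub> x = \<zero>\<^bsub>E\<^esub>" if "x \<in> annE (S.cyc y)" for x
      proof -
        have "y \<in> S.cyc y" using S.cyc_self yc by simp
        then have x: "x \<in> carrier E" "y \<odot>\<^bsub>E\<^esub> x = \<zero>\<^bsub>E\<^esub>" using that by (auto simp: annE_def)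
        have "act (s (Suc q)) (\<rho> q v) x = \<zero>\<^bsub>Es (s (Suc q))\<^esub>"
          unfolding v(2)[symmetric] act_unitR[OF l yc x(1)] x(2)
          by (auto simp: single_def intro!: restrict_ext)
        from unit_entry_ann[OF v(1) k vk x(1) this z] show ?thesis .
      qed
      then show "z \<in> annR (annE (S.cyc y))" using soc_carrier[OF z] by (simp add: annR_def)
    qed
    then show False using soc_not_cyclic[OF y] annR_annE[OF cy] by simp
  qed
  then have "v \<in> ({..<s q} \<rightarrow>\<^sub>E m)" using v(1) by (auto simp: PiE_iff)
  then show ?thesis using that v(2) by metis
qed

lemma soc_eq_m2:
  assumes ex: "exactR q"
  shows "soc = m2"
proof
  show "soc \<subseteq> m2"
  proof
    fix y assume y: "y \<in> soc"
    obtain v where v: "v \<in> ({..<s q} \<rightarrow>\<^sub>E m)" "\<rho> q v = unitR (Suc q) 0 y"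
      using soc_lift[OF ex y s_pos] .
    have "\<rho> q v 0 \<in> m2" using \<rho>_entries_m2[OF v(1)] s_pos[of "Suc q"] by auto
    then show "y \<in> m2" unfolding v(2) using s_pos[of "Suc q"] by (simp add: single_def)
  qed
qed (rule m2_le_soc)

lemma \<rho>_image:
  assumes ex: "exactR q"
  shows "\<rho> q ` ({..<s q} \<rightarrow>\<^sub>E m) = ({..<s (Suc q)} \<rightarrow>\<^sub>E m2)"
proof
  show "\<rho> q ` ({..<s q} \<rightarrow>\<^sub>E m) \<subseteq> ({..<s (Suc q)} \<rightarrow>\<^sub>E m2)" using \<rho>_entries_m2 by blast
  have sub: "submodule ({..<s q} \<rightarrow>\<^sub>E m) R (Rs (s q))"
    unfolding free_module_def by (rule submodule_PiE[OF R.is_cring S.module_axioms m_ideal])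
  show "({..<s (Suc q)} \<rightarrow>\<^sub>E m2) \<subseteq> \<rho> q ` ({..<s q} \<rightarrow>\<^sub>E m)"
  proof (rule PiE_lessThan_subset_submodule[OF R.is_cring S.module_axioms submodule_m2])
    show "submodule (\<rho> q ` ({..<s q} \<rightarrow>\<^sub>E m)) R (finite_direct_sum {..<s (Suc q)} (\<lambda>_. self_module R))"
      using submodule_image[OF Rs Rs \<rho> sub] by (simp only: free_module_def)
    fix l z assume "l < s (Suc q)" "z \<in> m2"
    then show "unitR (Suc q) l z \<in> \<rho> q ` ({..<s q} \<rightarrow>\<^sub>E m)"
      using soc_lift[OF ex _, of z l] m2_le_soc by (metis imageI subsetD)
  qed
qed

text \<open>A lift over R gives one over E: write z = y x' with y in the socle of R, lift the
  coordinate vector of y to v, and apply v to x'. The entries of v lie in m, so m^3 = 0 puts those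
  of v x' into \<open>annE m2\<close>.\<close>

lemma \<delta>_image:
  assumes ex: "exactR q"
  shows "\<delta> q ` ({..<s q} \<rightarrow>\<^sub>E annE m2) = ({..<s (Suc q)} \<rightarrow>\<^sub>E annE m)"
proof
  show "\<delta> q ` ({..<s q} \<rightarrow>\<^sub>E annE m2) \<subseteq> ({..<s (Suc q)} \<rightarrow>\<^sub>E annE m)" using \<delta>_annE_m2 by blast
  have E2: "submodule (annE m2) R E" by (rule submodule_annE[OF ideal_subset[OF submodule_m2]])
  have E1: "submodule (annE m) R E" by (rule submodule_annE[OF ideal_subset[OF m_ideal]])
  have sub: "submodule ({..<s q} \<rightarrow>\<^sub>E annE m2) R (Es (s q))"
    by (rule submodule_PiE[OF R.is_cring E.module_axioms E2])
  show "({..<s (Suc q)} \<rightarrow>\<^sub>E annE m) \<subseteq> \<delta> q ` ({..<s q} \<rightarrow>\<^sub>E annE m2)"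
  proof (rule PiE_lessThan_subset_submodule[OF R.is_cring E.module_axioms E1 submodule_image[OF Es Es \<delta> sub]])
    fix l z assume l: "l < s (Suc q)" and z: "z \<in> annE m"
    \<comment> \<open>Any nonzero y serves: y x is then a nonzero socle element of E, and the socle
      of E consists of its multiples.\<close>
    obtain y where y: "y \<in> soc" "y \<noteq> \<zero>" by (rule soc_nonzero)
    note yc = soc_carrier[OF y(1)]
    obtain x where x: "x \<in> carrier E" "y \<odot>\<^bsub>E\<^esub> x \<noteq> \<zero>\<^bsub>E\<^esub>" using faithful_on_soc[OF y] by blast
    have "c \<odot>\<^bsub>E\<^esub> (y \<odot>\<^bsub>E\<^esub> x) = \<zero>\<^bsub>E\<^esub>" if "c \<in> m" for c
      using E.smult_assoc1[OF m_carrier[OF that] yc x(1)] soc_mult[OF y(1) that] x(1) by simp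
    then obtain t where t: "t \<in> carrier R" "t \<odot>\<^bsub>E\<^esub> (y \<odot>\<^bsub>E\<^esub> x) = x0"
      using socE_unit[of "y \<odot>\<^bsub>E\<^esub> x"] x yc by blast
    obtain r where r: "r \<in> carrier R" "z = r \<odot>\<^bsub>E\<^esub> x0"
      using z annE_m unfolding E.cyc_def by blast
    define x' where "x' = (r \<otimes> t) \<odot>\<^bsub>E\<^esub> x"
    have x': "x' \<in> carrier E" using r(1) t(1) x(1) by (simp add: x'_def)
    have "z = (r \<otimes> t) \<odot>\<^bsub>E\<^esub> (y \<odot>\<^bsub>E\<^esub> x)"
      using r t yc x(1) by (simp add: E.smult_assoc1)
    also have "\<dots> = y \<odot>\<^bsub>E\<^esub> x'" unfolding x'_def
      by (rule E.smult_swap) (use r(1) t(1) yc x(1) in auto)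
    finally have zx': "z = y \<odot>\<^bsub>E\<^esub> x'" .
    obtain v where v: "v \<in> ({..<s q} \<rightarrow>\<^sub>E m)" "\<rho> q v = unitR (Suc q) l y"
      using soc_lift[OF ex y(1) l] .
    have vc: "v \<in> carrier (Rs (s q))" using v(1) m_carrier by (auto simp: PiE_iff)
    have "act (s q) v x' \<in> ({..<s q} \<rightarrow>\<^sub>E annE m2)"
    proof -
      have "v i \<odot>\<^bsub>E\<^esub> x' \<in> annE m2" if i: "i < s q" for i
      proof -
        have vi: "v i \<in> m" using v(1) i by auto
        have "(a \<otimes> b) \<odot>\<^bsub>E\<^esub> (v i \<odot>\<^bsub>E\<^esub> x') = \<zero>\<^bsub>E\<^esub>" if "a \<in> m" "b \<in> m" for a b
          using E.smult_assoc1[of "a \<otimes> b" "v i" x'] cube[OF that vi] that vi m_carrier x' by simp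
        then show ?thesis using m_carrier[OF vi] x' by (simp add: annE_m2_iff)
      qed
      then show ?thesis by (auto simp: act_def)
    qed
    moreover have "\<delta> q (act (s q) v x') = single {..<s (Suc q)} (\<lambda>_. E) l z"
      unfolding \<rho>\<delta>[OF vc x'] v(2) act_unitR[OF l yc x'] zx' ..
    ultimately show "single {..<s (Suc q)} (\<lambda>_. E) l z \<in> \<delta> q ` ({..<s q} \<rightarrow>\<^sub>E annE m2)"
      by (metis imageI)
  qed
qed

lemma kerE_le:
  assumes ex: "exactR p"
  shows "kerE q \<subseteq> ({..<s q} \<rightarrow>\<^sub>E annE m2)"
proof
  fix x assume x: "x \<in> kerE q"
  then have "x \<in> carrier (Es (s q))" by (simp add: rmod_kernel_def)
  then show "x \<in> ({..<s q} \<rightarrow>\<^sub>E annE m2)"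
    using kerE_soc[OF x] soc_eq_m2[OF ex] by (auto simp: PiE_iff annE_def)
qed

lemma \<rho>\<rho>: "v \<in> carrier (Rs (s q)) \<Longrightarrow> \<rho> q v \<in> kerR (Suc q)"
proof -
  assume v: "v \<in> carrier (Rs (s q))"
  have \<rho>c: "\<rho> q v \<in> carrier (Rs (s (Suc q)))" by (rule rmod_homD(1)[OF \<rho> v])
  have "\<rho> (Suc q) (\<rho> q v) = \<zero>\<^bsub>Rs (s (Suc (Suc q)))\<^esub>"
  proof (rule act_eqD[OF rmod_homD(1)[OF \<rho> \<rho>c] abelian_groupE(2)[OF module.axioms(2)[OF Rs]]])
    fix x assume x: "x \<in> carrier E"
    have "\<delta> q (act (s q) v x) \<in> kerE (Suc q)" using exactE[of q] act_closed[OF v x] by blast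
    then have "\<delta> (Suc q) (act (s (Suc q)) (\<rho> q v) x) = \<zero>\<^bsub>Es (s (Suc (Suc q)))\<^esub>"
      unfolding rmod_kernel_def \<rho>\<delta>[OF v x] by blast
    then show "act (s (Suc (Suc q))) (\<rho> (Suc q) (\<rho> q v)) x =
        act (s (Suc (Suc q))) \<zero>\<^bsub>Rs (s (Suc (Suc q)))\<^esub> x"
      using \<rho>\<delta>[OF \<rho>c x] act_zero[OF x] by simp
  qed
  then show ?thesis using \<rho>c unfolding rmod_kernel_def by blast
qed

end

text \<open>Subtracting the equations for r, and those for t, forces r = p and t = u because a is
  not 1. What remains is (1 + a) p = e u and (1 + a) u = e p, whose product compares squares of
  nonnegative numbers.\<close>

lemma double_recurrence:
  fixes p u r t e a :: int
  assumes pos: "p > 0" "u > 0" "e \<ge> 0" "a \<ge> 0" and a: "a \<noteq> 1"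
    and E1: "r = e * u - a * p" and E2: "t = e * r - a * u"
    and R1: "a * r = e * u - p" and R2: "a * t = e * r - u"
  shows "e = a + 1"
proof -
  have "(1 - a) * (r - p) = 0" using E1 R1 by (simp add: algebra_simps)
  then have r: "r = p" using a by simp
  have "(1 - a) * (t - u) = 0" using E2 R2 by (simp add: algebra_simps)
  then have t: "t = u" using a by simp
  have 1: "(1 + a) * p = e * u" using E1 r by (simp add: algebra_simps)
  have 2: "(1 + a) * u = e * p" using E2 r t by (simp add: algebra_simps)
  have "((1 + a) * p) * ((1 + a) * u) = (e * u) * (e * p)" by (simp only: 1 2)
  then have "((1 + a)\<^sup>2) * (p * u) = (e\<^sup>2) * (p * u)" by (simp add: power2_eq_square algebra_simps)
  then have "(1 + a)\<^sup>2 = e\<^sup>2" using pos(1,2) by simp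
  then show ?thesis using pos(3,4) by (simp add: power2_eq_iff)
qed

section \<open>Length equations for the kernels and the resulting length of R\<close>

context minimal_injective_complex
begin

text \<open>The second equation counts lengths for the whole term, the third for its part
  annihilated by m^2, which contains the kernel and maps onto the next socle. The summand s q * a
  keeps the length L - a of \<open>annE m2\<close> free of subtraction.\<close>

lemma kernel_lengths_E:
  obtains K where "\<And>q. rel_length R (Es (s q)) {\<zero>\<^bsub>Es (s q)\<^esub>} (kerE q) = enat (K q)"
    "\<And>q L. S.len (carrier R) = enat L \<Longrightarrow> K q + K (Suc q) = s q * L"
    "\<And>q L a. S.len (carrier R) = enat L \<Longrightarrow> S.len m2 = enat a \<Longrightarrow> exactR q \<Longrightarrow>
      s q * L = K q + s (Suc q) + s q * a"
proof -
  have kerE: "submodule (kerE q) R (Es (s q))" for q by (rule submodule_kernel[OF Es Es \<delta>])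
  have carE: "submodule (carrier (Es k)) R (Es k)" for k by (rule module.carrier_is_submodule[OF Es])
  have le: "rel_length R (Es (s q)) {\<zero>\<^bsub>Es (s q)\<^esub>} (kerE q) \<le> rel_length R (Es (s q)) {\<zero>\<^bsub>Es (s q)\<^esub>} (carrier (Es (s q)))" for q
    by (rule module.len_mono[OF Es kerE carE module.submoduleE(1)[OF Es kerE]])
  have "\<exists>k. rel_length R (Es (s q)) {\<zero>\<^bsub>Es (s q)\<^esub>} (kerE q) = enat k" for q
  proof -
    obtain n where "rel_length R (Es (s q)) {\<zero>\<^bsub>Es (s q)\<^esub>} (carrier (Es (s q))) = enat n"
      using fin_length_Es[of "s q"] by blast
    then show ?thesis using le[of q] enat_ile by metis
  qed
  then obtain K where K: "\<And>q. rel_length R (Es (s q)) {\<zero>\<^bsub>Es (s q)\<^esub>} (kerE q) = enat (K q)" by metis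
  show ?thesis
  proof (rule that[OF K])
    fix q L assume L: "S.len (carrier R) = enat L"
    have "carrier (Es (s q)) \<inter> kerE q = kerE q" by (auto simp: rmod_kernel_def)
    then have "rel_length R (Es (s q)) {\<zero>\<^bsub>Es (s q)\<^esub>} (carrier (Es (s q))) = enat (K q) + enat (K (Suc q))"
      using len_hom[OF Es Es \<delta> carE, of q] by (simp only: K exactE[symmetric])
    then show "K q + K (Suc q) = s q * L"
      using len_Es[OF E.carrier_is_submodule, of "s q"] len_E L by (simp add: of_nat_eq_enat)
  next
    fix q L a assume L: "S.len (carrier R) = enat L" and a: "S.len m2 = enat a" and ex: "exactR q"
    have E2: "submodule (annE m2) R E" by (rule submodule_annE[OF ideal_subset[OF submodule_m2]])
    have E1: "submodule (annE m) R E" by (rule submodule_annE[OF ideal_subset[OF m_ideal]])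
    have sub: "submodule ({..<s q} \<rightarrow>\<^sub>E annE m2) R (Es (s q))"
      by (rule submodule_PiE[OF R.is_cring E.module_axioms E2])
    have "({..<s q} \<rightarrow>\<^sub>E annE m2) \<inter> kerE q = kerE q" using kerE_le[OF ex] by blast
    then have "of_nat (s q) * E.len (annE m2) = enat (K q) + of_nat (s (Suc q)) * E.len (annE m)"
      using len_hom[OF Es Es \<delta> sub] by (simp only: K \<delta>_image[OF ex] len_Es[OF E1] len_Es[OF E2])
    moreover obtain l where l: "E.len (annE m2) = enat l" "a + l = L"
      using len_annE[OF submodule_m2] L a by (cases "E.len (annE m2)") auto
    ultimately have "s q * l = K q + s (Suc q)"
      by (simp add: len_socE of_nat_eq_enat)
    then show "s q * L = K q + s (Suc q) + s q * a" using l(2) by (auto simp: algebra_simps)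
  qed
qed

text \<open>The counterpart over R: m R^(s q) contains the kernel and maps onto m^2 R^(s (q+1)).
  Here even the count for the whole term rests on \<open>exactR\<close>, whereas over E the complex
  is exact by construction.\<close>

lemma kernel_lengths_R:
  obtains K where "\<And>q. rel_length R (Rs (s q)) {\<zero>\<^bsub>Rs (s q)\<^esub>} (kerR q) = enat (K q)"
    "\<And>q L. S.len (carrier R) = enat L \<Longrightarrow> exactR q \<Longrightarrow> K q + K (Suc q) = s q * L"
    "\<And>q l a. S.len m = enat l \<Longrightarrow> S.len m2 = enat a \<Longrightarrow> exactR q \<Longrightarrow> s q * l = K q + s (Suc q) * a"
proof -
  have kerR: "submodule (kerR q) R (Rs (s q))" for q by (rule submodule_kernel[OF Rs Rs \<rho>])
  have carR: "submodule (carrier (Rs k)) R (Rs k)" for k by (rule module.carrier_is_submodule[OF Rs])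
  have le: "rel_length R (Rs (s q)) {\<zero>\<^bsub>Rs (s q)\<^esub>} (kerR q) \<le> rel_length R (Rs (s q)) {\<zero>\<^bsub>Rs (s q)\<^esub>} (carrier (Rs (s q)))" for q
    by (rule module.len_mono[OF Rs kerR carR module.submoduleE(1)[OF Rs kerR]])
  have "\<exists>k. rel_length R (Rs (s q)) {\<zero>\<^bsub>Rs (s q)\<^esub>} (kerR q) = enat k" for q
  proof -
    obtain n where "rel_length R (Rs (s q)) {\<zero>\<^bsub>Rs (s q)\<^esub>} (carrier (Rs (s q))) = enat n"
      using free_module_finite_length[OF R.is_cring, of "s q"] fin_length by auto
    then show ?thesis using le[of q] enat_ile by metis
  qed
  then obtain K where K: "\<And>q. rel_length R (Rs (s q)) {\<zero>\<^bsub>Rs (s q)\<^esub>} (kerR q) = enat (K q)" by metis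
  have cR: "submodule (carrier R) R (self_module R)" using S.carrier_is_submodule by simp
  show ?thesis
  proof (rule that[OF K])
    fix q L assume L: "S.len (carrier R) = enat L" and ex: "exactR q"
    have "carrier (Rs (s q)) \<inter> kerR q = kerR q" by (auto simp: rmod_kernel_def)
    moreover have "\<rho> q ` carrier (Rs (s q)) = kerR (Suc q)" using ex \<rho>\<rho> by blast
    ultimately have "rel_length R (Rs (s q)) {\<zero>\<^bsub>Rs (s q)\<^esub>} (carrier (Rs (s q))) = enat (K q) + enat (K (Suc q))"
      using len_hom[OF Rs Rs \<rho> carR, of q] by (simp only: K)
    then show "K q + K (Suc q) = s q * L"
      using len_Rs[OF cR, of "s q"] L by (simp add: of_nat_eq_enat)
  next
    fix q l a assume l: "S.len m = enat l" and a: "S.len m2 = enat a" and ex: "exactR q"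
    have sub: "submodule ({..<s q} \<rightarrow>\<^sub>E m) R (Rs (s q))"
      unfolding free_module_def by (rule submodule_PiE[OF R.is_cring S.module_axioms m_ideal])
    have "({..<s q} \<rightarrow>\<^sub>E m) \<inter> kerR q = kerR q" using kerR_le_m by blast
    then have "of_nat (s q) * S.len m = enat (K q) + of_nat (s (Suc q)) * S.len m2"
      using len_hom[OF Rs Rs \<rho> sub]
      by (simp only: K \<rho>_image[OF ex] len_Rs[OF m_ideal] len_Rs[OF submodule_m2])
    then show "s q * l = K q + s (Suc q) * a" using l a by (simp add: of_nat_eq_enat)
  qed
qed

text \<open>In length 1 any nonzero element would generate the socle. Together with
  \<open>soc_eq_m2\<close> this supplies a \<noteq> 1.\<close>

lemma len_soc_ne_1: "S.len soc \<noteq> 1"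
proof
  assume 1: "S.len soc = 1"
  obtain y where y: "y \<in> soc" "y \<noteq> \<zero>" by (rule soc_nonzero)
  have cy: "submodule (S.cyc y) R (self_module R)" using S.submodule_cyc soc_carrier[OF y(1)] by simp
  have le: "S.cyc y \<subseteq> soc" by (rule S.cyc_least[OF submodule_soc y(1)])
  have "y \<in> S.cyc y" using S.cyc_self soc_carrier[OF y(1)] by simp
  then have "{\<zero>\<^bsub>self_module R\<^esub>} \<subset> S.cyc y" using S.submodule_zero[OF cy] y(2) by auto
  from S.len_strict_mono[OF S.submodule_zero_module cy this fin_length_sub[OF cy]]
  have "0 < S.len (S.cyc y)" by (simp add: S.rel_length_self)
  moreover have "S.len (S.cyc y) < 1"
    using S.len_strict_mono[OF cy submodule_soc _ fin_length_sub[OF submodule_soc]] le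
      soc_not_cyclic[OF y(1)] 1 by (metis psubsetI order_refl)
  ultimately show False by (simp add: one_eSuc)
qed

lemma length_eq:
  assumes ex: "exactR q" "exactR (Suc q)" "exactR (Suc (Suc q))"
    and e: "S.len m = S.len m2 + enat e"
  shows "S.len (carrier R) = 2 * enat e"
proof -
  obtain L where L: "S.len (carrier R) = enat L" using fin_length by auto
  obtain a where a: "S.len m2 = enat a" using fin_length_sub[OF submodule_m2] by auto
  have lm: "S.len m = enat (a + e)" using e a by simp
  \<comment> \<open>The summand 1 is the length of R/m, computed as that of its dual
    \<open>annE m\<close>.\<close>
  have L': "L = a + e + 1" using len_annE[OF m_ideal] L lm len_socE by (simp add: one_enat_def)
  have a1: "a \<noteq> 1" using len_soc_ne_1 soc_eq_m2[OF ex(1)] a by (simp add: one_enat_def)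
  \<comment> \<open>The kernel lengths only mediate: eliminating K at q + 1 and q + 2 leaves the
    recurrences among four consecutive values of s.\<close>
  obtain K where K: "K q + K (Suc q) = s q * L" "K (Suc q) + K (Suc (Suc q)) = s (Suc q) * L"
    "s q * L = K q + s (Suc q) + s q * a"
    "s (Suc q) * L = K (Suc q) + s (Suc (Suc q)) + s (Suc q) * a"
    "s (Suc (Suc q)) * L = K (Suc (Suc q)) + s (Suc (Suc (Suc q))) + s (Suc (Suc q)) * a"
    using L a ex by (rule_tac kernel_lengths_E) blast
  obtain J where J: "J q + J (Suc q) = s q * L" "J (Suc q) + J (Suc (Suc q)) = s (Suc q) * L"
    "s q * (a + e) = J q + s (Suc q) * a"
    "s (Suc q) * (a + e) = J (Suc q) + s (Suc (Suc q)) * a"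
    "s (Suc (Suc q)) * (a + e) = J (Suc (Suc q)) + s (Suc (Suc (Suc q))) * a"
    using L a lm ex by (rule_tac kernel_lengths_R) blast
  define p where "p = int (s q)"
  define u where "u = int (s (Suc q))"
  define r where "r = int (s (Suc (Suc q)))"
  define t where "t = int (s (Suc (Suc (Suc q))))"
  note K' = K[unfolded L', THEN arg_cong[of _ _ int], simplified, folded p_def u_def r_def t_def]
  note J' = J[unfolded L', THEN arg_cong[of _ _ int], simplified, folded p_def u_def r_def t_def]
  have "int e = int a + 1"
  proof (rule double_recurrence[of p u _ _ r t])
    show "p > 0" "u > 0" using s_pos by (simp_all add: p_def u_def)
    show "r = int e * u - int a * p" "t = int e * r - int a * u"
      using K' by (simp_all add: algebra_simps)
    show "int a * r = int e * u - p" "int a * t = int e * r - u"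
      using J' by (simp_all add: algebra_simps)
  qed (use a1 in auto)
  then have "e = a + 1" by simp
  then have "L = 2 * e" using L' by simp
  then show ?thesis using L by (simp add: numeral_eq_enat)
qed

lemma exactR_if:
  assumes *: "\<And>f. f \<in> rmod_hom R E (Es (s (Suc q))) \<Longrightarrow>
      (\<And>x. x \<in> carrier E \<Longrightarrow> \<delta> (Suc q) (f x) = \<zero>\<^bsub>Es (s (Suc (Suc q)))\<^esub>) \<Longrightarrow>
      \<exists>w\<in>rmod_hom R E (Es (s q)). \<forall>x\<in>carrier E. f x = \<delta> q (w x)"
  shows "exactR q"
proof
  fix v assume v: "v \<in> kerR (Suc q)"
  then have vc: "v \<in> carrier (Rs (s (Suc q)))" and v0: "\<rho> (Suc q) v = \<zero>\<^bsub>Rs (s (Suc (Suc q)))\<^esub>"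
    unfolding rmod_kernel_def by blast+
  have "\<exists>w\<in>rmod_hom R E (Es (s q)). \<forall>x\<in>carrier E. act (s (Suc q)) v x = \<delta> q (w x)"
  proof (rule *[OF act_hom[OF vc]])
    fix x assume x: "x \<in> carrier E"
    show "\<delta> (Suc q) (act (s (Suc q)) v x) = \<zero>\<^bsub>Es (s (Suc (Suc q)))\<^esub>"
      unfolding \<rho>\<delta>[OF vc x] v0 by (rule act_zero[OF x])
  qed
  then obtain w where w: "w \<in> rmod_hom R E (Es (s q))" "\<And>x. x \<in> carrier E \<Longrightarrow> act (s (Suc q)) v x = \<delta> q (w x)"
    by blast
  obtain u where u: "u \<in> carrier (Rs (s q))" "\<And>x. x \<in> carrier E \<Longrightarrow> w x = act (s q) u x"
    using hom_eq_act[OF w(1)] by blast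
  have "v = \<rho> q u"
  proof (rule act_eqD[OF vc rmod_homD(1)[OF \<rho> u(1)]])
    fix x assume x: "x \<in> carrier E"
    show "act (s (Suc q)) v x = act (s (Suc q)) (\<rho> q u) x"
      using w(2)[OF x] u(2)[OF x] \<rho>\<delta>[OF u(1) x] by simp
  qed
  then show "v \<in> \<rho> q ` carrier (Rs (s q))" using u(1) by blast
qed

end

section \<open>Generators of the maximal ideal\<close>

lemma (in abelian_group) eq_diff_if_add_eq:
  "a \<in> carrier G \<Longrightarrow> x \<in> carrier G \<Longrightarrow> a \<oplus> x = b \<Longrightarrow> x = b \<ominus> a"
  by (metis a_assoc a_comm a_inv_closed a_minus_def r_neg r_zero)

context cube_zero_ring
begin

text \<open>(V + R x)/V is cyclic and killed by m, hence zero or simple.\<close>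

lemma rel_length_step:
  assumes A: "module R A" and V: "submodule V R A" and x: "x \<in> carrier A"
    and mx: "\<And>c. c \<in> m \<Longrightarrow> c \<odot>\<^bsub>A\<^esub> x \<in> V"
  shows "rel_length R A V (module.submodule_sum A V (module.cyc R A x)) \<le> 1"
proof -
  interpret A: module R A by fact
  let ?W = "A.submodule_sum V (A.cyc x)"
  have cx: "submodule (A.cyc x) R A" by (rule A.submodule_cyc[OF x])
  have up: "V \<subseteq> ?W" using A.submodule_sum_upper[OF V cx] by blast
  have "\<not> enat 2 \<le> rel_length R A V ?W"
  proof
    assume "enat 2 \<le> rel_length R A V ?W"
    then have "length_chain R A V (Suc (Suc 0)) ?W"
      unfolding enat_le_rel_length_iff[OF up] by (simp only: numeral_2_eq_2)
    then obtain D D' where D: "submodule D R A" "D \<subset> ?W" "D' \<subset> D" "V \<subseteq> D'" by auto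
    then obtain y where y: "y \<in> D" "y \<notin> V" by blast
    then obtain v r where vr: "v \<in> V" "r \<in> carrier R" "y = v \<oplus>\<^bsub>A\<^esub> r \<odot>\<^bsub>A\<^esub> x"
      using D(2) unfolding A.submodule_sum_def A.cyc_def by blast
    have "r \<notin> m" using vr y(2) mx A.submoduleD(3)[OF V] by blast
    then obtain t where t: "t \<in> carrier R" "t \<odot>\<^bsub>A\<^esub> (r \<odot>\<^bsub>A\<^esub> x) = x" using unit_cancel[OF A vr(2) _ x] by blast
    have vc: "v \<in> carrier A" by (rule A.submodule_in_carrier[OF V vr(1)])
    have "r \<odot>\<^bsub>A\<^esub> x = y \<ominus>\<^bsub>A\<^esub> v"
      by (rule A.M.eq_diff_if_add_eq) (use vr x vc in simp_all)
    then have "r \<odot>\<^bsub>A\<^esub> x \<in> D" using A.submodule_minus[OF D(1) y(1)] vr(1) D(3,4) by auto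
    then have "x \<in> D" using A.submoduleD(4)[OF D(1) t(1)] t(2) by metis
    then have "?W \<subseteq> D"
      by (intro A.submodule_sum_least[OF D(1)] A.cyc_least[OF D(1)]) (use D(3,4) in auto)
    then show False using D(2) by blast
  qed
  then show ?thesis by (cases "rel_length R A V ?W") (auto simp: one_enat_def)
qed

text \<open>Each generator contributes at most one step. That N is generated is expressed by
  minimality, so that both \<open>generated_submodule\<close> and \<open>Idl\<close> can supply the
  generators.\<close>

lemma rel_length_generated:
  assumes A: "module R A" and U: "submodule U R A" and Gs: "finite Gs" "Gs \<subseteq> carrier A"
    and mX: "\<And>c x. c \<in> m \<Longrightarrow> x \<in> Gs \<Longrightarrow> c \<odot>\<^bsub>A\<^esub> x \<in> U"
    and N: "submodule N R A" "U \<subseteq> N" "Gs \<subseteq> N"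
    and gen: "\<And>K. submodule K R A \<Longrightarrow> U \<subseteq> K \<Longrightarrow> Gs \<subseteq> K \<Longrightarrow> N \<subseteq> K"
  shows "rel_length R A U N \<le> enat (card Gs)"
proof -
  interpret A: module R A by fact
  have "\<exists>W. submodule W R A \<and> U \<subseteq> W \<and> Gs \<subseteq> W \<and> W \<subseteq> N \<and> rel_length R A U W \<le> enat (card Gs)"
    using Gs mX N(3)
  proof (induction Gs rule: finite_induct)
    case empty
    show ?case using U N(2) A.rel_length_self by (intro exI[of _ U]) auto
  next
    case (insert x Gs)
    then obtain W where W: "submodule W R A" "U \<subseteq> W" "Gs \<subseteq> W" "W \<subseteq> N" "rel_length R A U W \<le> enat (card Gs)"
      by auto
    have xc: "x \<in> carrier A" using insert.prems by simp
    let ?W = "A.submodule_sum W (A.cyc x)"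
    have cx: "submodule (A.cyc x) R A" by (rule A.submodule_cyc[OF xc])
    have W': "submodule ?W R A" by (rule A.submodule_sum[OF W(1) cx])
    have up: "W \<subseteq> ?W" "x \<in> ?W"
      using A.submodule_sum_upper[OF W(1) cx] A.cyc_self[OF xc] by blast+
    have "rel_length R A U ?W = rel_length R A U W + rel_length R A W ?W"
      by (rule A.rel_length_add[OF U W(1) W' W(2) up(1)])
    also have "\<dots> \<le> enat (card Gs) + 1"
      by (intro add_mono W(5) rel_length_step[OF A W(1) xc]) (use insert.prems W(2) in auto)
    finally have "rel_length R A U ?W \<le> enat (card (insert x Gs))"
      using insert.hyps by (simp add: one_enat_def)
    moreover have "?W \<subseteq> N"
      using A.submodule_sum_least[OF N(1) W(4) A.cyc_least[OF N(1)]] insert.prems by simp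
    ultimately show ?case using W' W(2,3) up by (intro exI[of _ ?W]) auto
  qed
  then show ?thesis using gen by (metis subset_antisym)
qed

text \<open>Every element chosen outside the current submodule uses up at least one unit of the
  remaining length.\<close>

lemma generators_exist:
  assumes A: "module R A" and N: "submodule N R A" and U: "submodule U R A" "U \<subseteq> N"
    and fin: "rel_length R A U N = enat e"
  shows "\<exists>Gs. finite Gs \<and> Gs \<subseteq> N \<and> card Gs \<le> e \<and> (\<forall>K. submodule K R A \<longrightarrow> U \<subseteq> K \<longrightarrow> Gs \<subseteq> K \<longrightarrow> N \<subseteq> K)"
  using U fin
proof (induction e arbitrary: U rule: less_induct)
  case (less e)
  interpret A: module R A by fact
  show ?case
  proof (cases "U = N")
    case True
    then show ?thesis by (intro exI[of _ "{}"]) auto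
  next
    case False
    then obtain x where x: "x \<in> N" "x \<notin> U" using less.prems(2) by blast
    have xc: "x \<in> carrier A" by (rule A.submodule_in_carrier[OF N x(1)])
    let ?W = "A.submodule_sum U (A.cyc x)"
    have cx: "submodule (A.cyc x) R A" by (rule A.submodule_cyc[OF xc])
    have W: "submodule ?W R A" by (rule A.submodule_sum[OF less.prems(1) cx])
    have WN: "?W \<subseteq> N" by (rule A.submodule_sum_least[OF N less.prems(2) A.cyc_least[OF N x(1)]])
    have up: "U \<subseteq> ?W" "x \<in> ?W"
      using A.submodule_sum_upper[OF less.prems(1) cx] A.cyc_self[OF xc] by blast+
    have sum: "enat e = rel_length R A U ?W + rel_length R A ?W N"
      using A.rel_length_add[OF less.prems(1) W N up(1) WN] less.prems(3) by simp
    have "enat 1 \<le> rel_length R A U ?W"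
      using up x(2) less.prems(1) by (subst enat_le_rel_length_iff) auto
    then obtain k l where kl: "rel_length R A ?W N = enat k" "rel_length R A U ?W = enat l" "l \<ge> 1" "e = l + k"
      using sum by (cases "rel_length R A ?W N"; cases "rel_length R A U ?W") auto
    then have "k < e" by simp
    from less.IH[OF this W WN kl(1)] obtain Gs where Gs: "finite Gs" "Gs \<subseteq> N" "card Gs \<le> k"
      "\<And>K. submodule K R A \<Longrightarrow> ?W \<subseteq> K \<Longrightarrow> Gs \<subseteq> K \<Longrightarrow> N \<subseteq> K" by blast
    show ?thesis
    proof (intro exI[of _ "insert x Gs"] conjI allI impI)
      show "card (insert x Gs) \<le> e" using Gs(1,3) kl(3,4) by (simp add: card_insert_if)
      fix K assume K: "submodule K R A" "U \<subseteq> K" "insert x Gs \<subseteq> K"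
      then have "?W \<subseteq> K" by (intro A.submodule_sum_least A.cyc_least) auto
      then show "N \<subseteq> K" using Gs(4) K by blast
    qed (use Gs(1,2) x(1) in auto)
  qed
qed

lemma submodule_ideal_module_iff:
  "submodule N R (ideal_module R m) \<longleftrightarrow> submodule N R (self_module R) \<and> N \<subseteq> m"
proof -
  let ?I = "(self_module R)\<lparr>carrier := m\<rparr>"
  interpret I: module R ?I by (rule submodule.submodule_is_module[OF m_ideal S.module_axioms])
  show ?thesis unfolding ideal_module_def
  proof
    assume N: "submodule N R ?I"
    have "submodule N R (self_module R)"
    proof (rule S.submoduleI_smult)
      show "N \<subseteq> carrier (self_module R)" using I.submoduleE(1)[OF N] m_carrier by auto
      show "\<zero>\<^bsub>self_module R\<^esub> \<in> N" using I.submodule_zero[OF N] by simp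
      show "a \<oplus>\<^bsub>self_module R\<^esub> b \<in> N" if "a \<in> N" "b \<in> N" for a b
        using I.submoduleD(3)[OF N that] by simp
      show "r \<odot>\<^bsub>self_module R\<^esub> x \<in> N" if "r \<in> carrier R" "x \<in> N" for r x
        using I.submoduleD(4)[OF N that] by simp
    qed
    then show "submodule N R (self_module R) \<and> N \<subseteq> m" using I.submoduleE(1)[OF N] by simp
  next
    assume N: "submodule N R (self_module R) \<and> N \<subseteq> m"
    then have N1: "submodule N R (self_module R)" by simp
    show "submodule N R ?I"
    proof (rule I.submoduleI_smult)
      show "N \<subseteq> carrier ?I" using N by simp
      show "\<zero>\<^bsub>?I\<^esub> \<in> N" using S.submodule_zero[OF N1] by simp
      show "a \<oplus>\<^bsub>?I\<^esub> b \<in> N" if "a \<in> N" "b \<in> N" for a b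
        using S.submoduleD(3)[OF N1 that] by simp
      show "r \<odot>\<^bsub>?I\<^esub> x \<in> N" if "r \<in> carrier R" "x \<in> N" for r x
        using S.submoduleD(4)[OF N1 that] by simp
    qed
  qed
qed

lemma generated_ideal_module_iff:
  assumes Gs: "Gs \<subseteq> m"
  shows "generated_submodule R (ideal_module R m) Gs = m \<longleftrightarrow>
    (\<forall>K. submodule K R (self_module R) \<longrightarrow> K \<subseteq> m \<longrightarrow> Gs \<subseteq> K \<longrightarrow> m \<subseteq> K)"
proof -
  have "generated_submodule R (ideal_module R m) Gs \<subseteq> m"
    unfolding generated_submodule_def submodule_ideal_module_iff using m_ideal Gs by blast
  then show ?thesis
    unfolding generated_submodule_def submodule_ideal_module_iff by blast
qed

text \<open>Nakayama's lemma: \<open>m = K + m\<^sup>2\<close> gives \<open>m\<^sup>2 \<subseteq> m K + m\<^sup>3 \<subseteq> K\<close>.\<close>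

lemma generates_m_if_modulo_m2:
  assumes K: "submodule K R (self_module R)" "K \<subseteq> m"
    and gen: "m \<subseteq> S.submodule_sum K m2"
  shows "m \<subseteq> K"
proof -
  have "m2 \<subseteq> K"
  proof (rule m2_least[OF K(1)])
    fix a b assume ab: "a \<in> m" "b \<in> m"
    obtain k z where kz: "k \<in> K" "z \<in> m2" "a = k \<oplus> z"
      using gen ab(1) unfolding S.submodule_sum_def by auto
    have c: "k \<in> carrier R" "z \<in> carrier R" "b \<in> carrier R"
      using ideal_carrier[OF K(1) kz(1)] ideal_carrier[OF submodule_m2 kz(2)] m_carrier[OF ab(2)] by auto
    have "b \<otimes> z = \<zero>" using m2_le_soc kz(2) soc_mult ab(2) by blast
    moreover have "a \<otimes> b = b \<otimes> a" using c kz(3) by (intro R.m_comm) auto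
    ultimately have "a \<otimes> b = b \<otimes> k" using c kz(3) by (simp add: R.r_distr)
    then show "a \<otimes> b \<in> K" using S.submoduleD(4)[OF K(1) c(3) kz(1)] by simp
  qed
  then have "S.submodule_sum K m2 \<subseteq> K" by (intro S.submodule_sum_least[OF K(1)]) auto
  then show ?thesis using gen by blast
qed

end

section \<open>The number of generators of m as the length of m/m^2\<close>

context cube_zero_local
begin

text \<open>Generators of m also generate m/m^2, which bounds its length from above; conversely
  generators modulo m^2 generate m by Nakayama. On m/m^2, a module over k, length and number of
  generators agree.\<close>

lemma len_m: "S.len m = S.len m2 + enat (min_num_generators R (ideal_module R m))"
proof -
  have zm2: "{\<zero>\<^bsub>self_module R\<^esub>} \<subseteq> m2" using S.submodule_zero[OF submodule_m2] by blast
  have sum: "S.len m = S.len m2 + rel_length R (self_module R) m2 m"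
    by (rule S.rel_length_add[OF S.submodule_zero_module submodule_m2 m_ideal zm2 m2_le_m])
  obtain e where e: "rel_length R (self_module R) m2 m = enat e"
    using sum fin_length_sub[OF m_ideal] by (cases "rel_length R (self_module R) m2 m") auto
  let ?P = "\<lambda>n. \<exists>Gs\<subseteq>carrier (ideal_module R m). finite Gs \<and> card Gs = n \<and>
      generated_submodule R (ideal_module R m) Gs = carrier (ideal_module R m)"
  have car: "carrier (ideal_module R m) = m" by (simp add: ideal_module_def)
  have lower: "e \<le> n" if Gs: "Gs \<subseteq> m" "finite Gs" "card Gs = n"
      "generated_submodule R (ideal_module R m) Gs = m" for n Gs
  proof -
    note gen = Gs(4)[unfolded generated_ideal_module_iff[OF Gs(1)], rule_format]
    have "rel_length R (self_module R) m2 m \<le> enat (card Gs)"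
    proof (rule rel_length_generated[OF S.module_axioms submodule_m2 Gs(2) _ _ m_ideal m2_le_m Gs(1)])
      show "Gs \<subseteq> carrier (self_module R)" using Gs(1) m_carrier by auto
      show "c \<odot>\<^bsub>self_module R\<^esub> x \<in> m2" if "c \<in> m" "x \<in> Gs" for c x
        using m2_mult[OF that(1), of x] that(2) Gs(1) by auto
      fix K assume K: "submodule K R (self_module R)" "Gs \<subseteq> K"
      have "m \<subseteq> K \<inter> m"
        by (rule gen[OF S.submodule_Int[OF K(1) m_ideal]]) (use K Gs(1) in auto)
      then show "m \<subseteq> K" by blast
    qed
    then show ?thesis using e Gs(3) by simp
  qed
  obtain Gs where Gs: "finite Gs" "Gs \<subseteq> m" "card Gs \<le> e"
    "\<And>K. submodule K R (self_module R) \<Longrightarrow> m2 \<subseteq> K \<Longrightarrow> Gs \<subseteq> K \<Longrightarrow> m \<subseteq> K"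
    using generators_exist[OF S.module_axioms m_ideal submodule_m2 m2_le_m e] by blast
  have "?P (card Gs)"
    unfolding car
  proof (intro exI[of _ Gs] conjI Gs(1,2) refl)
    show "generated_submodule R (ideal_module R m) Gs = m"
      unfolding generated_ideal_module_iff[OF Gs(2)]
    proof (intro allI impI)
      fix K assume K: "submodule K R (self_module R)" "K \<subseteq> m" "Gs \<subseteq> K"
      show "m \<subseteq> K"
      proof (rule generates_m_if_modulo_m2[OF K(1,2)])
        show "m \<subseteq> S.submodule_sum K m2"
          using S.submodule_sum_upper[OF K(1) submodule_m2] K(3)
          by (intro Gs(4) S.submodule_sum K(1) submodule_m2) auto
      qed
    qed
  qed
  then have "?P (min_num_generators R (ideal_module R m))" "min_num_generators R (ideal_module R m) \<le> card Gs"
    unfolding min_num_generators_def by (rule LeastI[of ?P] Least_le[of ?P])+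
  moreover from this(1) have "e \<le> min_num_generators R (ideal_module R m)"
    unfolding car by (elim exE conjE) (rule lower)
  ultimately have "min_num_generators R (ideal_module R m) = e" using Gs(3) by simp
  then show ?thesis using sum e by simp
qed

end

section \<open>Noetherian local rings with \<open>m\<^sup>3 = 0\<close>\<close>

lemma (in cring) submodule_self_if_ideal:
  assumes "ideal I R"
  shows "submodule I R (self_module R)"
proof -
  interpret S: module R "self_module R" by (rule module_self_module) (rule is_cring)
  interpret ideal I R by fact
  show ?thesis by (rule S.submoduleI_smult) (auto simp: a_closed I_l_closed)
qed

lemma (in cring) ideal_if_submodule_self:
  assumes I: "submodule I R (self_module R)"
  shows "ideal I R"
proof -
  interpret S: module R "self_module R" by (rule module_self_module) (rule is_cring)
  have c: "x \<in> carrier R" if "x \<in> I" for x using S.submodule_in_carrier[OF I that] by simp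
  have sm: "r \<otimes> x \<in> I" if "r \<in> carrier R" "x \<in> I" for r x using S.submoduleD(4)[OF I that] by simp
  have "subgroup I (add_monoid R)"
  proof (rule subgroup.intro)
    show "I \<subseteq> carrier (add_monoid R)" using c by auto
    show "a \<otimes>\<^bsub>add_monoid R\<^esub> b \<in> I" if "a \<in> I" "b \<in> I" for a b
      using S.submoduleD(3)[OF I that] by simp
    show "\<one>\<^bsub>add_monoid R\<^esub> \<in> I" using S.submodule_zero[OF I] by simp
    show "inv\<^bsub>add_monoid R\<^esub> a \<in> I" if "a \<in> I" for a
      using sm[OF _ that, of "\<ominus> \<one>"] c[OF that] by (simp add: l_minus a_inv_def[symmetric])
  qed
  then show ?thesis
  proof (rule idealI[OF ring_axioms])
    fix a x assume "a \<in> I" "x \<in> carrier R"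
    then show "x \<otimes> a \<in> I" "a \<otimes> x \<in> I"
      using sm[of x a] m_comm[of a x] c[of a] by simp_all
  qed
qed

text \<open>For r outside m, maximality gives 1 = c + t r with c in m, and 1 - c is invertible
  because c is nilpotent. Finite length comes from the filtration of R by m and m^2.\<close>

lemma cube_zero_local_if_noetherian:
  fixes R (structure)
  assumes R: "noetherian_local_ring R m" and cube: "m \<cdot>\<^bsub>R\<^esub> m \<cdot>\<^bsub>R\<^esub> m = {\<zero>\<^bsub>R\<^esub>}"
  shows "cube_zero_local R m"
proof -
  interpret R: cring R using R by (simp add: noetherian_local_ring_def)
  interpret noeth: noetherian_ring R using R by (simp add: noetherian_local_ring_def)
  interpret max: maximalideal m R using R by (simp add: noetherian_local_ring_def)
  interpret S: module R "self_module R" by (rule module_self_module) (rule R.is_cring)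
  have m: "submodule m R (self_module R)" by (rule R.submodule_self_if_ideal[OF max.is_ideal])
  have cube': "a \<otimes> b \<otimes> c = \<zero>" if "a \<in> m" "b \<in> m" "c \<in> m" for a b c
    using ideal_prod.prod[OF ideal_prod.prod[OF that(1,2), of R] that(3), of R] cube by simp
  have one: "\<one> \<notin> m" using max.I_notcarr max.one_imp_carrier by blast
  have unit: "\<exists>s\<in>carrier R. s \<otimes> r = \<one>" if r: "r \<in> carrier R" "r \<notin> m" for r
  proof -
    have rc: "submodule (S.cyc r) R (self_module R)" using S.submodule_cyc r(1) by simp
    let ?J = "S.submodule_sum m (S.cyc r)"
    have J: "submodule ?J R (self_module R)" by (rule S.submodule_sum[OF m rc])
    have "m \<subseteq> ?J" "r \<in> ?J"
      using S.submodule_sum_upper[OF m rc] S.cyc_self r(1) by auto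
    then have "?J = carrier R"
      using max.I_maximal[OF R.ideal_if_submodule_self[OF J]] S.submoduleE(1)[OF J] r(2) by auto
    then have "\<one> \<in> ?J" by simp
    then obtain c t where ct: "c \<in> m" "t \<in> carrier R" "\<one> = c \<oplus> t \<otimes> r"
      by (auto simp: S.submodule_sum_def S.cyc_def)
    have c: "c \<in> carrier R" using max.Icarr[OF ct(1)] .
    have tr: "t \<otimes> r = \<one> \<ominus> c"
      by (rule R.eq_diff_if_add_eq) (use ct(2,3) c r(1) in simp_all)
    have c3: "c \<otimes> c \<otimes> c = \<zero>" by (rule cube'[OF ct(1) ct(1) ct(1)])
    \<comment> \<open>The geometric series 1 + c + c^2 inverts 1 - c, as c^3 = 0.\<close>
    have "((\<one> \<oplus> c \<oplus> c \<otimes> c) \<otimes> t) \<otimes> r = (\<one> \<oplus> c \<oplus> c \<otimes> c) \<otimes> (\<one> \<ominus> c)"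
      using ct(2) r(1) c tr by (simp add: R.m_assoc)
    also have "\<dots> = (\<one> \<oplus> c \<oplus> c \<otimes> c) \<ominus> (\<one> \<oplus> c \<oplus> c \<otimes> c) \<otimes> c"
      using c by (simp add: a_minus_def R.r_distr R.r_minus)
    also have "(\<one> \<oplus> c \<oplus> c \<otimes> c) \<otimes> c = c \<oplus> c \<otimes> c"
      using c c3 by (simp add: R.l_distr)
    also have "(\<one> \<oplus> c \<oplus> c \<otimes> c) \<ominus> (c \<oplus> c \<otimes> c) = \<one>"
      using c by (simp only: a_minus_def R.a_assoc R.r_neg R.r_zero R.one_closed R.m_closed R.a_closed
          R.a_inv_closed)
    finally show ?thesis using ct(2) c by (intro bexI[of _ "(\<one> \<oplus> c \<oplus> c \<otimes> c) \<otimes> t"]) auto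
  qed
  interpret cube_zero_ring R m
    by (intro cube_zero_ring.intro cube_zero_ring_axioms.intro R.is_cring m one unit cube')
  have gens: "\<exists>Gs. finite Gs \<and> Gs \<subseteq> J \<and> (\<forall>K. submodule K R (self_module R) \<longrightarrow> Gs \<subseteq> K \<longrightarrow> J \<subseteq> K)"
    if J: "submodule J R (self_module R)" for J
  proof -
    obtain Gs where Gs: "Gs \<subseteq> carrier R" "finite Gs" "J = Idl Gs"
      using noeth.finetely_gen[OF R.ideal_if_submodule_self[OF J]] by blast
    show ?thesis
    proof (intro exI[of _ Gs] conjI allI impI)
      show "Gs \<subseteq> J" unfolding Gs(3) by (rule R.genideal_self[OF Gs(1)])
      fix K assume "submodule K R (self_module R)" "Gs \<subseteq> K"
      then show "J \<subseteq> K"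
        unfolding Gs(3) by (intro R.genideal_minimal R.ideal_if_submodule_self)
    qed (rule Gs(2))
  qed
  \<comment> \<open>A layer N/U killed by m has length at most the number of generators of N, and
    that number is finite as R is Noetherian.\<close>
  have fin: "rel_length R (self_module R) U N \<noteq> \<infinity>"
    if U: "submodule U R (self_module R)" and N: "submodule N R (self_module R)" "U \<subseteq> N"
      and mN: "\<And>c x. c \<in> m \<Longrightarrow> x \<in> N \<Longrightarrow> c \<otimes> x \<in> U" for U N
  proof -
    obtain Gs where Gs: "finite Gs" "Gs \<subseteq> N" "\<And>K. submodule K R (self_module R) \<Longrightarrow> Gs \<subseteq> K \<Longrightarrow> N \<subseteq> K"
      using gens[OF N(1)] by blast
    have "rel_length R (self_module R) U N \<le> enat (card Gs)"
      by (rule rel_length_generated[OF S.module_axioms U Gs(1) _ _ N Gs(2) Gs(3)])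
        (use S.submoduleE(1)[OF N(1)] Gs(2) mN in auto)
    then show ?thesis using enat_ile by fastforce
  qed
  have c: "submodule (carrier R) R (self_module R)" using S.carrier_is_submodule by simp
  have z: "submodule {\<zero>} R (self_module R)" using S.submodule_zero_module by simp
  have sub: "{\<zero>} \<subseteq> m2" "m \<subseteq> carrier R" using S.submodule_zero[OF submodule_m2] m_carrier by auto
  have "rel_length R (self_module R) {\<zero>} (carrier R) =
      rel_length R (self_module R) {\<zero>} m2 + (rel_length R (self_module R) m2 m + rel_length R (self_module R) m (carrier R))"
    using S.rel_length_add[OF z submodule_m2 c sub(1)] S.rel_length_add[OF submodule_m2 m_ideal c m2_le_m sub(2)]
      sub m2_le_m by auto
  moreover have "rel_length R (self_module R) {\<zero>} m2 \<noteq> \<infinity>"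
    by (rule fin[OF z submodule_m2 sub(1)]) (use m2_le_soc soc_mult in auto)
  moreover have "rel_length R (self_module R) m2 m \<noteq> \<infinity>"
    by (rule fin[OF submodule_m2 m_ideal m2_le_m m2_mult])
  moreover have "rel_length R (self_module R) m (carrier R) \<noteq> \<infinity>"
    by (rule fin[OF m_ideal c sub(2)]) (simp add: max.I_r_closed)
  ultimately have "rel_length R (self_module R) {\<zero>} (carrier R) \<noteq> \<infinity>"
    by (simp add: plus_eq_infty_iff_enat)
  then show ?thesis
    by (intro cube_zero_local.intro cube_zero_local_axioms.intro cube_zero_ring_axioms)
qed

section \<open>The residue field, its injective hull and its syzygies\<close>

context cube_zero_local
begin

lemma residue_coset:
  assumes t: "t \<in> carrier R"
  shows "m +>\<^bsub>self_module R\<^esub> t \<in> carrier (residue_field_module R m)"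
  using t unfolding residue_field_module_def quotient_module_def by (auto simp: A_RCOSETS_def')

lemma coset_mem: "x \<in> m +>\<^bsub>self_module R\<^esub> t \<longleftrightarrow> (\<exists>c\<in>m. x = c \<oplus> t)"
  unfolding a_r_coset_def' by auto

lemma coset_add_m:
  assumes c: "c \<in> m" and t: "t \<in> carrier R"
  shows "m +>\<^bsub>self_module R\<^esub> (c \<oplus> t) = m +>\<^bsub>self_module R\<^esub> t"
proof (intro equalityI subsetI)
  note cc = m_carrier[OF c]
  have add: "a \<oplus> b \<in> m" if "a \<in> m" "b \<in> m" for a b using S.submoduleD(3)[OF m_ideal that] by simp
  fix x assume "x \<in> m +>\<^bsub>self_module R\<^esub> (c \<oplus> t)"
  then obtain a where "a \<in> m" "x = a \<oplus> (c \<oplus> t)" unfolding coset_mem by blast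
  then have "x = (a \<oplus> c) \<oplus> t" "a \<oplus> c \<in> m" using cc t m_carrier add c by (auto simp: R.a_assoc)
  then show "x \<in> m +>\<^bsub>self_module R\<^esub> t" unfolding coset_mem by blast
next
  note cc = m_carrier[OF c]
  fix x assume "x \<in> m +>\<^bsub>self_module R\<^esub> t"
  then obtain a where a: "a \<in> m" "x = a \<oplus> t" unfolding coset_mem by blast
  have "\<ominus> c \<in> m" using m_mult[of "\<ominus> \<one>" c] c cc by (simp add: R.l_minus)
  then have "a \<oplus> \<ominus> c \<in> m" using S.submoduleD(3)[OF m_ideal a(1)] by simp
  moreover have "x = (a \<oplus> \<ominus> c) \<oplus> (c \<oplus> t)"
    using a m_carrier[OF a(1)] cc t by (simp add: R.a_assoc R.r_neg1)
  ultimately show "x \<in> m +>\<^bsub>self_module R\<^esub> (c \<oplus> t)" unfolding coset_mem by blast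
qed

text \<open>Scalar multiplication on a quotient is a union over all representatives; it collapses to
  one coset because r m lies in m.\<close>

lemma residue_smult:
  assumes r: "r \<in> carrier R" and t: "t \<in> carrier R"
  shows "r \<odot>\<^bsub>residue_field_module R m\<^esub> (m +>\<^bsub>self_module R\<^esub> t) = m +>\<^bsub>self_module R\<^esub> (r \<otimes> t)"
proof -
  have "m +>\<^bsub>self_module R\<^esub> (r \<otimes> (c \<oplus> t)) = m +>\<^bsub>self_module R\<^esub> (r \<otimes> t)" if c: "c \<in> m" for c
    using coset_add_m[OF m_mult[OF r c], of "r \<otimes> t"] r t m_carrier[OF c] by (simp add: R.r_distr)
  then have "(\<Union>x\<in>m +>\<^bsub>self_module R\<^esub> t. m +>\<^bsub>self_module R\<^esub> (r \<otimes> x)) =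
      (\<Union>x\<in>m +>\<^bsub>self_module R\<^esub> t. m +>\<^bsub>self_module R\<^esub> (r \<otimes> t))"
    unfolding coset_mem by (intro SUP_cong refl) (auto simp: coset_mem)
  also have "\<dots> = m +>\<^bsub>self_module R\<^esub> (r \<otimes> t)"
    using S.submodule_zero[OF m_ideal] coset_mem[of _ t] by auto
  finally show ?thesis by (simp add: residue_field_module_def quotient_module_def)
qed

lemma residue_carrierE:
  assumes "x \<in> carrier (residue_field_module R m)"
  obtains t where "t \<in> carrier R" "x = m +>\<^bsub>self_module R\<^esub> t"
  using assms unfolding residue_field_module_def quotient_module_def A_RCOSETS_def' by auto

lemma coset_eq_m_iff:
  assumes t: "t \<in> carrier R"
  shows "m +>\<^bsub>self_module R\<^esub> t = m \<longleftrightarrow> t \<in> m"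
proof
  assume "m +>\<^bsub>self_module R\<^esub> t = m"
  moreover have "t \<in> m +>\<^bsub>self_module R\<^esub> t"
    unfolding coset_mem using S.submodule_zero[OF m_ideal] t by (intro bexI[of _ \<zero>]) auto
  ultimately show "t \<in> m" by blast
next
  assume tm: "t \<in> m"
  have "m +>\<^bsub>self_module R\<^esub> t = m +>\<^bsub>self_module R\<^esub> \<zero>"
    using coset_add_m[OF tm R.zero_closed] t by simp
  also have "\<dots> = m" using m_carrier by (auto simp: coset_mem intro: bexI[rotated])
  finally show "m +>\<^bsub>self_module R\<^esub> t = m" .
qed

text \<open>The zero coset is written as the scalar 0 times a coset, which avoids proving first that
  the quotient is a module.\<close>

lemma residue_hom_zero:
  assumes B: "module R B" and f: "f \<in> rmod_hom R (residue_field_module R m) B" and t: "t \<in> m"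
  shows "f (m +>\<^bsub>self_module R\<^esub> t) = \<zero>\<^bsub>B\<^esub>"
proof -
  interpret B: module R B by fact
  have c: "m +>\<^bsub>self_module R\<^esub> \<zero> \<in> carrier (residue_field_module R m)" by (rule residue_coset) simp
  have "f (\<zero> \<odot>\<^bsub>residue_field_module R m\<^esub> (m +>\<^bsub>self_module R\<^esub> \<zero>)) = \<zero>\<^bsub>B\<^esub>"
    using rmod_homD(3)[OF f R.zero_closed c] rmod_homD(1)[OF f c] by simp
  moreover have "\<zero> \<odot>\<^bsub>residue_field_module R m\<^esub> (m +>\<^bsub>self_module R\<^esub> \<zero>) = m"
    using residue_smult[of \<zero> \<zero>] coset_eq_m_iff[of \<zero>] S.submodule_zero[OF m_ideal] by simp
  ultimately show ?thesis using coset_eq_m_iff[OF m_carrier[OF t]] t by simp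
qed

text \<open>x0 is the image of the class of 1. If m kills a nonzero x, essentiality gives r x = t x0
  nonzero; then r is outside m, hence a unit, and x is a multiple of x0.\<close>

lemma injective_hull_matlis:
  assumes hull: "injective_hull R (residue_field_module R m) E"
  obtains x0 where "cube_zero_matlis R m E x0"
proof -
  let ?k = "residue_field_module R m"
  have inj: "injective_module R E" using hull by (simp add: injective_hull_def)
  then interpret E: module R E by (simp add: injective_module_def)
  obtain \<iota> where \<iota>: "\<iota> \<in> rmod_hom R ?k E" "inj_on \<iota> (carrier ?k)"
    "\<And>L. submodule L R E \<Longrightarrow> L \<noteq> {\<zero>\<^bsub>E\<^esub>} \<Longrightarrow> L \<inter> \<iota> ` carrier ?k \<noteq> {\<zero>\<^bsub>E\<^esub>}"
    using hull unfolding injective_hull_def by blast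
  let ?q = "\<lambda>t. m +>\<^bsub>self_module R\<^esub> t"
  define x0 where "x0 = \<iota> (?q \<one>)"
  have x0c: "x0 \<in> carrier E" unfolding x0_def by (rule rmod_homD(1)[OF \<iota>(1) residue_coset]) simp
  have \<iota>q: "\<iota> (?q t) = t \<odot>\<^bsub>E\<^esub> x0" if t: "t \<in> carrier R" for t
    using rmod_homD(3)[OF \<iota>(1) t residue_coset[OF R.one_closed]] residue_smult[OF t R.one_closed] t
    by (simp add: x0_def)
  have "cube_zero_matlis R m E x0"
  proof (intro cube_zero_matlis.intro cube_zero_local_axioms cube_zero_matlis_axioms.intro)
    show "injective_module R E" by (rule inj)
    show "x0 \<in> carrier E" by (rule x0c)
    have m0: "\<zero> \<in> m" using S.submodule_zero[OF m_ideal] by simp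
    show "x0 \<noteq> \<zero>\<^bsub>E\<^esub>"
    proof
      assume "x0 = \<zero>\<^bsub>E\<^esub>"
      then have "\<iota> (?q \<one>) = \<iota> (?q \<zero>)"
        using residue_hom_zero[OF E.module_axioms \<iota>(1) m0] by (simp add: x0_def)
      then have "?q \<one> = ?q \<zero>" using inj_onD[OF \<iota>(2)] residue_coset by blast
      then show False using coset_eq_m_iff[of \<zero>] coset_eq_m_iff[of \<one>] m0 one_notin by simp
    qed
    show "c \<odot>\<^bsub>E\<^esub> x0 = \<zero>\<^bsub>E\<^esub>" if c: "c \<in> m" for c
      using residue_hom_zero[OF E.module_axioms \<iota>(1) c] \<iota>q[OF m_carrier[OF c]] by simp
    fix x assume x: "x \<in> carrier E" and mx: "\<And>c. c \<in> m \<Longrightarrow> c \<odot>\<^bsub>E\<^esub> x = \<zero>\<^bsub>E\<^esub>"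
    show "x \<in> {r \<odot>\<^bsub>E\<^esub> x0 |r. r \<in> carrier R}"
    proof (cases "x = \<zero>\<^bsub>E\<^esub>")
      case True
      then show ?thesis using x0c by (intro CollectI exI[of _ \<zero>]) simp
    next
      case False
      have cyc: "submodule (E.cyc x) R E" by (rule E.submodule_cyc[OF x])
      have "E.cyc x \<noteq> {\<zero>\<^bsub>E\<^esub>}" using E.cyc_self[OF x] False by blast
      from \<iota>(3)[OF cyc this] have "E.cyc x \<inter> \<iota> ` carrier ?k \<noteq> {\<zero>\<^bsub>E\<^esub>}" .
      moreover have "\<zero>\<^bsub>E\<^esub> \<in> E.cyc x \<inter> \<iota> ` carrier ?k"
        using E.submodule_zero[OF cyc] residue_hom_zero[OF E.module_axioms \<iota>(1) m0] residue_coset[OF R.zero_closed]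
        by (metis IntI imageI)
      ultimately obtain y where y: "y \<in> E.cyc x" "y \<in> \<iota> ` carrier ?k" "y \<noteq> \<zero>\<^bsub>E\<^esub>" by blast
      obtain r where r: "r \<in> carrier R" "y = r \<odot>\<^bsub>E\<^esub> x" using y(1) by (auto simp: E.cyc_def)
      obtain k where k: "k \<in> carrier ?k" "y = \<iota> k" using y(2) by blast
      obtain t where t: "t \<in> carrier R" "k = ?q t" using residue_carrierE[OF k(1)] .
      have yt: "y = t \<odot>\<^bsub>E\<^esub> x0" using k(2) t \<iota>q by simp
      have "r \<notin> m" using r y(3) mx by blast
      from unit_cancel[OF E.module_axioms r(1) this x] obtain u where u: "u \<in> carrier R" "u \<odot>\<^bsub>E\<^esub> (r \<odot>\<^bsub>E\<^esub> x) = x" .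
      then have "x = (u \<otimes> t) \<odot>\<^bsub>E\<^esub> x0" using yt r t x0c by (simp add: E.smult_assoc1)
      then show ?thesis using u(1) t(1) by blast
    qed
  qed
  then show ?thesis by (rule that)
qed

text \<open>For n = 0 the module is a copy of k, killed by m and so by the socle. For n > 0
  minimality of the resolution embeds it into tuples with entries in m, and the socle times m is
  zero.\<close>

lemma syzygy_finite_length_soc:
  assumes syz: "is_syzygy R m (residue_field_module R m) n Y" and soc_m: "soc \<subseteq> m"
  shows "module R Y" and "rel_length R Y {\<zero>\<^bsub>Y\<^esub>} (carrier Y) \<noteq> \<infinity>"
    and "\<And>y x. y \<in> soc \<Longrightarrow> x \<in> carrier Y \<Longrightarrow> y \<odot>\<^bsub>Y\<^esub> x = \<zero>\<^bsub>Y\<^esub>"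
proof -
  show Y: "module R Y" using syz by (simp add: is_syzygy_def)
  interpret Y: module R Y by (rule Y)
  have "Y.len (carrier Y) \<noteq> \<infinity> \<and> (\<forall>y\<in>soc. \<forall>x\<in>carrier Y. y \<odot>\<^bsub>Y\<^esub> x = \<zero>\<^bsub>Y\<^esub>)"
  proof (cases n)
    case 0
    let ?k = "residue_field_module R m"
    let ?q = "\<lambda>t. m +>\<^bsub>self_module R\<^esub> t"
    obtain f where f: "f \<in> rmod_hom R Y ?k" "bij_betw f (carrier Y) (carrier ?k)"
      using syz 0 by (auto simp: is_syzygy_def rmod_isomorphic_def)
    have injf: "x = y" if "x \<in> carrier Y" "y \<in> carrier Y" "f x = f y" for x y
      using inj_onD[OF bij_betw_imp_inj_on[OF f(2)]] that by blast
    have "?q \<one> \<in> f ` carrier Y"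
      unfolding bij_betw_imp_surj_on[OF f(2)] by (rule residue_coset) simp
    then obtain y0 where y0: "y0 \<in> carrier Y" "f y0 = ?q \<one>" by force
    have fr: "f (r \<odot>\<^bsub>Y\<^esub> y0) = ?q r" if r: "r \<in> carrier R" for r
      using rmod_homD(3)[OF f(1) r y0(1)] y0(2) residue_smult[OF r R.one_closed] r by simp
    have gen: "\<exists>r\<in>carrier R. y = r \<odot>\<^bsub>Y\<^esub> y0" if y: "y \<in> carrier Y" for y
    proof -
      obtain r where r: "r \<in> carrier R" "f y = ?q r"
        using residue_carrierE[OF rmod_homD(1)[OF f(1) y]] .
      then have "y = r \<odot>\<^bsub>Y\<^esub> y0" using injf[OF y] fr[OF r(1)] y0(1) by simp
      then show ?thesis using r(1) by blast
    qed
    have m0: "\<zero> \<in> m" using S.submodule_zero[OF m_ideal] by simp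
    have kill: "c \<odot>\<^bsub>Y\<^esub> y0 = \<zero>\<^bsub>Y\<^esub>" if c: "c \<in> m" for c
    proof (rule injf)
      have "f (c \<odot>\<^bsub>Y\<^esub> y0) = f (\<zero> \<odot>\<^bsub>Y\<^esub> y0)"
        unfolding fr[OF m_carrier[OF c]] fr[OF R.zero_closed]
        using coset_eq_m_iff[OF m_carrier[OF c]] coset_eq_m_iff[OF R.zero_closed] c m0 by simp
      then show "f (c \<odot>\<^bsub>Y\<^esub> y0) = f \<zero>\<^bsub>Y\<^esub>" using y0(1) by simp
    qed (use m_carrier[OF c] y0(1) in auto)
    have g: "(\<lambda>r. r \<odot>\<^bsub>Y\<^esub> y0) \<in> rmod_hom R (self_module R) Y"
      by (rule rmod_homI) (use y0(1) in \<open>auto simp: Y.smult_l_distr Y.smult_assoc1\<close>)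
    have im: "(\<lambda>r. r \<odot>\<^bsub>Y\<^esub> y0) ` carrier (self_module R) = carrier Y" using gen y0(1) by auto
    have "S.len (carrier (self_module R)) =
        S.len (carrier (self_module R) \<inter> rmod_kernel (self_module R) Y (\<lambda>r. r \<odot>\<^bsub>Y\<^esub> y0)) + Y.len (carrier Y)"
      using len_hom[OF S.module_axioms Y g S.carrier_is_submodule] unfolding im .
    then have "Y.len (carrier Y) \<noteq> \<infinity>"
      using fin_length' by (simp add: plus_eq_infty_iff_enat)
    moreover have "y \<odot>\<^bsub>Y\<^esub> x = \<zero>\<^bsub>Y\<^esub>" if y: "y \<in> soc" and x: "x \<in> carrier Y" for y x
    proof -
      obtain r where r: "r \<in> carrier R" "x = r \<odot>\<^bsub>Y\<^esub> y0" using gen[OF x] by blast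
      have "y \<in> m" using soc_m y by blast
      then show ?thesis using Y.smult_swap[OF soc_carrier[OF y] r(1) y0(1)] kill r by simp
    qed
    ultimately show ?thesis by blast
  next
    case (Suc i)
    obtain b \<epsilon> d f where res: "minimal_free_resolution R m (residue_field_module R m) b \<epsilon> d"
      and f: "f \<in> rmod_hom R Y ((free_module R (b i))\<lparr>carrier := d i ` carrier (free_module R (b (Suc i)))\<rparr>)"
        "bij_betw f (carrier Y) (d i ` carrier (free_module R (b (Suc i))))"
      using syz Suc by (auto simp: is_syzygy_def rmod_isomorphic_def simp del: free_module_simps)
    let ?F = "free_module R (b i)"
    interpret F: module R ?F by (rule module_free_module[OF R.is_cring])
    have entries: "f x \<in> {..<b i} \<rightarrow>\<^sub>E m" if "x \<in> carrier Y" for x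
      using res bij_betw_apply[OF f(2) that] unfolding minimal_free_resolution_def by blast
    have f': "f \<in> rmod_hom R Y ?F"
    proof (rule rmod_homI)
      show "f x \<in> carrier ?F" if "x \<in> carrier Y" for x
        using entries[OF that] m_carrier by (auto simp: PiE_iff)
    qed (use rmod_homD(2,3)[OF f(1)] in \<open>simp_all del: free_module_simps\<close>)
    have injf: "x = y" if "x \<in> carrier Y" "y \<in> carrier Y" "f x = f y" for x y
      using inj_onD[OF bij_betw_imp_inj_on[OF f(2)]] that by blast
    have f0: "f \<zero>\<^bsub>Y\<^esub> = \<zero>\<^bsub>?F\<^esub>" by (rule rmod_hom_zero[OF Y F.module_axioms f'])
    have "carrier Y \<inter> rmod_kernel Y ?F f \<subseteq> {\<zero>\<^bsub>Y\<^esub>}"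
    proof
      fix x assume "x \<in> carrier Y \<inter> rmod_kernel Y ?F f"
      then have "x \<in> carrier Y" "f x = f \<zero>\<^bsub>Y\<^esub>" unfolding rmod_kernel_def f0 by blast+
      then show "x \<in> {\<zero>\<^bsub>Y\<^esub>}" using injf[of x "\<zero>\<^bsub>Y\<^esub>"] by simp
    qed
    from len_hom_inj[OF Y F.module_axioms f' Y.carrier_is_submodule this]
    have "Y.len (carrier Y) = F.len (f ` carrier Y)" by simp
    also have "\<dots> \<le> F.len (carrier ?F)"
      by (intro F.len_mono F.carrier_is_submodule F.submoduleE(1)
          submodule_image[OF Y F.module_axioms f' Y.carrier_is_submodule])
    finally have le: "Y.len (carrier Y) \<le> F.len (carrier ?F)" .
    have "F.len (carrier ?F) \<noteq> \<infinity>"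
      by (rule free_module_finite_length[OF R.is_cring]) (use fin_length in simp)
    then have "Y.len (carrier Y) \<noteq> \<infinity>" using le by (metis enat_ord_simps(5))
    moreover have "y \<odot>\<^bsub>Y\<^esub> x = \<zero>\<^bsub>Y\<^esub>" if y: "y \<in> soc" and x: "x \<in> carrier Y" for y x
    proof (rule injf)
      note yc = soc_carrier[OF y]
      show "y \<odot>\<^bsub>Y\<^esub> x \<in> carrier Y" using yc x by simp
      have "y \<otimes> f x k = \<zero>" if k: "k < b i" for k
      proof -
        have fm: "f x k \<in> m" using entries[OF x] k by auto
        then show ?thesis using soc_mult[OF y fm] R.m_comm[OF yc m_carrier[OF fm]] by simp
      qed
      then have "y \<odot>\<^bsub>?F\<^esub> f x = \<zero>\<^bsub>?F\<^esub>" by (auto intro!: restrict_ext)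
      then show "f (y \<odot>\<^bsub>Y\<^esub> x) = f \<zero>\<^bsub>Y\<^esub>" unfolding f0 rmod_homD(3)[OF f' yc x] .
    qed simp
    ultimately show ?thesis by blast
  qed
  then show "rel_length R Y {\<zero>\<^bsub>Y\<^esub>} (carrier Y) \<noteq> \<infinity>"
    and "\<And>y x. y \<in> soc \<Longrightarrow> x \<in> carrier Y \<Longrightarrow> y \<odot>\<^bsub>Y\<^esub> x = \<zero>\<^bsub>Y\<^esub>" by blast+
qed

end

lemma sum_enat_not_infinity: "finite A \<Longrightarrow> (\<And>i. i \<in> A \<Longrightarrow> f i \<noteq> (\<infinity> :: enat)) \<Longrightarrow> sum f A \<noteq> \<infinity>"
  by (induction A rule: finite_induct) (auto simp: plus_eq_infty_iff_enat)

section \<open>The Gorenstein case\<close>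

lemma injective_retract:
  assumes A: "module R A" and B: "injective_module R B"
    and u: "u \<in> rmod_hom R A B" and v: "v \<in> rmod_hom R B A"
    and vu: "\<And>x. x \<in> carrier A \<Longrightarrow> v (u x) = x"
  shows "injective_module R A"
  unfolding injective_module_def
proof (intro conjI A allI impI)
  fix C D :: "('a, 'a module_universe) module" and f g
  assume *: "module R C \<and> module R D \<and> f \<in> rmod_hom R C D \<and> inj_on f (carrier C) \<and> g \<in> rmod_hom R C A"
  then have g: "g \<in> rmod_hom R C A" by blast
  have "(\<lambda>x. u (g x)) \<in> rmod_hom R C B" by (rule rmod_hom_comp[OF g u])
  then obtain h where h: "h \<in> rmod_hom R D B" "\<And>x. x \<in> carrier C \<Longrightarrow> h (f x) = u (g x)"
    using B[unfolded injective_module_def, THEN conjunct2, rule_format, of C D f "\<lambda>x. u (g x)"] * by blast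
  show "\<exists>h\<in>rmod_hom R D A. \<forall>x\<in>carrier C. h (f x) = g x"
  proof (intro bexI ballI)
    show "(\<lambda>x. v (h x)) \<in> rmod_hom R D A" by (rule rmod_hom_comp[OF h(1) v])
    show "v (h (f x)) = g x" if "x \<in> carrier C" for x
      using h(2)[OF that] vu[OF rmod_homD(1)[OF g that]] by simp
  qed
qed

text \<open>The resolution has the single nonzero term R. The definition asks for terms in
  \<open>module_universe\<close>, so R is transported there along r -> the singleton of the constant
  sequence r, and the zero terms are the zero submodule of that copy.\<close>

lemma finite_injective_dimension_if_injective:
  assumes R: "cring R" and inj: "injective_module R (self_module R)"
  shows "finite_injective_dimension R (self_module R)"
proof -
  have S: "module R (self_module R)" by (rule module_self_module[OF R])
  let ?h = "\<lambda>r. {\<lambda>_::nat. r}"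
  have hinj: "inj_on ?h (carrier (self_module R))" by (auto simp: inj_on_def fun_eq_iff)
  obtain I0 :: "('a, 'a module_universe) module" where I0: "module R I0"
    "?h \<in> rmod_hom R (self_module R) I0"
    "the_inv_into (carrier (self_module R)) ?h \<in> rmod_hom R I0 (self_module R)"
    "carrier I0 = ?h ` carrier (self_module R)"
    using module_transport[OF S hinj] .
  interpret I0: module R I0 by (rule I0(1))
  have I0inj: "injective_module R I0"
  proof (rule injective_retract[OF I0(1) inj I0(3,2)])
    fix x assume "x \<in> carrier I0"
    then show "?h (the_inv_into (carrier (self_module R)) ?h x) = x"
      unfolding I0(4) by (rule f_the_inv_into_f[OF hinj])
  qed
  define Z where "Z = I0\<lparr>carrier := {\<zero>\<^bsub>I0\<^esub>}\<rparr>"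
  have Z: "module R Z" unfolding Z_def
    by (rule submodule.submodule_is_module[OF I0.submodule_zero_module I0(1)])
  have Zc: "carrier Z = {\<zero>\<^bsub>I0\<^esub>}" "\<zero>\<^bsub>Z\<^esub> = \<zero>\<^bsub>I0\<^esub>" by (simp_all add: Z_def)
  have Zinj: "injective_module R Z"
  proof (rule injective_retract[OF Z I0inj])
    show "(\<lambda>x. x) \<in> rmod_hom R Z I0" by (rule rmod_homI) (simp_all add: Z_def)
    show "(\<lambda>_. \<zero>\<^bsub>Z\<^esub>) \<in> rmod_hom R I0 Z" by (rule rmod_hom_zero_map[OF Z])
  qed (simp add: Zc)
  define I where "I i = (if i = (0::nat) then I0 else Z)" for i
  have "injective_resolution R (self_module R) I ?h (\<lambda>_ _. \<zero>\<^bsub>Z\<^esub>)"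
    unfolding injective_resolution_def
  proof (intro conjI allI)
    show "injective_module R (I i)" for i using I0inj Zinj by (simp add: I_def)
    show "?h \<in> rmod_hom R (self_module R) (I 0)" using I0(2) by (simp add: I_def)
    show "inj_on ?h (carrier (self_module R))" by (rule hinj)
    show "(\<lambda>_. \<zero>\<^bsub>Z\<^esub>) \<in> rmod_hom R (I i) (I (Suc i))" for i
      by (cases "i = 0") (simp_all add: I_def rmod_hom_zero_map[OF Z])
    show "?h ` carrier (self_module R) = rmod_kernel (I 0) (I 1) (\<lambda>_. \<zero>\<^bsub>Z\<^esub>)"
      unfolding I0(4)[symmetric] by (simp add: I_def rmod_kernel_def)
    show "(\<lambda>_. \<zero>\<^bsub>Z\<^esub>) ` carrier (I i) = rmod_kernel (I (Suc i)) (I (Suc (Suc i))) (\<lambda>_. \<zero>\<^bsub>Z\<^esub>)" for i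
      using I0.M.zero_closed by (auto simp: I_def rmod_kernel_def Zc)
  qed
  moreover have "\<forall>i>0. carrier (I i) = {\<zero>\<^bsub>I i\<^esub>}" by (simp add: I_def Zc)
  ultimately show ?thesis unfolding finite_injective_dimension_def by blast
qed

text \<open>If y generates the socle and y x is nonzero, then r -> r x is an isomorphism from R to
  E: it is injective because its kernel avoids the socle, and surjective because R x is the double
  annihilator of itself, which is E. So R inherits injectivity.\<close>

lemma (in cube_zero_matlis) injective_if_soc_cyclic:
  assumes y: "y \<in> soc" "soc \<subseteq> S.cyc y"
  shows "injective_module R (self_module R)"
proof -
  have c: "submodule (carrier R) R (self_module R)" using S.carrier_is_submodule by simp
  have "\<one> \<noteq> \<zero>" using one_notin S.submodule_zero[OF m_ideal] by auto
  then obtain z where z: "z \<in> soc" "z \<noteq> \<zero>" using ideal_meets_soc[OF c R.one_closed] by blast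
  then obtain r where r: "r \<in> carrier R" "z = r \<otimes> y" using y(2) by (auto simp: S.cyc_def)
  have y0: "y \<noteq> \<zero>" using r z(2) by auto
  note yc = soc_carrier[OF y(1)]
  obtain x where x: "x \<in> carrier E" "y \<odot>\<^bsub>E\<^esub> x \<noteq> \<zero>\<^bsub>E\<^esub>" using faithful[OF yc] y0 by blast
  \<comment> \<open>A nonzero annihilator of x contains a nonzero w = q y in the socle. Here q is a
    unit, since m kills y, so y x would be zero.\<close>
  have ann: "t = \<zero>" if t: "t \<in> carrier R" "t \<odot>\<^bsub>E\<^esub> x = \<zero>\<^bsub>E\<^esub>" for t
  proof (rule ccontr)
    assume t0: "t \<noteq> \<zero>"
    have J: "submodule (annR {x}) R (self_module R)" by (rule submodule_annR) (use x(1) in simp)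
    have "t \<in> annR {x}" using t by (simp add: annR_def)
    from ideal_meets_soc[OF J this t0] obtain w where w: "w \<in> annR {x}" "w \<in> soc" "w \<noteq> \<zero>" .
    obtain q where q: "q \<in> carrier R" "w = q \<otimes> y" using y(2) w(2) by (auto simp: S.cyc_def)
    have "q \<notin> m" using q w(3) soc_mult[OF y(1)] by blast
    moreover have "q \<odot>\<^bsub>E\<^esub> (y \<odot>\<^bsub>E\<^esub> x) = \<zero>\<^bsub>E\<^esub>" using w(1) q yc x(1) by (simp add: annR_def E.smult_assoc1)
    moreover obtain p where "p \<in> carrier R" "p \<odot>\<^bsub>E\<^esub> (q \<odot>\<^bsub>E\<^esub> (y \<odot>\<^bsub>E\<^esub> x)) = y \<odot>\<^bsub>E\<^esub> x"
      using unit_cancel[OF E.module_axioms q(1) calculation(1), of "y \<odot>\<^bsub>E\<^esub> x"] yc x(1) by blast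
    ultimately show False using x(2) by simp
  qed
  have "annR (E.cyc x) = {\<zero>}"
    using ann E.cyc_self[OF x(1)] E.submodule_in_carrier[OF E.submodule_cyc[OF x(1)]]
    by (auto simp: annR_def)
  then have cyc: "E.cyc x = carrier E" using annE_annR[OF E.submodule_cyc[OF x(1)]] annE_zero by simp
  let ?f = "\<lambda>r. r \<odot>\<^bsub>E\<^esub> x"
  have f: "?f \<in> rmod_hom R (self_module R) E"
    by (rule rmod_homI) (use x(1) in \<open>auto simp: E.smult_l_distr E.smult_assoc1\<close>)
  have ker: "s = \<zero>\<^bsub>self_module R\<^esub>" if "s \<in> carrier (self_module R)" "?f s = \<zero>\<^bsub>E\<^esub>" for s
    using ann that by simp
  have idh: "(\<lambda>s. s) \<in> rmod_hom R (self_module R) (self_module R)" by (rule rmod_homI) auto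
  obtain g where g: "g \<in> rmod_hom R (E\<lparr>carrier := ?f ` carrier (self_module R)\<rparr>) (self_module R)"
    "\<And>s. s \<in> carrier (self_module R) \<Longrightarrow> g (?f s) = s"
    using rmod_hom_factor[OF S.module_axioms E.module_axioms S.module_axioms f idh ker] by blast
  have "?f ` carrier (self_module R) = carrier E" using cyc by (auto simp: E.cyc_def)
  then have "g \<in> rmod_hom R E (self_module R)" using g(1) by simp
  from injective_retract[OF S.module_axioms E_inj f this g(2)] show ?thesis .
qed

theorem corollary3p16:
  fixes R :: "('a, 'r) ring_scheme" and m :: "'a set"
    and E :: "('a, 'e) module" and M :: "('a, 'c) module"
    and Y :: "nat \<Rightarrow> ('a, 'x) module" and n :: "nat \<Rightarrow> nat" and s j :: nat
    and p :: "(nat \<Rightarrow> 'x) \<Rightarrow> 'c"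
  assumes "noetherian_local_ring R m"
    and "m \<cdot>\<^bsub>R\<^esub> m \<cdot>\<^bsub>R\<^esub> m = {\<zero>\<^bsub>R\<^esub>}"
    and "2 * enat (min_num_generators R (ideal_module R m)) \<noteq> module_length R (self_module R)"
    and "injective_hull R (residue_field_module R m) E"
    and "module R M" and "\<not> is_zero_module M"
    and "\<And>t. t < s \<Longrightarrow> is_syzygy R m (residue_field_module R m) (n t) (Y t)"
    and "p \<in> rmod_hom R (finite_direct_sum {..<s} Y) M"
    and "p ` carrier (finite_direct_sum {..<s} Y) = carrier M"
    and "j \<ge> 3"
    and "\<And>i. i \<in> {j, j + 1, j + 2} \<Longrightarrow> is_zero_module (ext_module R E M i)"
  shows "gorenstein_local_ring R m"
proof (rule ccontr)
  assume not_gor: "\<not> gorenstein_local_ring R m"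
  interpret cube_zero_local R m by (rule cube_zero_local_if_noetherian[OF assms(1,2)])
  obtain x0 where "cube_zero_matlis R m E x0" using injective_hull_matlis[OF assms(4)] .
  then interpret cube_zero_matlis R m E x0 .
  interpret M: module R M by fact
  \<comment> \<open>With a cyclic socle R would be injective over itself, hence Gorenstein.\<close>
  have not_cyclic: "\<not> soc \<subseteq> S.cyc y" if "y \<in> soc" for y
    using injective_if_soc_cyclic[OF that] finite_injective_dimension_if_injective[OF R.is_cring]
      not_gor assms(1) unfolding gorenstein_local_ring_def by blast
  have soc_m: "soc \<subseteq> m" by (rule soc_le_m[OF not_cyclic])
  note syz = syzygy_finite_length_soc[OF assms(7) soc_m]
  let ?P = "finite_direct_sum {..<s} Y"
  have P: "module R ?P" by (rule module_finite_direct_sum[OF R.is_cring]) (simp add: syz(1))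
  interpret P: module R ?P by (rule P)
  have "P.len (carrier ?P) = (\<Sum>i<s. module.len R (Y i) (carrier (Y i)))"
    using len_PiE[OF R.is_cring, of s Y "\<lambda>i. carrier (Y i)"]
    by (simp add: syz(1) module.carrier_is_submodule)
  also have "\<dots> \<noteq> \<infinity>"
    by (rule sum_enat_not_infinity) (use syz(2) in blast)+
  finally have finP: "P.len (carrier ?P) \<noteq> \<infinity>" .
  have "P.len (carrier ?P) = P.len (carrier ?P \<inter> rmod_kernel ?P M p) + M.len (carrier M)"
    using len_hom[OF P M.module_axioms assms(8) P.carrier_is_submodule] unfolding assms(9) .
  then have finM: "M.len (carrier M) \<noteq> \<infinity>" using finP by (metis plus_eq_infty_iff_enat)
  have socM: "y \<odot>\<^bsub>M\<^esub> x = \<zero>\<^bsub>M\<^esub>" if y: "y \<in> soc" and x: "x \<in> carrier M" for x y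
  proof -
    have "x \<in> p ` carrier ?P" unfolding assms(9) by (rule x)
    then obtain w where w: "w \<in> carrier ?P" "x = p w" by blast
    have "y \<odot>\<^bsub>?P\<^esub> w = \<zero>\<^bsub>?P\<^esub>" using w(1) syz(3)[OF _ y] by (auto intro!: restrict_ext)
    then show ?thesis
      using rmod_homD(3)[OF assms(8) soc_carrier[OF y] w(1)] rmod_hom_zero[OF P M.module_axioms assms(8)] w(2)
      by simp
  qed
  obtain k \<phi> \<delta> where \<phi>: "\<phi> \<in> rmod_hom R M (Es (k 0))" "inj_on \<phi> (carrier M)"
      "\<And>z. in_soc (k 0) z \<Longrightarrow> z \<in> \<phi> ` carrier M"
    and \<delta>: "\<And>q. \<delta> q \<in> rmod_hom R (Es (k q)) (Es (k (Suc q)))"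
    and ex0: "rmod_kernel (Es (k 0)) (Es (k 1)) (\<delta> 0) = \<phi> ` carrier M"
    and ex: "\<And>q. rmod_kernel (Es (k (Suc q))) (Es (k (Suc (Suc q)))) (\<delta> (Suc q)) = \<delta> q ` carrier (Es (k q))"
    and soc\<delta>: "\<And>q z. in_soc (k (Suc q)) z \<Longrightarrow> z \<in> \<delta> q ` carrier (Es (k q))"
    by (rule minimal_injective_resolution[OF M.module_axioms finM]) (rule that)
  have "\<exists>r. r \<in> rmod_hom R (Rs (k q)) (Rs (k (Suc q))) \<and>
      (\<forall>v\<in>carrier (Rs (k q)). \<forall>x\<in>carrier E. \<delta> q (act (k q) v x) = act (k (Suc q)) (r v) x)" for q
    by (rule induced_hom[OF \<delta>[of q]]) blast
  then obtain \<rho> where \<rho>: "\<And>q. \<rho> q \<in> rmod_hom R (Rs (k q)) (Rs (k (Suc q)))"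
    "\<And>q v x. v \<in> carrier (Rs (k q)) \<Longrightarrow> x \<in> carrier E \<Longrightarrow> \<delta> q (act (k q) v x) = act (k (Suc q)) (\<rho> q v) x"
    by metis
  interpret minimal_injective_complex R m E x0 k \<delta> \<rho>
  proof (intro minimal_injective_complex.intro cube_zero_matlis_axioms minimal_injective_complex_axioms.intro \<delta> ex \<rho> not_cyclic)
    fix q z assume z: "in_soc (k q) z"
    have "z \<in> rmod_kernel (Es (k q)) (Es (k (Suc q))) (\<delta> q)"
    proof (cases q)
      case 0
      then show ?thesis using \<phi>(3) z ex0 by simp
    next
      case (Suc q')
      then show ?thesis using soc\<delta>[of q' z] z ex[of q'] by simp
    qed
    then show "\<delta> q z = \<zero>\<^bsub>Es (k (Suc q))\<^esub>" unfolding rmod_kernel_def by blast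
  next
    fix x y i assume "x \<in> rmod_kernel (Es (k 0)) (Es (k 1)) (\<delta> 0)" and y: "y \<in> soc" and i: "i < k 0"
    then obtain w where w: "w \<in> carrier M" "x = \<phi> w" using ex0 by blast
    have "y \<odot>\<^bsub>Es (k 0)\<^esub> \<phi> w = \<zero>\<^bsub>Es (k 0)\<^esub>"
      using rmod_homD(3)[OF \<phi>(1) soc_carrier[OF y] w(1)] socM[OF y w(1)]
        rmod_hom_zero[OF M.module_axioms Es \<phi>(1)] by simp
    from fun_cong[OF this, of i] show "y \<odot>\<^bsub>E\<^esub> x i = \<zero>\<^bsub>E\<^esub>" using i w(2) by simp
  next
    show "k 0 > 0"
    proof (rule ccontr)
      assume "\<not> k 0 > 0"
      then have k0: "k 0 = 0" by simp
      have "x = \<zero>\<^bsub>M\<^esub>" if x: "x \<in> carrier M" for x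
        using inj_onD[OF \<phi>(2) _ x M.M.zero_closed] rmod_homD(1)[OF \<phi>(1) x]
          rmod_homD(1)[OF \<phi>(1) M.M.zero_closed] by (simp add: k0)
      then show False using assms(6) unfolding is_zero_module_def by blast
    qed
  qed
  obtain b \<epsilon> d where res: "free_resolution R E b \<epsilon> d"
    and ext: "\<And>i. ext_module R E M i = hom_cohomology R b d M i"
    using ext_module_resolution[OF free_resolution_exists[OF E.module_axioms _ fin_length_E], where ?'c = 'c]
      fin_length by (metis self_module_simps(2))
  \<comment> \<open>The free resolution of E fixed by \<open>ext_module\<close> is paired with the
    minimal injective resolution of M.\<close>
  interpret X: ext_double_complex R E M b \<epsilon> d "\<lambda>q. Es (k q)" \<phi> \<delta>
    by (intro ext_double_complex.intro E.module_axioms M.module_axioms res Es_inj \<phi> \<delta> ex0 ex)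
  \<comment> \<open>\<open>exactR i\<close> concerns place i + 1, so degrees j, j + 1, j + 2 of Ext
    give it at j - 1, j, j + 1.\<close>
  have exact: "exactR i" if "Suc i \<in> {j, j + 1, j + 2}" for i
  proof (rule exactR_if)
    fix f assume "f \<in> rmod_hom R E (Es (k (Suc i)))"
      "\<And>x. x \<in> carrier E \<Longrightarrow> \<delta> (Suc i) (f x) = \<zero>\<^bsub>Es (k (Suc (Suc i)))\<^esub>"
    then show "\<exists>w\<in>rmod_hom R E (Es (k i)). \<forall>x\<in>carrier E. f x = \<delta> i (w x)"
      using X.hom_exact[of i f] assms(11)[OF that] ext by simp
  qed
  obtain q where q: "j = Suc q" using assms(10) by (cases j) auto
  have "S.len (carrier R) = 2 * enat (min_num_generators R (ideal_module R m))"
    by (rule length_eq[of q]) (use exact[of q] exact[of "Suc q"] exact[of "Suc (Suc q)"] q len_m in auto)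
  then show False
    using assms(3) module_length_eq_len[OF S.module_axioms] by simp
qed

end
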